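(* Let $\alpha,C_a,C_b,\beta>0$ be constants such that for all $\mathbf{u}\in V_h$, $\mathbf{U}\in T_M$, $\boldsymbol{\omega}\in R_M$, $q\in Q_h$, $\boldsymbol{\mu}\in\boldsymbol{\Lambda}_h$, writing $N^2=\|\mathbf{u}\|_V^2+\|\mathbf{U}\|_{T_M}^2+\|\boldsymbol{\omega}\|_{R_M}^2$ and $\mathbf{w}=\mathbf{u}-\mathbf{U}-\boldsymbol{\omega}\times\mathbf{r}$, $$\alpha N^2\le \frac{\mathrm{Re}}{\gamma\Delta t}m^t(\mathbf{u},\mathbf{u})+a^t(\mathbf{u},\mathbf{u})+c^t(\mathbf{w},\mathbf{w})\le C_aN^2,\qquad |b^t(q,\mathbf{u})+c^t(\boldsymbol{\mu},\mathbf{w})|\le C_b\left(\|q\|_Q^2+\|\boldsymbol{\mu}\|_{\boldsymbol{\Lambda}}^2\right)^{1/2}N,$$ and $$\inf_{(q,\boldsymbol{\mu})\in Q_h\times\boldsymbol{\Lambda}_h}\ \sup_{(\mathbf{u},\mathbf{U},\boldsymbol{\omega})\in V_h\times T_M\times R_M}\frac{b^t(q,\mathbf{u})+c^t(\boldsymbol{\mu},\mathbf{u}-\mathbf{U}-\boldsymbol{\omega}\times\mathbf{r})}{\left(\|q\|_Q^2+\|\boldsymbol{\mu}\|_{\boldsymbol{\Lambda}}^2\right)^{1/2}\left(\|\mathbf{u}\|_V^2+\|\mathbf{U}\|_{T_M}^2+\|\boldsymbol{\omega}\|_{R_M}^2\right)^{1/2}}=\beta$$ (inf and sup over nonzero elements).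 Then the condition number of the preconditioned Schur complement $\tilde{\mathbf{S}}^{-1}\mathbf{S}$ is bounded independently of the problem parameters, in the sense that $$\kappa(\tilde{\mathbf{S}}^{-1}\mathbf{S})\le C,$$ where the constant $C$ depends only on $\alpha,C_a,C_b,\beta$.
   Context: Geometry. Let $d\in\{2,3\}$, let $t$ be fixed, and let $\Omega\subset\mathbb{R}^d$ be a bounded Lipschitz domain (open, connected) containing a rigid-body region $\Omega_s^t$, a Lipschitz domain with $\overline{\Omega_s^t}\subset\Omega$. The fluid region is $\Omega_f^t=\Omega\setminus\overline{\Omega_s^t}$, assumed to be a Lipschitz domain. Let $\mathbf{x}_c$ be the centre of mass (centroid) of $\Omega_s^t$ and $\mathbf{r}=\mathbf{x}-\mathbf{x}_c$. The parameters $\mathrm{Re},\gamma,\Delta t$ are positive real numbers. For $d=2$ the angular velocity is a scalar $\omega$, identified with $\omega\mathbf{e}_3$, and $\boldsymbol{\omega}\times\mathbf{r}=\omega(-r_2,r_1)$. Forms. $\varepsilon(\mathbf{u})=\frac12(\nabla\mathbf{u}+\nabla\mathbf{u}^T)$, $(\cdot,\cdot)_w$ is the $L^2(w)$ inner product, and $$m^t(\mathbf{u},\mathbf{v})=(\mathbf{u},\mathbf{v})_\Omega,\quad a^t(\mathbf{u},\mathbf{v})=2(\varepsilon(\mathbf{u}),\varepsilon(\mathbf{v}))_\Omega,\quad b^t(p,\mathbf{v})=-\int_{\Omega_f^t}p\,\nabla\cdot\mathbf{v}\,d\mathbf{x},$$ $$c^t(\boldsymbol{\lambda},\boldsymbol{\mu})=\frac{\mathrm{Re}}{\gamma\Delta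 t}(\boldsymbol{\lambda},\boldsymbol{\mu})_{\Omega_s^t}+2(\varepsilon(\boldsymbol{\lambda}),\varepsilon(\boldsymbol{\mu}))_{\Omega_s^t}.$$ In $c^t$, functions on $\Omega$ are restricted to $\Omega_s^t$ and $\mathbf{U}\in\mathbb{R}^d$ is viewed as a constant vector field. Spaces and norms. $V=[H_0^1(\Omega)]^d$, $Q=L_0^2(\Omega_f^t)$ (zero-mean $L^2$ functions), $\boldsymbol{\Lambda}=[H^1(\Omega_s^t)]^d$, $T_M=\mathbb{R}^d$ (translations), $R_M$ = space of angular velocities ($\mathbb{R}^3$ if $d=3$, $\mathbb{R}$ if $d=2$), with $$\|\mathbf{u}\|_V^2=\frac{\mathrm{Re}}{\gamma\Delta t}(\mathbf{u},\mathbf{u})_\Omega+2(\varepsilon(\mathbf{u}),\varepsilon(\mathbf{u}))_\Omega,\quad \|\mathbf{U}\|_{T_M}^2=c^t(\mathbf{U},\mathbf{U}),\quad \|\boldsymbol{\omega}\|_{R_M}^2=c^t(\boldsymbol{\omega}\times\mathbf{r},\boldsymbol{\omega}\times\mathbf{r}),\quad \|\boldsymbol{\lambda}\|_{\boldsymbol{\Lambda}}^2=c^t(\boldsymbol{\lambda},\boldsymbol{\lambda}),$$ and $\|q\|_Q^2=\langle\tilde{S}q,q\rangle$, where $\tilde S=\left(M^{-1}+\frac{\mathrm{Re}}{\gamma\Delta t}A^{-1}\right)^{-1}:Q\to Q'$, with $M:Q\to Q'$, $\langle Mp,q\rangle=(p,q)_{\Omega_f^t}$, and $\langle Ap,q\rangle=(\nabla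 p,\nabla q)_{\Omega_f^t}$; that is, for $g\in Q'$, $A^{-1}g$ is the unique element of $H^1(\Omega_f^t)\cap Q$ with $(\nabla A^{-1}g,\nabla q)_{\Omega_f^t}=\langle g,q\rangle$ for all $q\in H^1(\Omega_f^t)\cap Q$. Discrete spaces. $\mathcal{T}_h$ is a simplicial mesh of $\Omega$ (possibly with curved isoparametric elements $K=F_K(\hat K)$, $F_K$ a polynomial map of degree 2 from the reference simplex $\hat K$) fitted to $\Omega_s^t$ and $\Omega_f^t$, i.e. each of these regions is a union of elements. The finite element spaces are $V_h=\{\mathbf{v}\in V:\mathbf{v}|_K\circ F_K\in[P_2(\hat K)]^d\ \forall K\}$; $Q_h=\{q\in Q\cap C(\overline{\Omega_f^t}):q|_K\circ F_K\in P_1(\hat K)\ \forall K\subset\Omega_f^t\}$; $\boldsymbol{\Lambda}_h=\{\boldsymbol{\mu}\in\boldsymbol{\Lambda}:\boldsymbol{\mu}|_K\circ F_K\in[P_2(\hat K)]^d\ \forall K\subset\Omega_s^t\}$. They carry the norms of $V,Q,\boldsymbol{\Lambda}$. Schur complement and preconditioner. Put $X_h=V_h\times T_M\times R_M$ and $Y_h=Q_h\times\boldsymbol{\Lambda}_h$. Define $\mathbf{A}:X_h\to X_h'$ and $\mathbf{B}:X_h\to Y_h'$ by $$\langle\mathbf{A}(\mathbf{u},\mathbf{U},\boldsymbol{\omega}),(\mathbf{v},\mathbf{V},\boldsymbol{\xi})\rangle=\frac{\mathrm{Re}}{\gamma\Delta t}m^t(\mathbf{u},\mathbf{v})+a^t(\mathbf{u},\mathbf{v})+c^t(\mathbf{u}-\mathbf{U}-\boldsymbol{\omega}\times\mathbf{r},\mathbf{v}-\mathbf{V}-\boldsymbol{\xi}\times\mathbf{r}),$$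 $$\langle\mathbf{B}(\mathbf{u},\mathbf{U},\boldsymbol{\omega}),(q,\boldsymbol{\eta})\rangle=b^t(q,\mathbf{u})+c^t(\boldsymbol{\eta},\mathbf{u}-\mathbf{U}-\boldsymbol{\omega}\times\mathbf{r}).$$ The Schur complement is $\mathbf{S}=\mathbf{B}\mathbf{A}^{-1}\mathbf{B}^T:Y_h\to Y_h'$, and $\tilde{\mathbf{S}}:Y_h\to Y_h'$ is the block-diagonal operator $\tilde{\mathbf S}=\mathrm{diag}(\tilde S,P_{\boldsymbol{\Lambda}})$ with $\langle P_{\boldsymbol{\Lambda}}\boldsymbol{\mu}_h,\boldsymbol{\nu}_h\rangle=c^t(\boldsymbol{\mu}_h,\boldsymbol{\nu}_h)$, i.e. $\langle\tilde{\mathbf{S}}(q,\boldsymbol{\mu}),(q,\boldsymbol{\mu})\rangle=\|q\|_Q^2+\|\boldsymbol{\mu}\|_{\boldsymbol{\Lambda}}^2$ on $Y_h$. Since $\tilde{\mathbf S}^{-1}\mathbf{S}$ is self-adjoint in the inner product induced by $\tilde{\mathbf S}$, $\kappa(\tilde{\mathbf S}^{-1}\mathbf{S})$ denotes the ratio of its largest to its smallest eigenvalue. *)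

theory Defs
  imports "HOL-Analysis.Analysis"
begin

text \<open>Elements of Lebesgue and Sobolev spaces on a region \<open>w\<close> are represented by total functions of which
  only the values on \<open>w\<close> matter, up to null sets. Hence equality in such a space is
  equality almost everywhere on \<open>w\<close>, and it is always written out as such below.\<close>

section \<open>Domains\<close>

text \<open>Locally, and in a suitable orthonormal frame whose last axis is \<open>e\<close>, the domain is the strict
  epigraph of a Lipschitz function defined on the hyperplane orthogonal to \<open>e\<close>.\<close>

definition lipschitz_domain :: "(real ^ 'n) set \<Rightarrow> bool" where
  "lipschitz_domain D \<longleftrightarrow>
     open D \<and> connected D \<and> bounded D \<and> D \<noteq> {} \<and>
     (\<forall>z \<in> frontier D. \<exists>U e L \<phi>. open U \<and> z \<in> U \<and> norm e = 1 \<and>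
        lipschitz_on L {y. y \<bullet> e = 0} (\<phi> :: real ^ 'n \<Rightarrow> real) \<and>
        D \<inter> U = {y \<in> U. \<phi> (y - (y \<bullet> e) *\<^sub>R e) < y \<bullet> e})"

definition centroid :: "(real ^ 'n) set \<Rightarrow> real ^ 'n" where
  "centroid D = (1 / measure lebesgue D) *\<^sub>R integral\<^sup>L (lebesgue_on D) (\<lambda>x. x)"


section \<open>Lebesgue and Sobolev spaces\<close>

definition L2 :: "(real ^ 'n) set \<Rightarrow> (real ^ 'n \<Rightarrow> 'b::euclidean_space) set" where
  "L2 w = {f \<in> borel_measurable (lebesgue_on w). integrable (lebesgue_on w) (\<lambda>x. (norm (f x))\<^sup>2)}"

definition L2_inner ::
    "(real ^ 'n) set \<Rightarrow> (real ^ 'n \<Rightarrow> 'b::euclidean_space) \<Rightarrow> (real ^ 'n \<Rightarrow> 'b) \<Rightarrow> real" where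
  "L2_inner w f g = integral\<^sup>L (lebesgue_on w) (\<lambda>x. f x \<bullet> g x)"

definition L2_0 :: "(real ^ 'n) set \<Rightarrow> (real ^ 'n \<Rightarrow> real) set" where
  "L2_0 w = {f \<in> L2 w. integral\<^sup>L (lebesgue_on w) f = 0}"

definition partial :: "'n \<Rightarrow> (real ^ 'n \<Rightarrow> real) \<Rightarrow> real ^ 'n \<Rightarrow> real" where
  "partial j f x = frechet_derivative f (at x) (axis j 1)"

primrec C_k :: "nat \<Rightarrow> (real ^ 'n \<Rightarrow> real) \<Rightarrow> bool" where
  "C_k 0 f \<longleftrightarrow> continuous_on UNIV f"
| "C_k (Suc k) f \<longleftrightarrow> (\<forall>x. f differentiable (at x)) \<and> (\<forall>j. C_k k (partial j f))"

definition test_functions :: "(real ^ 'n) set \<Rightarrow> (real ^ 'n \<Rightarrow> real) set" where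
  "test_functions w = {\<phi>. (\<forall>k. C_k k \<phi>) \<and>
     compact (closure {x. \<phi> x \<noteq> 0}) \<and> closure {x. \<phi> x \<noteq> 0} \<subseteq> w}"

definition is_weak_grad ::
    "(real ^ 'n) set \<Rightarrow> (real ^ 'n \<Rightarrow> real) \<Rightarrow> (real ^ 'n \<Rightarrow> real ^ 'n) \<Rightarrow> bool" where
  "is_weak_grad w f g \<longleftrightarrow> (\<forall>\<phi> \<in> test_functions w. \<forall>j.
     integral\<^sup>L (lebesgue_on w) (\<lambda>x. f x * partial j \<phi> x) =
     - integral\<^sup>L (lebesgue_on w) (\<lambda>x. g x $ j * \<phi> x))"

definition H1 :: "(real ^ 'n) set \<Rightarrow> (real ^ 'n \<Rightarrow> real) set" where
  "H1 w = {f \<in> L2 w. \<exists>g \<in> L2 w. is_weak_grad w f g}"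

definition grad :: "(real ^ 'n) set \<Rightarrow> (real ^ 'n \<Rightarrow> real) \<Rightarrow> real ^ 'n \<Rightarrow> real ^ 'n" where
  "grad w f = (SOME g. g \<in> L2 w \<and> is_weak_grad w f g)"

definition H1_norm :: "(real ^ 'n) set \<Rightarrow> (real ^ 'n \<Rightarrow> real) \<Rightarrow> real" where
  "H1_norm w f = sqrt (L2_inner w f f + L2_inner w (grad w f) (grad w f))"

definition H1_0 :: "(real ^ 'n) set \<Rightarrow> (real ^ 'n \<Rightarrow> real) set" where
  "H1_0 w = {f \<in> H1 w. \<forall>e>0. \<exists>\<phi> \<in> test_functions w. H1_norm w (\<lambda>x. f x - \<phi> x) < e}"

definition vec_fields :: "(real ^ 'n \<Rightarrow> real) set \<Rightarrow> (real ^ 'n \<Rightarrow> real ^ 'n) set" where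
  "vec_fields X = {u. \<forall>i. (\<lambda>x. u x $ i) \<in> X}"

text \<open>The Jacobian, with rows indexed by the components of the field.\<close>

definition vgrad :: "(real ^ 'n) set \<Rightarrow> (real ^ 'n \<Rightarrow> real ^ 'n) \<Rightarrow> real ^ 'n \<Rightarrow> real ^ 'n ^ 'n" where
  "vgrad w u x = (\<chi> i. grad w (\<lambda>y. u y $ i) x)"

definition strain :: "(real ^ 'n) set \<Rightarrow> (real ^ 'n \<Rightarrow> real ^ 'n) \<Rightarrow> real ^ 'n \<Rightarrow> real ^ 'n ^ 'n" where
  "strain w u x = (1/2) *\<^sub>R (vgrad w u x + transpose (vgrad w u x))"

definition divergence :: "(real ^ 'n) set \<Rightarrow> (real ^ 'n \<Rightarrow> real ^ 'n) \<Rightarrow> real ^ 'n \<Rightarrow> real" where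
  "divergence w u x = trace (vgrad w u x)"


section \<open>Isoparametric simplicial meshes\<close>

definition polys :: "nat \<Rightarrow> (real ^ 'n \<Rightarrow> real) set" where
  "polys k = {p. \<exists>c :: ('n \<Rightarrow> nat) \<Rightarrow> real.
     \<forall>x. p x = (\<Sum>a | (\<Sum>i\<in>UNIV. a i) \<le> k. c a * (\<Prod>i\<in>UNIV. (x $ i) ^ a i))}"

definition ref_vertices :: "(real ^ 'n) set" where
  "ref_vertices = insert 0 Basis"

definition ref_simplex :: "(real ^ 'n) set" where
  "ref_simplex = convex hull ref_vertices"

text \<open>A mesh is given by its element maps, one for each element \<open>F ` ref_simplex\<close>. Elements are closed
  sets. Two different elements meet in a common proper face, possibly the empty one.\<close>

definition isoparametric_mesh :: "(real ^ 'n \<Rightarrow> real ^ 'n) set \<Rightarrow> (real ^ 'n) set \<Rightarrow> bool" where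
  "isoparametric_mesh T D \<longleftrightarrow>
     finite T \<and>
     (\<forall>F \<in> T. F \<in> vec_fields (polys 2) \<and> inj_on F ref_simplex) \<and>
     (\<Union>F \<in> T. F ` ref_simplex) = closure D \<and>
     (\<forall>F \<in> T. \<forall>G \<in> T. F \<noteq> G \<longrightarrow>
        (\<exists>I J. I \<subset> ref_vertices \<and> J \<subset> ref_vertices \<and>
           F ` ref_simplex \<inter> G ` ref_simplex = F ` (convex hull I) \<and>
           F ` ref_simplex \<inter> G ` ref_simplex = G ` (convex hull J)))"

definition fitted :: "(real ^ 'n \<Rightarrow> real ^ 'n) set \<Rightarrow> (real ^ 'n) set \<Rightarrow> bool" where
  "fitted T w \<longleftrightarrow> (\<exists>T' \<subseteq> T. (\<Union>F \<in> T'. F ` ref_simplex) = closure w)"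

definition piecewise_poly ::
    "(real ^ 'n \<Rightarrow> real ^ 'n) set \<Rightarrow> (real ^ 'n) set \<Rightarrow> nat \<Rightarrow> (real ^ 'n \<Rightarrow> real) set" where
  "piecewise_poly T w k = {v. \<forall>F \<in> T. F ` ref_simplex \<subseteq> closure w \<longrightarrow>
     (\<exists>p \<in> polys k. AE y in lebesgue_on ref_simplex. v (F y) = p y)}"


section \<open>The coupled fluid-rigid body problem\<close>

text \<open>Here \<open>rot \<omega> r\<close> stands for \<open>\<omega> \<times> r\<close>; it is instantiated with \<open>rot2\<close> for \<open>d = 2\<close> and with
  \<open>cross3\<close> for \<open>d = 3\<close>. The angular velocities form the type \<open>'r\<close>, the translational
  velocities the type \<open>real ^ 'n\<close>.\<close>

definition rot2 :: "real \<Rightarrow> real ^ 2 \<Rightarrow> real ^ 2" where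
  "rot2 \<omega> r = \<omega> *\<^sub>R vector [- (r $ 2), r $ 1]"

type_synonym ('n, 'r) xvec = "(real ^ 'n \<Rightarrow> real ^ 'n) \<times> (real ^ 'n) \<times> 'r"

type_synonym 'n yvec = "(real ^ 'n \<Rightarrow> real) \<times> (real ^ 'n \<Rightarrow> real ^ 'n)"

locale fsi =
  fixes rot :: "'r::euclidean_space \<Rightarrow> real ^ 'n \<Rightarrow> real ^ 'n"
    and \<Omega> \<Omega>s :: "(real ^ 'n) set"
    and T :: "(real ^ 'n \<Rightarrow> real ^ 'n) set"
    and Rey \<gamma> dt :: real
  assumes domain: "lipschitz_domain \<Omega>"
    and solid_domain: "lipschitz_domain \<Omega>s"
    and solid_inside: "closure \<Omega>s \<subseteq> \<Omega>"
    and fluid_domain: "lipschitz_domain (\<Omega> - closure \<Omega>s)"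
    and mesh: "isoparametric_mesh T \<Omega>"
    and mesh_fitted: "fitted T \<Omega>s" "fitted T (\<Omega> - closure \<Omega>s)"
    and params_pos: "Rey > 0" "\<gamma> > 0" "dt > 0"
begin

definition \<Omega>f :: "(real ^ 'n) set" where
  "\<Omega>f = \<Omega> - closure \<Omega>s"

definition mass_coeff :: real where
  "mass_coeff = Rey / (\<gamma> * dt)"


subsection \<open>Forms\<close>

definition m_form :: "(real ^ 'n \<Rightarrow> real ^ 'n) \<Rightarrow> (real ^ 'n \<Rightarrow> real ^ 'n) \<Rightarrow> real" where
  "m_form u v = L2_inner \<Omega> u v"

definition a_form :: "(real ^ 'n \<Rightarrow> real ^ 'n) \<Rightarrow> (real ^ 'n \<Rightarrow> real ^ 'n) \<Rightarrow> real" where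
  "a_form u v = 2 * L2_inner \<Omega> (strain \<Omega> u) (strain \<Omega> v)"

definition b_form :: "(real ^ 'n \<Rightarrow> real) \<Rightarrow> (real ^ 'n \<Rightarrow> real ^ 'n) \<Rightarrow> real" where
  "b_form p v = - integral\<^sup>L (lebesgue_on \<Omega>f) (\<lambda>x. p x * divergence \<Omega> v x)"

definition c_form :: "(real ^ 'n \<Rightarrow> real ^ 'n) \<Rightarrow> (real ^ 'n \<Rightarrow> real ^ 'n) \<Rightarrow> real" where
  "c_form l m = mass_coeff * L2_inner \<Omega>s l m + 2 * L2_inner \<Omega>s (strain \<Omega>s l) (strain \<Omega>s m)"

definition rotation :: "'r \<Rightarrow> real ^ 'n \<Rightarrow> real ^ 'n" where
  "rotation \<omega> x = rot \<omega> (x - centroid \<Omega>s)"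

definition slip :: "(real ^ 'n \<Rightarrow> real ^ 'n) \<Rightarrow> real ^ 'n \<Rightarrow> 'r \<Rightarrow> real ^ 'n \<Rightarrow> real ^ 'n" where
  "slip u U \<omega> x = u x - U - rotation \<omega> x"


subsection \<open>Spaces and norms\<close>

definition V :: "(real ^ 'n \<Rightarrow> real ^ 'n) set" where
  "V = vec_fields (H1_0 \<Omega>)"

definition Q :: "(real ^ 'n \<Rightarrow> real) set" where
  "Q = L2_0 \<Omega>f"

definition Lam :: "(real ^ 'n \<Rightarrow> real ^ 'n) set" where
  "Lam = vec_fields (H1 \<Omega>s)"

definition V_norm2 :: "(real ^ 'n \<Rightarrow> real ^ 'n) \<Rightarrow> real" where
  "V_norm2 u = mass_coeff * L2_inner \<Omega> u u + 2 * L2_inner \<Omega> (strain \<Omega> u) (strain \<Omega> u)"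

definition T_norm2 :: "real ^ 'n \<Rightarrow> real" where
  "T_norm2 U = c_form (\<lambda>x. U) (\<lambda>x. U)"

definition R_norm2 :: "'r \<Rightarrow> real" where
  "R_norm2 \<omega> = c_form (rotation \<omega>) (rotation \<omega>)"

definition Lam_norm2 :: "(real ^ 'n \<Rightarrow> real ^ 'n) \<Rightarrow> real" where
  "Lam_norm2 l = c_form l l"

text \<open>Elements of \<open>Q'\<close> are functionals on \<open>Q\<close>, made extensional so that equality of functionals is
  equality in HOL. The operator \<open>A\<^sup>-\<^sup>1\<close> is a relation: \<open>A_inverse g w\<close> says \<open>A\<^sup>-\<^sup>1 g = w\<close>.\<close>

definition M_op :: "(real ^ 'n \<Rightarrow> real) \<Rightarrow> (real ^ 'n \<Rightarrow> real) \<Rightarrow> real" where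
  "M_op p = (\<lambda>q\<in>Q. L2_inner \<Omega>f p q)"

definition A_inverse :: "((real ^ 'n \<Rightarrow> real) \<Rightarrow> real) \<Rightarrow> (real ^ 'n \<Rightarrow> real) \<Rightarrow> bool" where
  "A_inverse g w \<longleftrightarrow> w \<in> H1 \<Omega>f \<inter> Q \<and>
     (\<forall>q \<in> H1 \<Omega>f \<inter> Q. L2_inner \<Omega>f (grad \<Omega>f w) (grad \<Omega>f q) = g q)"

text \<open>\<open>S_tilde p\<close> is the \<open>g \<in> Q'\<close> with \<open>M\<^sup>-\<^sup>1 g + (Re / (\<gamma> \<Delta>t)) A\<^sup>-\<^sup>1 g = p\<close>; here \<open>m = M\<^sup>-\<^sup>1 g\<close>
  and \<open>w = A\<^sup>-\<^sup>1 g\<close>. That \<open>g\<close> is a bounded linear functional follows from \<open>g = M_op m\<close>.\<close>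

definition S_tilde :: "(real ^ 'n \<Rightarrow> real) \<Rightarrow> (real ^ 'n \<Rightarrow> real) \<Rightarrow> real" where
  "S_tilde p = (THE g. \<exists>m \<in> Q. \<exists>w. M_op m = g \<and> A_inverse g w \<and>
     (AE x in lebesgue_on \<Omega>f. m x + mass_coeff * w x = p x))"

definition Q_norm2 :: "(real ^ 'n \<Rightarrow> real) \<Rightarrow> real" where
  "Q_norm2 q = S_tilde q q"


subsection \<open>Discrete spaces\<close>

definition V_h :: "(real ^ 'n \<Rightarrow> real ^ 'n) set" where
  "V_h = V \<inter> vec_fields (piecewise_poly T \<Omega> 2)"

definition Q_h :: "(real ^ 'n \<Rightarrow> real) set" where
  "Q_h = {q \<in> Q. continuous_on (closure \<Omega>f) q} \<inter> piecewise_poly T \<Omega>f 1"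

definition Lam_h :: "(real ^ 'n \<Rightarrow> real ^ 'n) set" where
  "Lam_h = Lam \<inter> vec_fields (piecewise_poly T \<Omega>s 2)"

definition X_h :: "('n, 'r) xvec set" where
  "X_h = V_h \<times> UNIV \<times> UNIV"

definition Y_h :: "'n yvec set" where
  "Y_h = Q_h \<times> Lam_h"

definition X_norm2 :: "('n, 'r) xvec \<Rightarrow> real" where
  "X_norm2 = (\<lambda>(u, U, \<omega>). V_norm2 u + T_norm2 U + R_norm2 \<omega>)"

definition Y_norm2 :: "'n yvec \<Rightarrow> real" where
  "Y_norm2 = (\<lambda>(q, \<mu>). Q_norm2 q + Lam_norm2 \<mu>)"

definition X_eq :: "('n, 'r) xvec \<Rightarrow> ('n, 'r) xvec \<Rightarrow> bool" where
  "X_eq = (\<lambda>(u, U, \<omega>) (v, W, \<xi>). (AE x in lebesgue_on \<Omega>. u x = v x) \<and> U = W \<and> \<omega> = \<xi>)"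

definition Y_eq :: "'n yvec \<Rightarrow> 'n yvec \<Rightarrow> bool" where
  "Y_eq = (\<lambda>(q, \<mu>) (r, \<nu>). (AE x in lebesgue_on \<Omega>f. q x = r x) \<and> (AE x in lebesgue_on \<Omega>s. \<mu> x = \<nu> x))"

definition X_nonzero :: "('n, 'r) xvec set" where
  "X_nonzero = {x \<in> X_h. \<not> X_eq x (\<lambda>_. 0, 0, 0)}"

definition Y_nonzero :: "'n yvec set" where
  "Y_nonzero = {y \<in> Y_h. \<not> Y_eq y (\<lambda>_. 0, \<lambda>_. 0)}"


subsection \<open>Operators\<close>

definition form_A :: "('n, 'r) xvec \<Rightarrow> ('n, 'r) xvec \<Rightarrow> real" where
  "form_A = (\<lambda>(u, U, \<omega>) (v, W, \<xi>).
     mass_coeff * m_form u v + a_form u v + c_form (slip u U \<omega>) (slip v W \<xi>))"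

definition form_B :: "('n, 'r) xvec \<Rightarrow> 'n yvec \<Rightarrow> real" where
  "form_B = (\<lambda>(u, U, \<omega>) (q, \<eta>). b_form q u + c_form \<eta> (slip u U \<omega>))"

text \<open>The duals of \<open>X_h\<close> and \<open>Y_h\<close> consist of extensional functionals. The inverses below select some
  representative of the unique preimage.\<close>

definition A_op :: "('n, 'r) xvec \<Rightarrow> ('n, 'r) xvec \<Rightarrow> real" where
  "A_op x = (\<lambda>z\<in>X_h. form_A x z)"

definition B_op :: "('n, 'r) xvec \<Rightarrow> 'n yvec \<Rightarrow> real" where
  "B_op x = (\<lambda>y\<in>Y_h. form_B x y)"

definition B_transpose :: "'n yvec \<Rightarrow> ('n, 'r) xvec \<Rightarrow> real" where
  "B_transpose y = (\<lambda>x\<in>X_h. B_op x y)"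

definition schur :: "'n yvec \<Rightarrow> 'n yvec \<Rightarrow> real" where
  "schur y = B_op (inv_into X_h A_op (B_transpose y))"

definition precond :: "'n yvec \<Rightarrow> 'n yvec \<Rightarrow> real" where
  "precond = (\<lambda>(q, \<mu>). \<lambda>(r, \<nu>)\<in>Y_h. S_tilde q r + c_form \<mu> \<nu>)"

definition precond_schur :: "'n yvec \<Rightarrow> 'n yvec" where
  "precond_schur y = inv_into Y_h precond (schur y)"

text \<open>Real eigenvalues suffice: the operator is self-adjoint for the inner product induced by
  \<open>precond\<close>. The set is finite because \<open>Y_h\<close> is finite-dimensional modulo \<open>Y_eq\<close>.\<close>

definition eigenvalues :: "real set" where
  "eigenvalues = {l. \<exists>(q, \<mu>) \<in> Y_nonzero. Y_eq (precond_schur (q, \<mu>)) (\<lambda>x. l * q x, \<lambda>x. l *\<^sub>R \<mu> x)}"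

definition condition_number :: real where
  "condition_number = Max eigenvalues / Min eigenvalues"


subsection \<open>Stability\<close>

definition stability_bounds :: "real \<Rightarrow> real \<Rightarrow> real \<Rightarrow> bool" where
  "stability_bounds \<alpha> C\<^sub>a C\<^sub>b \<longleftrightarrow> (\<forall>u \<in> V_h. \<forall>U \<omega>. \<forall>q \<in> Q_h. \<forall>\<mu> \<in> Lam_h.
     let N2 = V_norm2 u + T_norm2 U + R_norm2 \<omega>; w = slip u U \<omega> in
       \<alpha> * N2 \<le> mass_coeff * m_form u u + a_form u u + c_form w w \<and>
       mass_coeff * m_form u u + a_form u u + c_form w w \<le> C\<^sub>a * N2 \<and>
       \<bar>b_form q u + c_form \<mu> w\<bar> \<le> C\<^sub>b * sqrt (Q_norm2 q + Lam_norm2 \<mu>) * sqrt N2)"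

definition inf_sup_constant :: ereal where
  "inf_sup_constant = (INF y \<in> Y_nonzero. SUP x \<in> X_nonzero.
     ereal (form_B x y / (sqrt (Y_norm2 y) * sqrt (X_norm2 x))))"

end

end

theory Submission
  imports Defs "HOL-Library.Function_Algebras"
begin

text \<open>Let \<open>\<parallel>\<cdot>\<parallel>\<close> be the product norms, \<open>s(y) = \<langle>S y, y\<rangle>\<close> for the Schur complement \<open>S = B A\<^sup>-\<^sup>1 B\<^sup>T\<close>, and
  \<open>x = A\<^sup>-\<^sup>1 B\<^sup>T y\<close>. Then \<open>s(y) = \<langle>A x, x\<rangle> = \<langle>B x, y\<rangle>\<close>. The bound on \<open>B\<close> and the coercivity of
  \<open>A\<close> give \<open>s(y) \<le> (C\<^sub>b\<^sup>2 / \<alpha>) \<parallel>y\<parallel>\<^sup>2\<close> (\<open>schur_form_upper\<close>). Conversely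
  \<open>\<langle>B v, y\<rangle> = \<langle>A x, v\<rangle>\<close> for all \<open>v\<close>, so the Cauchy--Schwarz inequality for \<open>A\<close>, the upper bound on
  \<open>A\<close> and the inf-sup condition give \<open>(\<beta>\<^sup>2 / C\<^sub>a) \<parallel>y\<parallel>\<^sup>2 \<le> s(y)\<close> (\<open>schur_form_lower\<close>). The
  eigenvalues of the preconditioned operator are those of the form \<open>s\<close> relative to \<open>\<parallel>\<cdot>\<parallel>\<^sup>2\<close>
  (\<open>eigenvalues_eq\<close>). All of them lie in \<open>[\<beta>\<^sup>2 / C\<^sub>a, C\<^sub>b\<^sup>2 / \<alpha>]\<close>, and the condition number is at most
  \<open>C\<^sub>b\<^sup>2 C\<^sub>a / (\<alpha> \<beta>\<^sup>2)\<close>.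

  Most of the work is to show that the objects in this computation are what their names promise. The
  forms are bilinear because the weak gradient, an arbitrary choice, is unique almost everywhere
  (\<open>fundamental_lemma\<close>). The inverses of \<open>A\<close> and of the preconditioner are choices of preimages, which
  exist by the Riesz theorem in spaces that have finite dimension modulo null functions
  (\<open>finite_dim_Riesz\<close>, \<open>finite_dim_piecewise_poly\<close>), provided that the functional vanishes on the kernel
  of the form; for both inverses this follows from the bound on \<open>B\<close>. The pressure norm involves a Neumann
  problem in an infinite-dimensional space, solved by the Riesz theorem for complete spaces and the
  completeness of \<open>L\<^sup>2\<close> and \<open>H\<^sup>1\<close> (\<open>Riesz\<close>, \<open>L2_complete\<close>, \<open>H1_complete\<close>). Finally, the largest and
  the smallest eigenvalue exist since the set of eigenvalues is finite, by orthogonality of eigenvectors, and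
  nonempty, because the Rayleigh quotient attains its supremum (\<open>finite_relative_eigenvalues\<close>,
  \<open>relative_eigenvalues_nonempty\<close>).\<close>


section \<open>Functions as a real vector space\<close>

instantiation "fun" :: (type, real_vector) real_vector
begin

definition scaleR_fun :: "real \<Rightarrow> ('a \<Rightarrow> 'b) \<Rightarrow> 'a \<Rightarrow> 'b" where
  "scaleR_fun c f = (\<lambda>x. c *\<^sub>R f x)"

instance
  by standard (simp_all add: scaleR_fun_def fun_eq_iff scaleR_add_left scaleR_add_right)

end

lemma scaleR_fun_apply [simp]: "(c *\<^sub>R f) x = c *\<^sub>R f x"
  by (simp add: scaleR_fun_def)


section \<open>Semi-inner products on a subspace\<close>

text \<open>Representatives of \<open>L\<^sup>2\<close> and Sobolev functions live in the space of all functions, where the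
  integral forms are bilinear only on a subspace and where the null functions have length zero.\<close>

locale semi_inner =
  fixes V :: "'v::real_vector set" and f :: "'v \<Rightarrow> 'v \<Rightarrow> real"
  assumes sub: "subspace V"
    and add_left: "\<And>x y z. x \<in> V \<Longrightarrow> y \<in> V \<Longrightarrow> z \<in> V \<Longrightarrow> f (x + y) z = f x z + f y z"
    and scale_left: "\<And>c x z. x \<in> V \<Longrightarrow> z \<in> V \<Longrightarrow> f (c *\<^sub>R x) z = c * f x z"
    and sym: "\<And>x y. x \<in> V \<Longrightarrow> y \<in> V \<Longrightarrow> f x y = f y x"
    and nonneg: "\<And>x. x \<in> V \<Longrightarrow> 0 \<le> f x x"
begin

lemmas closed = subspace_0[OF sub] subspace_add[OF sub] subspace_diff[OF sub] subspace_scale[OF sub]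

lemma add_right: "x \<in> V \<Longrightarrow> y \<in> V \<Longrightarrow> z \<in> V \<Longrightarrow> f z (x + y) = f z x + f z y"
  using add_left[of x y z] sym closed by metis

lemma scale_right: "x \<in> V \<Longrightarrow> z \<in> V \<Longrightarrow> f z (c *\<^sub>R x) = c * f z x"
  using scale_left[of x z c] sym closed by metis

lemma diff_left: "x \<in> V \<Longrightarrow> y \<in> V \<Longrightarrow> z \<in> V \<Longrightarrow> f (x - y) z = f x z - f y z"
  using add_left[of x "(-1) *\<^sub>R y" z] scale_left[of y z "-1"] closed(4)[of y "-1"] by simp

lemma diff_right: "x \<in> V \<Longrightarrow> y \<in> V \<Longrightarrow> z \<in> V \<Longrightarrow> f z (x - y) = f z x - f z y"
  using diff_left[of x y z] sym closed by metis

lemmas bilin = add_left add_right scale_left scale_right diff_left diff_right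

lemma Cauchy_Schwarz:
  assumes "x \<in> V" "y \<in> V"
  shows "(f x y)\<^sup>2 \<le> f x x * f y y"
proof -
  \<comment> \<open>if \<open>y\<close> has length zero, this is affine in \<open>t\<close>, which forces the slope to vanish\<close>
  have q: "0 \<le> f x x - 2 * t * f x y + t\<^sup>2 * f y y" for t
    using nonneg[of "x - t *\<^sub>R y"] assms sym[of x y]
    by (simp add: bilin closed algebra_simps power2_eq_square)
  show ?thesis
  proof (cases "f y y = 0")
    case True
    have "f x y = 0"
    proof (rule ccontr)
      assume "f x y \<noteq> 0"
      then show False
        using q[of "(f x x + 1) / (2 * f x y)"] True by (simp add: field_simps)
    qed
    then show ?thesis by (simp add: True)
  next
    case False
    then have "f y y > 0" using nonneg[OF assms(2)] by simp
    then show ?thesis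
      using q[of "f x y / f y y"] by (simp add: field_simps power2_eq_square)
  qed
qed

lemma Cauchy_Schwarz_abs:
  assumes "x \<in> V" "y \<in> V"
  shows "\<bar>f x y\<bar> \<le> sqrt (f x x) * sqrt (f y y)"
  using real_sqrt_le_mono[OF Cauchy_Schwarz[OF assms]] by (simp add: real_sqrt_mult)

lemma null_orthogonal:
  assumes "x \<in> V" "y \<in> V" "f x x = 0"
  shows "f x y = 0"
  using Cauchy_Schwarz[OF assms(1,2)] assms(3) by simp

lemma triangle:
  assumes "x \<in> V" "y \<in> V"
  shows "sqrt (f (x + y) (x + y)) \<le> sqrt (f x x) + sqrt (f y y)"
proof (rule real_le_lsqrt)
  have "f (x + y) (x + y) = f x x + 2 * f x y + f y y"
    using assms sym[of x y] by (simp add: bilin closed)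
  also have "\<dots> \<le> f x x + 2 * (sqrt (f x x) * sqrt (f y y)) + f y y"
    using Cauchy_Schwarz_abs[OF assms] by simp
  also have "\<dots> = (sqrt (f x x) + sqrt (f y y))\<^sup>2"
    using assms by (simp add: power2_sum nonneg algebra_simps)
  finally show "f (x + y) (x + y) \<le> (sqrt (f x x) + sqrt (f y y))\<^sup>2" .
qed (use assms nonneg in simp)

end

text \<open>Linearity on a subspace only: the functionals below are defined by integrals and behave linearly
  only where the integrands are integrable.\<close>

definition linear_form_on :: "'v::real_vector set \<Rightarrow> ('v \<Rightarrow> real) \<Rightarrow> bool" where
  "linear_form_on V l \<longleftrightarrow> (\<forall>x\<in>V. \<forall>y\<in>V. l (x + y) = l x + l y) \<and> (\<forall>c. \<forall>x\<in>V. l (c *\<^sub>R x) = c * l x)"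

lemma linear_form_onI:
  assumes "\<And>x y. x \<in> V \<Longrightarrow> y \<in> V \<Longrightarrow> l (x + y) = l x + l y"
    and "\<And>c x. x \<in> V \<Longrightarrow> l (c *\<^sub>R x) = c * l x"
  shows "linear_form_on V l"
  using assms by (auto simp: linear_form_on_def)

lemma (in semi_inner) linear_form: "x \<in> V \<Longrightarrow> linear_form_on V (f x)"
  by (simp add: linear_form_on_def bilin)

text \<open>For a small multiple \<open>t\<close> of \<open>- a\<close> the linear term dominates.\<close>

lemma first_variation_zero:
  fixes a b :: real
  assumes "\<And>t. 0 \<le> 2 * t * a + t\<^sup>2 * b" "0 \<le> b"
  shows "a = 0"
proof (rule ccontr)
  assume "a \<noteq> 0"
  have "2 * (- a / (b + 1)) * a + (- a / (b + 1))\<^sup>2 * b = - (a\<^sup>2 * (b + 2)) / (b + 1)\<^sup>2"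
    using assms(2) by (simp add: divide_simps power2_eq_square) algebra
  also have "\<dots> < 0"
    using \<open>a \<noteq> 0\<close> assms(2) by (auto intro!: divide_neg_pos mult_pos_pos)
  finally show False using assms(1)[of "- a / (b + 1)"] by linarith
qed

locale complete_semi_inner = semi_inner +
  assumes complete: "\<And>X. (\<And>n. X n \<in> V) \<Longrightarrow>
      (\<And>e. 0 < e \<Longrightarrow> \<exists>N. \<forall>m\<ge>N. \<forall>n\<ge>N. f (X m - X n) (X m - X n) < e) \<Longrightarrow>
      \<exists>x\<in>V. (\<lambda>n::nat. f (X n - x) (X n - x)) \<longlonglongrightarrow> 0"
begin

text \<open>The representer minimises \<open>f x x - 2 l x\<close>. A minimising sequence is Cauchy by the parallelogram
  identity, and the vanishing first variation at its limit is the claim.\<close>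

theorem Riesz:
  assumes lin: "linear_form_on V l" and bdd: "\<And>x. x \<in> V \<Longrightarrow> \<bar>l x\<bar> \<le> K * sqrt (f x x)"
  shows "\<exists>v\<in>V. \<forall>x\<in>V. f v x = l x"
proof -
  define J where "J x = f x x - 2 * l x" for x
  define m where "m = Inf (J ` V)"
  have la: "l (x + y) = l x + l y" "l (c *\<^sub>R x) = c * l x" if "x \<in> V" "y \<in> V" for x y c
    using lin that by (auto simp: linear_form_on_def)
  have below: "- K\<^sup>2 \<le> J x" if "x \<in> V" for x
  proof -
    have "0 \<le> (sqrt (f x x) - K)\<^sup>2" by simp
    also have "\<dots> = f x x - 2 * (K * sqrt (f x x)) + K\<^sup>2"
      using nonneg[OF that] by (simp add: power2_diff algebra_simps)
    also have "\<dots> \<le> J x + K\<^sup>2"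
      using bdd[OF that] by (simp add: J_def abs_le_iff)
    finally show ?thesis by simp
  qed
  have bb: "bdd_below (J ` V)"
    using below by (rule bdd_belowI2)
  have m_le: "m \<le> J x" if "x \<in> V" for x
    unfolding m_def using bb that by (auto intro: cInf_lower)
  have "\<exists>x\<in>V. J x < m + 1 / (real n + 1)" for n
    using cInf_lessD[of "J ` V" "m + 1 / (real n + 1)"] closed(1) unfolding m_def by auto
  then obtain X where X: "\<And>n. X n \<in> V" "\<And>n. J (X n) < m + 1 / (real n + 1)" by metis
  have par: "f (x - y) (x - y) \<le> 2 * (J x - m) + 2 * (J y - m)" if "x \<in> V" "y \<in> V" for x y
  proof -
    have "f (x - y) (x - y) = 2 * J x + 2 * J y - 4 * J ((1/2) *\<^sub>R (x + y))"
      using that sym[of x y] by (simp add: J_def la bilin closed algebra_simps)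
    moreover have "m \<le> J ((1/2) *\<^sub>R (x + y))" using that by (intro m_le closed)
    ultimately show ?thesis by simp
  qed
  have rate: "J (X n) - m < 1 / (real N + 1)" if "n \<ge> N" for n N
    using X(2)[of n] that by (smt (verit) frac_le of_nat_0_le_iff of_nat_mono)
  have "\<exists>N. \<forall>m\<ge>N. \<forall>n\<ge>N. f (X m - X n) (X m - X n) < e" if "0 < e" for e
  proof -
    obtain N :: nat where "4 / e < real N" using reals_Archimedean2 by blast
    then have "4 / (real N + 1) < e" using that by (simp add: field_simps)
    then have "f (X i - X k) (X i - X k) < e" if "i \<ge> N" "k \<ge> N" for i k
      using par[OF X(1) X(1), of i k] rate[OF that(1)] rate[OF that(2)] by simp
    then show ?thesis by blast
  qed
  with complete X(1) obtain v where v: "v \<in> V" "(\<lambda>n. f (X n - v) (X n - v)) \<longlonglongrightarrow> 0" by blast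
  have "f v y = l y" if y: "y \<in> V" for y
  proof -
    have "(\<lambda>n. f (X n - v) y) \<longlonglongrightarrow> 0"
    proof (rule Lim_null_comparison)
      show "\<forall>\<^sub>F n in sequentially. norm (f (X n - v) y) \<le> sqrt (f (X n - v) (X n - v)) * sqrt (f y y)"
        using Cauchy_Schwarz_abs X(1) v(1) y by (auto simp: closed)
      show "(\<lambda>n. sqrt (f (X n - v) (X n - v)) * sqrt (f y y)) \<longlonglongrightarrow> 0"
        using tendsto_mult[OF tendsto_real_sqrt[OF v(2)] tendsto_const] by simp
    qed
    then have lim: "(\<lambda>n. f (X n) y) \<longlonglongrightarrow> f v y"
      using X(1) v(1) y by (simp add: diff_left LIM_zero_iff)
    have "0 \<le> 2 * t * (f v y - l y) + t\<^sup>2 * f y y" for t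
    proof (rule LIMSEQ_le)
      show "(\<lambda>n. - (1 / (real n + 1))) \<longlonglongrightarrow> 0"
        using tendsto_minus[OF LIMSEQ_inverse_real_of_nat] by (simp add: inverse_eq_divide add.commute)
      show "(\<lambda>n. 2 * t * (f (X n) y - l y) + t\<^sup>2 * f y y) \<longlonglongrightarrow> 2 * t * (f v y - l y) + t\<^sup>2 * f y y"
        by (intro tendsto_intros lim)
      have "J (X n + t *\<^sub>R y) = J (X n) + (2 * t * (f (X n) y - l y) + t\<^sup>2 * f y y)" for n
        using X(1)[of n] y sym[OF X(1)[of n] y]
        by (simp add: J_def la bilin closed algebra_simps power2_eq_square)
      then show "\<exists>N. \<forall>n\<ge>N. - (1 / (real n + 1)) \<le> 2 * t * (f (X n) y - l y) + t\<^sup>2 * f y y"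
        using X m_le[of "X _ + t *\<^sub>R y"] y by (intro exI[of _ 0] allI impI) (smt (verit) closed)
    qed
    from first_variation_zero[OF this nonneg[OF y]] show ?thesis by simp
  qed
  with v(1) show ?thesis by blast
qed

end


section \<open>Spaces of finite dimension modulo null elements\<close>

text \<open>Finite element functions form a finite-dimensional space only after functions that agree almost
  everywhere are identified. Instead of passing to a quotient, the null elements \<open>N\<close> are kept.\<close>

definition finite_dim_mod :: "'v::real_vector set \<Rightarrow> 'v set \<Rightarrow> bool" where
  "finite_dim_mod V N \<longleftrightarrow> (\<exists>B. finite B \<and> B \<subseteq> V \<and> (\<forall>x\<in>V. \<exists>y\<in>span B. x - y \<in> N))"

text \<open>Coordinates may be given by a relation \<open>R\<close>, which need be single-valued only up to \<open>N\<close>.\<close>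

lemma finite_dim_mod_coordinates:
  fixes R :: "('v::real_vector \<times> 'w::real_vector) set"
  assumes V: "subspace V" and C: "finite C" and R: "subspace R" "R \<subseteq> V \<times> span C"
    and total: "\<And>x. x \<in> V \<Longrightarrow> \<exists>w. (x, w) \<in> R"
    and null: "\<And>x. (x, 0) \<in> R \<Longrightarrow> x \<in> N"
  shows "finite_dim_mod V N"
proof -
  define D where "D = snd ` R"
  have D: "subspace D"
    unfolding D_def using R(1) by (intro linear_subspace_image linear_snd)
  obtain E where E: "E \<subseteq> D" "independent E" "D \<subseteq> span E"
    using maximal_independent_subset[of D] by blast
  have "finite E"
    using independent_span_bound[OF C E(2)] E(1) R(2) unfolding D_def by fastforce
  have "\<forall>w\<in>E. \<exists>x. (x, w) \<in> R" using E(1) unfolding D_def by force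
  then obtain g where g: "\<And>w. w \<in> E \<Longrightarrow> (g w, w) \<in> R" by metis
  show ?thesis
    unfolding finite_dim_mod_def
  proof (intro exI[of _ "g ` E"] conjI ballI)
    show "finite (g ` E)" using \<open>finite E\<close> by simp
    show "g ` E \<subseteq> V" using g R(2) by blast
    fix x assume "x \<in> V"
    then obtain w where w: "(x, w) \<in> R" using total by blast
    then have "w \<in> span E" using E(3) unfolding D_def by force
    then obtain k where k: "w = (\<Sum>v\<in>E. k v *\<^sub>R v)" using \<open>finite E\<close> by (auto simp: span_finite)
    define y where "y = (\<Sum>v\<in>E. k v *\<^sub>R g v)"
    have "(\<Sum>v\<in>E. k v *\<^sub>R (g v, v)) \<in> R"
      using g R(1) by (intro subspace_sum subspace_scale)
    then have "(y, w) \<in> R"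
      by (simp add: k y_def sum_prod)
    then have "(x - y, 0) \<in> R"
      using subspace_diff[OF R(1) w] by fastforce
    then have "x - y \<in> N" by (rule null)
    moreover have "y \<in> span (g ` E)"
      unfolding y_def by (intro span_sum span_scale span_base imageI)
    ultimately show "\<exists>y\<in>span (g ` E). x - y \<in> N" by blast
  qed
qed

locale finite_dim_semi_inner = semi_inner V f for V :: "'v::real_vector set" and f +
  fixes N :: "'v set"
  assumes fin_dim: "finite_dim_mod V N" and null: "\<And>x. x \<in> V \<Longrightarrow> x \<in> N \<Longrightarrow> f x x = 0"
begin

text \<open>Peel off one spanning vector \<open>b\<close> at a time. The induction hypothesis, applied to the functional
  \<open>f b\<close>, yields the orthogonal projection of \<open>b\<close> onto the span of the others.\<close>

lemma Riesz_span:
  assumes "finite B" "B \<subseteq> V" "linear_form_on V l" "\<And>x. x \<in> V \<Longrightarrow> f x x = 0 \<Longrightarrow> l x = 0"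
  shows "\<exists>v\<in>span B. \<forall>x\<in>span B. f v x = l x"
  using assms
proof (induction B arbitrary: l rule: finite_induct)
  case empty
  then show ?case using null_orthogonal[of 0 0] scale_left[of 0 0 0] closed(1) by auto
next
  case (insert b B)
  have bV: "b \<in> V" and BV: "B \<subseteq> V" using insert.prems by auto
  have spV: "span B \<subseteq> V" using BV sub by (simp add: span_minimal)
  obtain p where p: "p \<in> span B" "\<And>x. x \<in> span B \<Longrightarrow> f p x = f b x"
    using insert.IH[OF BV linear_form[OF bV]] null_orthogonal sym bV by metis
  obtain v where v: "v \<in> span B" "\<And>x. x \<in> span B \<Longrightarrow> f v x = l x"
    using insert.IH[OF BV insert.prems(2,3)] by blast
  define e where "e = b - p"
  have pV: "p \<in> V" and vV: "v \<in> V" using p v spV by auto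
  then have eV: "e \<in> V" using bV by (simp add: e_def closed)
  have orth: "f e x = 0" "f x e = 0" if "x \<in> span B" for x
    using that p spV bV pV sym[of x e] eV by (auto simp: e_def bilin)
  define s where "s = l e / f e e"
  have es: "e \<in> span (insert b B)" and sb: "span B \<subseteq> span (insert b B)"
    unfolding e_def using p span_mono[of B "insert b B"] by (auto intro: span_diff span_base)
  have see: "s * f e e = l e" using insert.prems(3)[OF eV] by (auto simp: s_def)
  have la: "l (c *\<^sub>R x + y) = c * l x + l y" if "x \<in> V" "y \<in> V" for x y c
    using insert.prems(2) that closed by (auto simp: linear_form_on_def)
  have "f (v + s *\<^sub>R e) x = l x" if xs: "x \<in> span (insert b B)" for x
  proof -
    obtain k where "x - k *\<^sub>R b \<in> span B" using xs span_breakdown_eq by blast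
    then have "x - k *\<^sub>R b + k *\<^sub>R p \<in> span B" using p by (intro span_add span_scale)
    moreover have "x - k *\<^sub>R b + k *\<^sub>R p = x - k *\<^sub>R e" by (simp add: e_def algebra_simps)
    ultimately obtain y where y: "y \<in> span B" "x = k *\<^sub>R e + y" by (metis add.commute diff_add_cancel)
    have yV: "y \<in> V" using y spV by auto
    have "f (v + s *\<^sub>R e) x = k * f v e + f v y + s * (k * f e e + f e y)"
      unfolding y(2) using vV eV yV by (simp add: bilin closed algebra_simps)
    also have "\<dots> = k * l e + l y" using orth v y see by (simp add: algebra_simps)
    also have "\<dots> = l x" unfolding y(2) using la[OF eV yV] by simp
    finally show ?thesis .
  qed
  moreover have "v + s *\<^sub>R e \<in> span (insert b B)"
    using v es sb by (auto intro!: span_add span_scale)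
  ultimately show ?case by blast
qed

theorem finite_dim_Riesz:
  assumes lin: "linear_form_on V l" and ker: "\<And>x. x \<in> V \<Longrightarrow> f x x = 0 \<Longrightarrow> l x = 0"
  shows "\<exists>v\<in>V. \<forall>x\<in>V. f v x = l x"
proof -
  obtain B where B: "finite B" "B \<subseteq> V" "\<And>x. x \<in> V \<Longrightarrow> \<exists>y\<in>span B. x - y \<in> N"
    using fin_dim unfolding finite_dim_mod_def by blast
  have spV: "span B \<subseteq> V" using B sub by (simp add: span_minimal)
  obtain v where v: "v \<in> span B" "\<And>x. x \<in> span B \<Longrightarrow> f v x = l x"
    using Riesz_span[OF B(1,2) assms] by blast
  have vV: "v \<in> V" using v spV by auto
  have "f v x = l x" if x: "x \<in> V" for x
  proof -
    obtain y where y: "y \<in> span B" "x - y \<in> N" using B(3)[OF x] by blast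
    have yV: "y \<in> V" using y spV by auto
    have z: "f (x - y) (x - y) = 0" using null y x yV closed by blast
    have "f (x - y) v = 0" "l (x - y) = 0"
      using null_orthogonal[OF _ vV z] ker[OF _ z] x yV by (auto simp: closed)
    moreover have "l (x - y) + l y = l x"
      using lin x yV closed(3)[OF x yV] unfolding linear_form_on_def by (metis diff_add_cancel)
    ultimately show ?thesis
      using v(2)[OF y(1)] x yV vV sym[of v x] sym[of v y] by (simp add: bilin)
  qed
  with vV show ?thesis by blast
qed

end


lemma finite_dim_mod_Times:
  assumes "finite_dim_mod V N" "finite_dim_mod V' N'" "0 \<in> V" "0 \<in> V'"
  shows "finite_dim_mod (V \<times> V') (N \<times> N')"
proof -
  obtain B where B: "finite B" "B \<subseteq> V" "\<And>x. x \<in> V \<Longrightarrow> \<exists>y\<in>span B. x - y \<in> N"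
    using assms(1) unfolding finite_dim_mod_def by blast
  obtain B' where B': "finite B'" "B' \<subseteq> V'" "\<And>x. x \<in> V' \<Longrightarrow> \<exists>y\<in>span B'. x - y \<in> N'"
    using assms(2) unfolding finite_dim_mod_def by blast
  let ?C = "(\<lambda>b. (b, 0)) ` B \<union> (\<lambda>b. (0, b)) ` B'"
  have l: "linear (\<lambda>b :: 'a. (b, 0 :: 'b))" "linear (\<lambda>b :: 'b. (0 :: 'a, b))"
    by (auto intro!: linearI)
  have s: "(x, 0) \<in> span ?C" "(0, y) \<in> span ?C" if "x \<in> span B" "y \<in> span B'" for x y
    using that linear_span_image[OF l(1), of B] linear_span_image[OF l(2), of B']
      span_mono[of "(\<lambda>b. (b, 0)) ` B" ?C] span_mono[of "(\<lambda>b. (0, b)) ` B'" ?C] by auto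
  have "\<exists>z\<in>span ?C. p - z \<in> N \<times> N'" if p: "p \<in> V \<times> V'" for p
  proof -
    obtain x y where xy: "x \<in> span B" "fst p - x \<in> N" "y \<in> span B'" "snd p - y \<in> N'"
      using B(3)[of "fst p"] B'(3)[of "snd p"] p by auto
    have "(x, y) \<in> span ?C" using span_add[OF s[OF xy(1,3)]] by simp
    then show ?thesis using xy by (intro bexI[of _ "(x, y)"]) (auto simp: mem_Times_iff)
  qed
  then show ?thesis
    unfolding finite_dim_mod_def using B B' assms(3,4) by (intro exI[of _ ?C]) auto
qed

lemma finite_dim_mod_UNIV: "finite_dim_mod (UNIV :: 'a::euclidean_space set) {0}"
  unfolding finite_dim_mod_def by (intro exI[of _ Basis]) (auto simp: span_Basis)

lemma (in semi_inner) form_sum_left: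
  "finite A \<Longrightarrow> (\<And>a. a \<in> A \<Longrightarrow> g a \<in> V) \<Longrightarrow> z \<in> V \<Longrightarrow> f (\<Sum>a\<in>A. k a *\<^sub>R g a) z = (\<Sum>a\<in>A. k a * f (g a) z)"
proof (induction A rule: finite_induct)
  case empty
  then show ?case using scale_left[of 0 z 0] closed(1) by simp
next
  case (insert a A)
  then show ?case
    using subspace_sum[OF sub, of A "\<lambda>a. k a *\<^sub>R g a"] by (simp add: add_left scale_left closed)
qed

lemma (in semi_inner) tendsto_form:
  assumes "\<And>n. X n \<in> V" "x \<in> V" "(\<lambda>n. f (X n - x) (X n - x)) \<longlonglongrightarrow> 0"
  shows "(\<lambda>n. f (X n) (X n)) \<longlonglongrightarrow> f x x"
proof -
  have "(\<lambda>n. f (X n - x) x) \<longlonglongrightarrow> 0"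
  proof (rule Lim_null_comparison)
    show "\<forall>\<^sub>F n in sequentially. norm (f (X n - x) x) \<le> sqrt (f (X n - x) (X n - x)) * sqrt (f x x)"
      using Cauchy_Schwarz_abs assms by (auto simp: closed)
    show "(\<lambda>n. sqrt (f (X n - x) (X n - x)) * sqrt (f x x)) \<longlonglongrightarrow> 0"
      using tendsto_mult[OF tendsto_real_sqrt[OF assms(3)] tendsto_const] by simp
  qed
  then have "(\<lambda>n. f (X n - x) (X n - x) + 2 * f (X n - x) x + f x x) \<longlonglongrightarrow> 0 + 2 * 0 + f x x"
    by (intro tendsto_intros assms)
  moreover have "f (X n - x) (X n - x) + 2 * f (X n - x) x + f x x = f (X n) (X n)" for n
    using assms(1)[of n] assms(2) sym[of "X n" x] by (simp add: bilin closed)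
  ultimately show ?thesis by simp
qed

context finite_dim_semi_inner
begin

lemma projection:
  assumes "finite B" "B \<subseteq> V" "b \<in> V"
  shows "\<exists>p\<in>span B. \<forall>x\<in>span B. f (b - p) x = 0"
proof -
  have spV: "span B \<subseteq> V" using assms sub by (simp add: span_minimal)
  have "f b x = 0" if "x \<in> V" "f x x = 0" for x
    using null_orthogonal[OF that(1) assms(3) that(2)] sym[OF that(1) assms(3)] by simp
  from Riesz_span[OF assms(1,2) linear_form[OF assms(3)] this]
  obtain p where "p \<in> span B" "\<forall>x\<in>span B. f p x = f b x" by blast
  then show ?thesis
    using spV assms(3) by (intro bexI[of _ p]) (auto simp: diff_left subset_iff)
qed

text \<open>Bolzano--Weierstrass for a semi-inner product, one orthogonal direction at a time.\<close>

lemma bounded_span_convergent_subsequence: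
  fixes X :: "nat \<Rightarrow> 'v"
  assumes "finite B" "B \<subseteq> V" "\<And>n. X n \<in> span B" "\<And>n. f (X n) (X n) \<le> K"
  shows "\<exists>r x. strict_mono r \<and> x \<in> span B \<and> (\<lambda>n::nat. f (X (r n) - x) (X (r n) - x)) \<longlonglongrightarrow> 0"
  using assms
proof (induction B arbitrary: X rule: finite_induct)
  case empty
  then have "X n = 0" for n by simp
  moreover have "f 0 0 = 0" using scale_left[of 0 0 0] closed(1) by simp
  ultimately show ?case
    by (auto simp: strict_mono_def intro!: exI[of _ "\<lambda>n. n"])
next
  case (insert b B)
  have bV: "b \<in> V" and BV: "B \<subseteq> V" using insert.prems by auto
  have spV: "span B \<subseteq> V" using BV sub by (simp add: span_minimal)
  obtain p where p: "p \<in> span B" "\<And>x. x \<in> span B \<Longrightarrow> f (b - p) x = 0"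
    using projection[OF insert.hyps(1) BV bV] by blast
  define e where "e = b - p"
  have eV: "e \<in> V" using bV p(1) spV by (auto simp: e_def closed)
  have "\<exists>k. X n - k *\<^sub>R e \<in> span B" for n
  proof -
    obtain k where "X n - k *\<^sub>R b \<in> span B" using insert.prems(2)[of n] span_breakdown_eq by blast
    then have "X n - k *\<^sub>R b + k *\<^sub>R p \<in> span B" using p by (intro span_add span_scale)
    then show ?thesis by (intro exI[of _ k]) (simp add: e_def algebra_simps)
  qed
  then obtain k where k: "\<And>n. X n - k n *\<^sub>R e \<in> span B" by metis
  define Y where "Y n = X n - k n *\<^sub>R e" for n
  have Y: "Y n \<in> span B" "Y n \<in> V" for n using k spV by (auto simp: Y_def)
  have pyth: "f (s *\<^sub>R e + y) (s *\<^sub>R e + y) = s\<^sup>2 * f e e + f y y" if "y \<in> span B" for s y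
  proof -
    have "y \<in> V" "f e y = 0" "f y e = 0" using that spV p(2) sym[of y e] eV by (auto simp: e_def)
    then show ?thesis using eV by (simp add: bilin closed power2_eq_square)
  qed
  have bound: "(k n)\<^sup>2 * f e e + f (Y n) (Y n) \<le> K" for n
    using insert.prems(3)[of n] pyth[OF Y(1), of "k n" n] by (simp add: Y_def)
  have "f (Y n) (Y n) \<le> K" for n
    using bound[of n] mult_nonneg_nonneg[OF zero_le_power2 nonneg[OF eV], of "k n"] by linarith
  have "\<exists>r s. strict_mono r \<and> (\<lambda>n. (k (r n) - s)\<^sup>2 * f e e) \<longlonglongrightarrow> 0"
  proof (cases "f e e = 0")
    case True
    then show ?thesis by (intro exI[of _ id] exI[of _ 0]) (auto simp: strict_mono_def)
  next
    case False
    then have pos: "0 < f e e" using nonneg[OF eV] by simp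
    have "norm (k n) \<le> sqrt (K / f e e)" for n
      using bound[of n] nonneg[OF Y(2)] pos
      by (intro real_le_rsqrt) (simp add: pos_le_divide_eq, smt (verit))
    then have "bounded (range k)" by (auto simp: bounded_iff)
    then obtain s r where "strict_mono r" "(k \<circ> r) \<longlonglongrightarrow> s"
      using bounded_imp_convergent_subsequence by blast
    moreover from this have "(\<lambda>n. (k (r n) - s)\<^sup>2 * f e e) \<longlonglongrightarrow> (s - s)\<^sup>2 * f e e"
      by (intro tendsto_intros) (simp add: o_def)
    ultimately show ?thesis by auto
  qed
  then obtain r s where r: "strict_mono r" "(\<lambda>n. (k (r n) - s)\<^sup>2 * f e e) \<longlonglongrightarrow> 0" by blast
  obtain r' y where r': "strict_mono r'" "y \<in> span B" "(\<lambda>n. f (Y (r (r' n)) - y) (Y (r (r' n)) - y)) \<longlonglongrightarrow> 0"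
    using insert.IH[OF BV, of "\<lambda>n. Y (r n)"] Y(1) \<open>\<And>n. f (Y n) (Y n) \<le> K\<close> by blast
  show ?case
  proof (intro exI conjI)
    show "strict_mono (r \<circ> r')" using r(1) r'(1) by (rule strict_mono_o)
    have "e \<in> span (insert b B)" "y \<in> span (insert b B)"
      using p(1) r'(2) span_mono[of B "insert b B"] by (auto simp: e_def intro: span_diff span_base)
    then show "s *\<^sub>R e + y \<in> span (insert b B)" by (intro span_add span_scale)
    have eq: "X m - (s *\<^sub>R e + y) = (k m - s) *\<^sub>R e + (Y m - y)" for m
      by (simp add: Y_def algebra_simps)
    have "f (X m - (s *\<^sub>R e + y)) (X m - (s *\<^sub>R e + y)) = (k m - s)\<^sup>2 * f e e + f (Y m - y) (Y m - y)" for m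
      unfolding eq by (rule pyth[OF span_diff[OF Y(1) r'(2)]])
    then show "(\<lambda>n. f (X ((r \<circ> r') n) - (s *\<^sub>R e + y)) (X ((r \<circ> r') n) - (s *\<^sub>R e + y))) \<longlonglongrightarrow> 0"
      using tendsto_add[OF LIMSEQ_subseq_LIMSEQ[OF r(2) r'(1)] r'(3)] by (simp add: o_def)
  qed
qed

end

section \<open>Eigenvalues of one form relative to another\<close>

text \<open>Since \<open>f\<close> may have a kernel, an eigenvector must not only be nonzero but have positive length.\<close>

definition relative_eigenvalues :: "'v::real_vector set \<Rightarrow> ('v \<Rightarrow> 'v \<Rightarrow> real) \<Rightarrow> ('v \<Rightarrow> 'v \<Rightarrow> real) \<Rightarrow> real set" where
  "relative_eigenvalues V f g = {l. \<exists>x\<in>V. 0 < f x x \<and> (\<forall>y\<in>V. g x y = l * f x y)}"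

locale relative_spectrum = finite_dim_semi_inner V f N + g: semi_inner V g
  for V :: "'v::real_vector set" and f N g +
  fixes K :: real
  assumes bound: "\<And>x. x \<in> V \<Longrightarrow> g x x \<le> K * f x x"
begin

text \<open>Both forms see their arguments only modulo \<open>N\<close>.\<close>

lemma replace_by_span:
  assumes "x \<in> V" "y \<in> V" "x - y \<in> N"
  shows "z \<in> V \<Longrightarrow> f x z = f y z" "z \<in> V \<Longrightarrow> g x z = g y z"
proof -
  have d: "x - y \<in> V" "f (x - y) (x - y) = 0" using assms null closed by auto
  then have "g (x - y) (x - y) = 0" using bound[OF d(1)] g.nonneg[OF d(1)] by simp
  then show "z \<in> V \<Longrightarrow> f x z = f y z" "z \<in> V \<Longrightarrow> g x z = g y z"
    using d assms null_orthogonal[of "x - y" z] g.null_orthogonal[of "x - y" z]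
    by (auto simp: diff_left g.diff_left)
qed

text \<open>Eigenvectors for different eigenvalues are \<open>f\<close>-orthogonal, so there are at most as many
  eigenvalues as spanning vectors.\<close>

lemma finite_relative_eigenvalues: "finite (relative_eigenvalues V f g)"
proof (rule ccontr)
  assume "infinite (relative_eigenvalues V f g)"
  obtain B where B: "finite B" "B \<subseteq> V" "\<And>x. x \<in> V \<Longrightarrow> \<exists>y\<in>span B. x - y \<in> N"
    using fin_dim unfolding finite_dim_mod_def by blast
  have spV: "span B \<subseteq> V" using B sub by (simp add: span_minimal)
  obtain L where L: "L \<subseteq> relative_eigenvalues V f g" "finite L" "card L = Suc (card B)"
    using infinite_arbitrarily_large[OF \<open>infinite _\<close>] by blast
  have "\<exists>y\<in>span B. 0 < f y y \<and> (\<forall>z\<in>V. g y z = l * f y z)" if lL: "l \<in> L" for l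
  proof -
    obtain x where x: "x \<in> V" "0 < f x x" "\<And>z. z \<in> V \<Longrightarrow> g x z = l * f x z"
      using L(1) lL unfolding relative_eigenvalues_def by blast
    obtain y where y: "y \<in> span B" "x - y \<in> N" using B(3)[OF x(1)] by blast
    then have yV: "y \<in> V" using spV by auto
    note eq = replace_by_span[OF x(1) yV y(2)]
    have "f y y = f x x" using eq(1)[OF x(1)] eq(1)[OF yV] sym[OF x(1) yV] by simp
    then show ?thesis using x y(1) eq by (intro bexI[of _ y]) auto
  qed
  then obtain v where v: "\<And>l. l \<in> L \<Longrightarrow> v l \<in> span B" "\<And>l. l \<in> L \<Longrightarrow> 0 < f (v l) (v l)"
      "\<And>l z. l \<in> L \<Longrightarrow> z \<in> V \<Longrightarrow> g (v l) z = l * f (v l) z"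
    by metis
  have vV: "v l \<in> V" if "l \<in> L" for l using v(1)[OF that] spV by auto
  have orth: "f (v l) (v m) = 0" if "l \<in> L" "m \<in> L" "l \<noteq> m" for l m
    using v(3)[OF that(1) vV[OF that(2)]] v(3)[OF that(2) vV[OF that(1)]]
      sym[OF vV[OF that(1)] vV[OF that(2)]] g.sym[OF vV[OF that(1)] vV[OF that(2)]] that(3) by simp
  have inj: "inj_on v L"
    using orth v(2) by (intro inj_onI) (metis less_irrefl)
  have "independent (v ` L)"
  proof (rule independent_if_scalars_zero)
    fix k x assume 0: "(\<Sum>x\<in>v ` L. k x *\<^sub>R x) = 0" and "x \<in> v ` L"
    then obtain m where m: "m \<in> L" "x = v m" by blast
    have "0 = f (\<Sum>l\<in>L. k (v l) *\<^sub>R v l) (v m)"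
      using 0 inj scale_left[of 0 "v m" 0] vV[OF m(1)] closed(1) by (simp add: sum.reindex)
    also have "\<dots> = (\<Sum>l\<in>L. k (v l) * f (v l) (v m))"
      using L(2) vV m by (intro form_sum_left) auto
    also have "\<dots> = (\<Sum>l\<in>L. if l = m then k (v m) * f (v m) (v m) else 0)"
      using orth m(1) by (intro sum.cong) auto
    finally show "k x = 0" using v(2)[OF m(1)] m L(2) by simp
  qed (use L(2) in simp)
  then have "card (v ` L) \<le> card B"
    using independent_span_bound[OF B(1), of "v ` L"] v(1) by auto
  then show False using L(3) inj by (simp add: card_image)
qed

text \<open>The largest eigenvalue is the supremum \<open>M\<close> of the Rayleigh quotient, attained by compactness.
  The form \<open>M f - g\<close> is then positive semidefinite and vanishes at a maximiser, which therefore is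
  orthogonal to everything with respect to it.\<close>

lemma relative_eigenvalues_nonempty:
  assumes "x0 \<in> V" "0 < f x0 x0"
  shows "relative_eigenvalues V f g \<noteq> {}"
proof -
  obtain B where B: "finite B" "B \<subseteq> V" "\<And>x. x \<in> V \<Longrightarrow> \<exists>y\<in>span B. x - y \<in> N"
    using fin_dim unfolding finite_dim_mod_def by blast
  have spV: "span B \<subseteq> V" using B sub by (simp add: span_minimal)
  define S where "S = {x \<in> V. f x x = 1}"
  define M where "M = (SUP x\<in>S. g x x)"
  have scale: "(1 / sqrt (f x x)) *\<^sub>R x \<in> S" if "x \<in> V" "0 < f x x" for x
    using that by (simp add: S_def scale_left scale_right closed real_divide_square_eq flip: power2_eq_square)
  then have ne: "S \<noteq> {}" using assms by blast
  have bdd: "bdd_above ((\<lambda>x. g x x) ` S)"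
    using bound by (intro bdd_aboveI2[of _ _ K]) (force simp: S_def)
  have le: "g z z \<le> M * f z z" if z: "z \<in> V" for z
  proof (cases "f z z = 0")
    case True
    then show ?thesis using bound[OF z] by simp
  next
    case False
    then have pos: "0 < f z z" using nonneg[OF z] by simp
    have "g ((1 / sqrt (f z z)) *\<^sub>R z) ((1 / sqrt (f z z)) *\<^sub>R z) \<le> M"
      unfolding M_def using bdd scale[OF z pos] by (intro cSUP_upper) auto
    moreover have "g ((1 / sqrt (f z z)) *\<^sub>R z) ((1 / sqrt (f z z)) *\<^sub>R z) = g z z / f z z"
      using z pos by (simp add: g.scale_left g.scale_right closed)
    ultimately show ?thesis using pos by (simp add: pos_divide_le_eq)
  qed
  have "\<exists>y\<in>span B. f y y = 1 \<and> M - 1 / (real n + 1) < g y y" for n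
  proof -
    obtain x where x: "x \<in> S" "M - 1 / (real n + 1) < g x x"
      using less_cSUP_iff[OF ne bdd, of "M - 1 / (real n + 1)"] unfolding M_def by auto
    then have xV: "x \<in> V" "f x x = 1" by (auto simp: S_def)
    obtain y where y: "y \<in> span B" "x - y \<in> N" using B(3)[OF xV(1)] by blast
    then have yV: "y \<in> V" using spV by auto
    note eq = replace_by_span[OF xV(1) yV y(2)]
    have "f y y = f x x" "g y y = g x x"
      using eq[OF xV(1)] eq[OF yV] sym[OF xV(1) yV] g.sym[OF xV(1) yV] by simp_all
    then show ?thesis using x(2) xV(2) y(1) by (intro bexI[of _ y]) auto
  qed
  then obtain X where X: "\<And>n. X n \<in> span B" "\<And>n. f (X n) (X n) = 1"
      "\<And>n. M - 1 / (real n + 1) < g (X n) (X n)" by metis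
  have "f (X n) (X n) \<le> 1" for n using X(2)[of n] by simp
  from bounded_span_convergent_subsequence[of B X 1, OF B(1,2) X(1) this]
  obtain r x where r: "strict_mono r" "x \<in> span B" "(\<lambda>n. f (X (r n) - x) (X (r n) - x)) \<longlonglongrightarrow> 0"
    by (elim exE conjE) (rule that)
  have XV: "X n \<in> V" and xV: "x \<in> V" for n using X(1) r(2) spV by auto
  have glim0: "(\<lambda>n. g (X (r n) - x) (X (r n) - x)) \<longlonglongrightarrow> 0"
  proof (rule Lim_null_comparison)
    show "\<forall>\<^sub>F n in sequentially. norm (g (X (r n) - x) (X (r n) - x)) \<le> K * f (X (r n) - x) (X (r n) - x)"
      using bound XV xV g.nonneg by (simp add: closed)
    show "(\<lambda>n. K * f (X (r n) - x) (X (r n) - x)) \<longlonglongrightarrow> 0"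
      using tendsto_mult[OF tendsto_const r(3)] by simp
  qed
  have fx: "f x x = 1"
    using tendsto_form[OF XV xV r(3)] X(2) by (simp add: LIMSEQ_const_iff)
  have "M \<le> g x x"
  proof (rule LIMSEQ_le)
    have "(\<lambda>n. M - inverse (real (Suc n))) \<longlonglongrightarrow> M - 0"
      by (intro tendsto_intros LIMSEQ_inverse_real_of_nat)
    then show "(\<lambda>n. M - 1 / (real (r n) + 1)) \<longlonglongrightarrow> M"
      using LIMSEQ_subseq_LIMSEQ[OF _ r(1)] by (fastforce simp: o_def inverse_eq_divide add.commute)
    show "(\<lambda>n. g (X (r n)) (X (r n))) \<longlonglongrightarrow> g x x" by (rule g.tendsto_form[OF XV xV glim0])
    show "\<exists>N. \<forall>n\<ge>N. M - 1 / (real (r n) + 1) \<le> g (X (r n)) (X (r n))"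
      using X(3) less_imp_le by blast
  qed
  then have gx: "g x x = M" using le[OF xV] fx by simp
  interpret h: semi_inner V "\<lambda>x y. M * f x y - g x y"
  proof (unfold_locales, goal_cases)
    case 1 show ?case by (rule sub)
  qed (simp_all add: bilin g.bilin sym g.sym le algebra_simps)
  have "g x y = M * f x y" if "y \<in> V" for y
    using h.null_orthogonal[OF xV that] gx fx by simp
  then have "M \<in> relative_eigenvalues V f g"
    using xV fx unfolding relative_eigenvalues_def by (intro CollectI bexI[of _ x]) auto
  then show ?thesis by blast
qed

end


section \<open>Square-integrable functions\<close>

lemma L2_D: "f \<in> L2 w \<Longrightarrow> f \<in> borel_measurable (lebesgue_on w)"
    "f \<in> L2 w \<Longrightarrow> integrable (lebesgue_on w) (\<lambda>x. (norm (f x))\<^sup>2)"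
  by (auto simp: L2_def)

lemma L2_inner_integrable:
  assumes "f \<in> L2 w" "g \<in> L2 w"
  shows "integrable (lebesgue_on w) (\<lambda>x. f x \<bullet> g x)"
proof (rule Bochner_Integration.integrable_bound)
  show "integrable (lebesgue_on w) (\<lambda>x. (norm (f x))\<^sup>2 + (norm (g x))\<^sup>2)"
    using assms by (auto dest: L2_D)
  show "(\<lambda>x. f x \<bullet> g x) \<in> borel_measurable (lebesgue_on w)"
    using assms[THEN L2_D(1)] by measurable
  have "\<bar>f x \<bullet> g x\<bar> \<le> (norm (f x))\<^sup>2 + (norm (g x))\<^sup>2" for x
  proof -
    have "\<bar>f x \<bullet> g x\<bar> \<le> norm (f x) * norm (g x)" by (rule Cauchy_Schwarz_ineq2)
    also have "\<dots> \<le> 2 * norm (f x) * norm (g x)" by simp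
    also have "\<dots> \<le> (norm (f x))\<^sup>2 + (norm (g x))\<^sup>2" by (rule sum_squares_bound)
    finally show ?thesis .
  qed
  then show "AE x in lebesgue_on w. norm (f x \<bullet> g x) \<le> norm ((norm (f x))\<^sup>2 + (norm (g x))\<^sup>2)"
    by (intro AE_I2) auto
qed

lemma subspace_L2: "subspace (L2 w :: (real ^ 'n \<Rightarrow> 'b::euclidean_space) set)"
proof (rule subspaceI)
  show "(0 :: real ^ 'n \<Rightarrow> 'b) \<in> L2 w" by (simp add: L2_def zero_fun_def)
next
  fix f g :: "real ^ 'n \<Rightarrow> 'b" assume fg: "f \<in> L2 w" "g \<in> L2 w"
  have eq: "(norm (f x + g x))\<^sup>2 = f x \<bullet> f x + 2 * (f x \<bullet> g x) + g x \<bullet> g x" for x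
    by (simp add: power2_norm_eq_inner algebra_simps inner_commute)
  have "integrable (lebesgue_on w) (\<lambda>x. (norm (f x + g x))\<^sup>2)"
    unfolding eq using fg by (intro Bochner_Integration.integrable_add integrable_mult_right L2_inner_integrable)
  moreover have "(\<lambda>x. f x + g x) \<in> borel_measurable (lebesgue_on w)"
    using fg[THEN L2_D(1)] by measurable
  ultimately show "f + g \<in> L2 w" by (simp add: L2_def plus_fun_def)
next
  fix c and f :: "real ^ 'n \<Rightarrow> 'b" assume f: "f \<in> L2 w"
  have "(\<lambda>x. c *\<^sub>R f x) \<in> borel_measurable (lebesgue_on w)" using f[THEN L2_D(1)] by measurable
  then show "c *\<^sub>R f \<in> L2 w"
    using L2_D(2)[OF f] by (auto simp: L2_def scaleR_fun_def power_mult_distrib)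
qed

interpretation L2: semi_inner "L2 w" "L2_inner w"
proof (unfold_locales)
  show "subspace (L2 w)" by (rule subspace_L2)
  show "L2_inner w (x + y) z = L2_inner w x z + L2_inner w y z"
    if "x \<in> L2 w" "y \<in> L2 w" "z \<in> L2 w" for x y z
    using L2_inner_integrable[OF that(1,3)] L2_inner_integrable[OF that(2,3)]
    by (simp add: L2_inner_def inner_add_left)
qed (auto simp: L2_inner_def inner_commute intro: integral_nonneg_AE)

lemma L2_inner_cong:
  "AE x in lebesgue_on w. f x = f' x \<Longrightarrow> AE x in lebesgue_on w. g x = g' x \<Longrightarrow> f \<in> L2 w \<Longrightarrow> g \<in> L2 w \<Longrightarrow>
    f' \<in> L2 w \<Longrightarrow> g' \<in> L2 w \<Longrightarrow> L2_inner w f g = L2_inner w f' g'"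
  unfolding L2_inner_def
  by (intro integral_cong_AE borel_measurable_inner L2_D(1)) auto

lemma L2_inner_self_eq_0:
  assumes "f \<in> L2 w" "L2_inner w f f = 0"
  shows "AE x in lebesgue_on w. f x = 0"
  using assms integral_nonneg_eq_0_iff_AE[OF L2_inner_integrable[OF assms(1,1)]]
  by (simp add: L2_inner_def)

lemma L2_inner_null: "AE x in lebesgue_on w. f x = 0 \<Longrightarrow> L2_inner w f f = 0"
  unfolding L2_inner_def by (rule integral_eq_zero_AE) auto

lemma L2_inner_tendsto:
  assumes "\<And>n. X n \<in> L2 w" "f \<in> L2 w" "(\<lambda>n. L2_inner w (X n - f) (X n - f)) \<longlonglongrightarrow> 0" "g \<in> L2 w"
  shows "(\<lambda>n. L2_inner w (X n) g) \<longlonglongrightarrow> L2_inner w f g"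
proof -
  have "(\<lambda>n. L2_inner w (X n - f) g) \<longlonglongrightarrow> 0"
  proof (rule Lim_null_comparison)
    show "\<forall>\<^sub>F n in sequentially. norm (L2_inner w (X n - f) g) \<le>
        sqrt (L2_inner w (X n - f) (X n - f)) * sqrt (L2_inner w g g)"
      using L2.Cauchy_Schwarz_abs[OF subspace_diff[OF subspace_L2 assms(1,2)] assms(4)] by simp
    show "(\<lambda>n. sqrt (L2_inner w (X n - f) (X n - f)) * sqrt (L2_inner w g g)) \<longlonglongrightarrow> 0"
      using tendsto_mult[OF tendsto_real_sqrt[OF assms(3)] tendsto_const] by simp
  qed
  then show ?thesis using assms by (simp add: L2.diff_left LIM_zero_iff)
qed

lemma L2_component:
  fixes f :: "real ^ 'n \<Rightarrow> real ^ 'm"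
  assumes "f \<in> L2 w"
  shows "(\<lambda>x. f x $ i) \<in> L2 w"
proof -
  have "(\<lambda>x. f x \<bullet> axis i 1) \<in> borel_measurable (lebesgue_on w)" using L2_D(1)[OF assms] by measurable
  then have m: "(\<lambda>x. f x $ i) \<in> borel_measurable (lebesgue_on w)" by (simp add: inner_axis)
  moreover have "integrable (lebesgue_on w) (\<lambda>x. (norm (f x $ i))\<^sup>2)"
  proof (rule Bochner_Integration.integrable_bound[OF L2_D(2)[OF assms]])
    have "(f x $ i)\<^sup>2 \<le> (norm (f x))\<^sup>2" for x
      using power_mono[OF component_le_norm_cart[of "f x" i], of 2] by simp
    then show "AE x in lebesgue_on w. norm ((norm (f x $ i))\<^sup>2) \<le> norm ((norm (f x))\<^sup>2)"
      by (intro AE_I2) simp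
  qed (use m in simp)
  ultimately show ?thesis by (simp add: L2_def)
qed

lemma L2_vec:
  fixes f :: "real ^ 'n \<Rightarrow> 'b::euclidean_space ^ 'm"
  assumes "\<And>i. (\<lambda>x. f x $ i) \<in> L2 w"
  shows "f \<in> L2 w"
proof -
  have "(\<lambda>x. f x \<bullet> b) \<in> borel_measurable (lebesgue_on w)" if "b \<in> Basis" for b
  proof -
    obtain i u where "b = axis i u" using \<open>b \<in> Basis\<close> by (auto simp: Basis_vec_def)
    then show ?thesis using L2_D(1)[OF assms[of i]] by (simp add: inner_axis) measurable
  qed
  then have "f \<in> borel_measurable (lebesgue_on w)"
    by (subst borel_measurable_euclidean_space) blast
  moreover have "integrable (lebesgue_on w) (\<lambda>x. \<Sum>i\<in>UNIV. (norm (f x $ i))\<^sup>2)"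
    using assms by (intro Bochner_Integration.integrable_sum L2_D(2))
  then have "integrable (lebesgue_on w) (\<lambda>x. (norm (f x))\<^sup>2)"
    by (simp add: norm_vec_def L2_set_def sum_nonneg)
  ultimately show ?thesis by (simp add: L2_def)
qed

lemma finite_measure_lebesgue_on_bounded:
  "w \<in> sets lebesgue \<Longrightarrow> bounded w \<Longrightarrow> finite_measure (lebesgue_on w)"
  by (meson bounded_set_imp_lmeasurable finite_measure_lebesgue_on)

lemma L2_const:
  assumes "finite_measure (lebesgue_on w)"
  shows "(\<lambda>x. c) \<in> L2 w"
  using assms by (simp add: L2_def finite_measure.integrable_const)

lemma L2_bounded:
  assumes "finite_measure (lebesgue_on w)" "f \<in> borel_measurable (lebesgue_on w)"
    and "\<And>x. x \<in> w \<Longrightarrow> norm (f x) \<le> K"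
  shows "f \<in> L2 w"
proof -
  have "integrable (lebesgue_on w) (\<lambda>x. (norm (f x))\<^sup>2)"
    by (rule finite_measure.integrable_const_bound[OF assms(1), where B = "K\<^sup>2"])
       (use assms in \<open>auto intro!: AE_I2 power_mono simp: space_restrict_space\<close>)
  then show ?thesis using assms by (simp add: L2_def)
qed

lemma L2_integrable:
  assumes "finite_measure (lebesgue_on w)" "f \<in> L2 w"
  shows "integrable (lebesgue_on w) f"
proof (rule Bochner_Integration.integrable_bound)
  show "integrable (lebesgue_on w) (\<lambda>x. 1 + (norm (f x))\<^sup>2)"
    using assms by (intro Bochner_Integration.integrable_add L2_D finite_measure.integrable_const) auto
  have "t \<le> 1 + t\<^sup>2" for t :: real
    using zero_le_power2[of "t - 1/2"] by (simp add: power2_diff power2_eq_square field_simps)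
  then show "AE x in lebesgue_on w. norm (f x) \<le> norm (1 + (norm (f x))\<^sup>2)"
    by (intro AE_I2) (simp add: add_nonneg_nonneg)
qed (use assms L2_D in auto)

lemma L2_mono:
  assumes "f \<in> L2 w'" "w \<subseteq> w'" "w \<in> sets lebesgue" "w' \<in> sets lebesgue"
  shows "f \<in> L2 w"
proof -
  have "f \<in> borel_measurable (lebesgue_on w)"
    using measurable_restrict_mono[OF L2_D(1)[OF assms(1)] assms(2)] .
  moreover have "set_integrable lebesgue w (\<lambda>x. (norm (f x))\<^sup>2)"
    using L2_D(2)[OF assms(1)] assms
    by (intro set_integrable_subset[of lebesgue w' _ w]) (auto simp: set_integrable_def integrable_restrict_space)
  ultimately show ?thesis
    using assms by (auto simp: L2_def set_integrable_def integrable_restrict_space)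
qed

text \<open>Along a rapidly converging subsequence the increments are summable in \<open>L\<^sup>1\<close>, which bounds them by
  \<open>L\<^sup>2\<close> on a finite measure space; hence the subsequence converges almost everywhere. Fatou's lemma turns
  this into convergence in \<open>L\<^sup>2\<close>.\<close>

theorem L2_complete:
  fixes X :: "nat \<Rightarrow> real ^ 'n \<Rightarrow> 'b::euclidean_space"
  assumes fin: "finite_measure (lebesgue_on w)" and X: "\<And>n. X n \<in> L2 w"
    and cau: "\<And>e. 0 < e \<Longrightarrow> \<exists>N. \<forall>m\<ge>N. \<forall>n\<ge>N. L2_inner w (X m - X n) (X m - X n) < e"
  shows "\<exists>f\<in>L2 w. (\<lambda>n. L2_inner w (X n - f) (X n - f)) \<longlonglongrightarrow> 0"
proof -
  let ?M = "lebesgue_on w"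
  interpret finite_measure ?M by (rule fin)
  have "\<forall>k. \<exists>N. \<forall>m\<ge>N. \<forall>n\<ge>N. L2_inner w (X m - X n) (X m - X n) < (1/4)^k"
    using cau by simp
  then obtain N where N: "\<And>k m n. m \<ge> N k \<Longrightarrow> n \<ge> N k \<Longrightarrow> L2_inner w (X m - X n) (X m - X n) < (1/4)^k"
    by metis
  \<comment> \<open>the sum makes \<open>r j\<close> exceed all of \<open>N 0, \<dots>, N j\<close> without assuming \<open>N\<close> monotone\<close>
  define r where "r k = k + (\<Sum>i\<le>k. N i)" for k
  have rN: "N k \<le> r j" if "k \<le> j" for k j
    using member_le_sum[of k "{..j}" N] that by (simp add: r_def)
  define D where "D k x = norm (X (r (Suc k)) x - X (r k) x)" for k x
  have meas: "X n \<in> borel_measurable ?M" for n using X L2_D by blast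
  have Dm: "D k \<in> borel_measurable ?M" for k unfolding D_def using meas by measurable
  define K where "K = sqrt (L2_inner w (\<lambda>x. 1::real) (\<lambda>x. 1))"
  have DL2: "D k \<in> L2 w" for k
    using subspace_diff[OF subspace_L2 X X, of "r (Suc k)" "r k"] Dm[of k]
    by (auto simp: L2_def D_def)
  have Dint: "integrable ?M (D k)" for k by (intro L2_integrable fin DL2)
  have Dsmall: "integral\<^sup>L ?M (D k) \<le> K * (1/2)^k" for k
  proof -
    have "integral\<^sup>L ?M (D k) = L2_inner w (\<lambda>x. 1) (D k)" by (simp add: L2_inner_def)
    also have "\<dots> \<le> K * sqrt (L2_inner w (D k) (D k))"
      using L2.Cauchy_Schwarz_abs[OF L2_const[OF fin, of 1] DL2[of k]] by (simp add: K_def)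
    also have "L2_inner w (D k) (D k) = L2_inner w (X (r (Suc k)) - X (r k)) (X (r (Suc k)) - X (r k))"
      by (simp add: L2_inner_def D_def power2_norm_eq_inner flip: power2_eq_square)
    also have "K * sqrt \<dots> \<le> K * sqrt ((1/4)^k)"
      using N[of k "r (Suc k)" "r k"] rN by (intro mult_left_mono real_sqrt_le_mono) (auto simp: K_def L2_inner_def)
    also have "sqrt ((1/4)^k) = (1/2)^k"
      by (simp add: real_sqrt_power real_sqrt_divide)
    finally show ?thesis .
  qed
  have "(\<integral>\<^sup>+x. (\<Sum>k. ennreal (D k x)) \<partial>?M) = (\<Sum>k. \<integral>\<^sup>+x. ennreal (D k x) \<partial>?M)"
    using Dm by (intro nn_integral_suminf) measurable
  also have "\<dots> = (\<Sum>k. ennreal (integral\<^sup>L ?M (D k)))"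
    using Dint by (intro suminf_cong nn_integral_eq_integral AE_I2) (simp_all add: D_def[abs_def])
  also have "\<dots> \<le> (\<Sum>k. ennreal (K * (1/2)^k))"
    using Dsmall by (intro suminf_le) (auto intro!: ennreal_leI)
  also have "\<dots> = ennreal (\<Sum>k. K * (1/2)^k)"
    by (intro suminf_ennreal2) (auto simp: K_def L2_inner_def intro!: summable_mult summable_geometric)
  also have "\<dots> < \<infinity>" by simp
  finally have "AE x in ?M. (\<Sum>k. ennreal (D k x)) \<noteq> \<infinity>"
    using Dm by (intro nn_integral_PInf_AE) auto
  then have ae: "AE x in ?M. convergent (\<lambda>k. X (r k) x)"
  proof (eventually_elim)
    case (elim x)
    then have "summable (\<lambda>k. norm (X (r (Suc k)) x - X (r k) x))"
      using summable_suminf_not_top[of "\<lambda>k. D k x"] by (simp add: D_def)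
    then have "summable (\<lambda>k. X (r (Suc k)) x - X (r k) x)" by (rule summable_norm_cancel)
    then have "convergent (\<lambda>n. X (r n) x - X (r 0) x)"
      unfolding summable_iff_convergent sum_lessThan_telescope[of "\<lambda>k. X (r k) x"] .
    then show ?case using convergent_add[OF _ convergent_const[of "X (r 0) x"]] by fastforce
  qed
  define f where "f x = lim (\<lambda>k. X (r k) x)" for x
  have fm: "f \<in> borel_measurable ?M" unfolding f_def using meas by measurable
  have ae: "AE x in ?M. (\<lambda>k. X (r k) x) \<longlonglongrightarrow> f x"
    using ae by eventually_elim (simp add: f_def convergent_LIMSEQ_iff)
  have fatou: "(\<integral>\<^sup>+x. ennreal ((norm (X m x - f x))\<^sup>2) \<partial>?M) \<le> ennreal ((1/4)^k)" if "m \<ge> N k" for m k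
  proof -
    have "(\<integral>\<^sup>+x. ennreal ((norm (X m x - f x))\<^sup>2) \<partial>?M)
        = (\<integral>\<^sup>+x. liminf (\<lambda>j. ennreal ((norm (X m x - X (r j) x))\<^sup>2)) \<partial>?M)"
    proof (rule nn_integral_cong_AE)
      show "AE x in ?M. ennreal ((norm (X m x - f x))\<^sup>2) = liminf (\<lambda>j. ennreal ((norm (X m x - X (r j) x))\<^sup>2))"
        using ae
      proof (eventually_elim)
        case (elim x)
        have "(\<lambda>j. ennreal ((norm (X m x - X (r j) x))\<^sup>2)) \<longlonglongrightarrow> ennreal ((norm (X m x - f x))\<^sup>2)"
          by (intro tendsto_intros elim)
        then show ?case by (intro lim_imp_Liminf[symmetric]) auto
      qed
    qed
    also have "\<dots> \<le> liminf (\<lambda>j. \<integral>\<^sup>+x. ennreal ((norm (X m x - X (r j) x))\<^sup>2) \<partial>?M)"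
      using meas by (intro nn_integral_liminf) measurable
    also have "\<dots> \<le> ennreal ((1/4)^k)"
    proof (rule Liminf_le)
      show "\<forall>\<^sub>F j in sequentially. (\<integral>\<^sup>+x. ennreal ((norm (X m x - X (r j) x))\<^sup>2) \<partial>?M) \<le> ennreal ((1/4)^k)"
        using eventually_ge_at_top[of k]
      proof (eventually_elim)
        case (elim j)
        have "(\<integral>\<^sup>+x. ennreal ((norm (X m x - X (r j) x))\<^sup>2) \<partial>?M)
            = ennreal (L2_inner w (X m - X (r j)) (X m - X (r j)))"
          using L2_D(2)[OF subspace_diff[OF subspace_L2 X X, of m "r j"]]
          by (subst nn_integral_eq_integral) (auto simp: L2_inner_def power2_norm_eq_inner)
        also have "\<dots> \<le> ennreal ((1/4)^k)"
          using N[of k m "r j"] that rN[OF elim] by (intro ennreal_leI) simp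
        finally show ?case .
      qed
    qed auto
    finally show ?thesis .
  qed
  have diff: "X m - f \<in> L2 w" if "m \<ge> N 0" for m
  proof -
    have "(\<lambda>x. X m x - f x) \<in> borel_measurable ?M" using meas fm by measurable
    moreover have "integrable ?M (\<lambda>x. (norm (X m x - f x))\<^sup>2)"
      using fatou[OF that] calculation
      by (intro integrableI_bounded) (auto simp: order_le_less_trans)
    ultimately show ?thesis by (simp add: L2_def fun_diff_def)
  qed
  have f: "f \<in> L2 w"
    using subspace_diff[OF subspace_L2 X diff[OF order_refl], of "N 0"] by (simp add: fun_diff_def)
  have small: "L2_inner w (X m - f) (X m - f) \<le> (1/4)^k" if "m \<ge> N k" for m k
  proof -
    have "ennreal (L2_inner w (X m - f) (X m - f)) = (\<integral>\<^sup>+x. ennreal ((norm (X m x - f x))\<^sup>2) \<partial>?M)"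
      using L2_D(2)[OF subspace_diff[OF subspace_L2 X f, of m]]
      by (subst nn_integral_eq_integral) (auto simp: L2_inner_def power2_norm_eq_inner)
    also have "\<dots> \<le> ennreal ((1/4)^k)" by (rule fatou[OF that])
    finally show ?thesis by (subst (asm) ennreal_le_iff) auto
  qed
  have "(\<lambda>n. L2_inner w (X n - f) (X n - f)) \<longlonglongrightarrow> 0"
  proof (rule LIMSEQ_I)
    fix e :: real assume "0 < e"
    then obtain k where "(1/4)^k < e" using real_arch_pow_inv[of e "1/4"] by auto
    then show "\<exists>n0. \<forall>n\<ge>n0. norm (L2_inner w (X n - f) (X n - f) - 0) < e"
      using small[of k] L2.nonneg[OF subspace_diff[OF subspace_L2 X f]]
      by (intro exI[of _ "N k"]) (auto intro: le_less_trans)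
  qed
  with f show ?thesis by blast
qed


section \<open>Smooth functions of several variables\<close>

lemma partial_eq: "(f has_derivative f') (at x) \<Longrightarrow> partial j f x = f' (axis j 1)"
  unfolding partial_def using frechet_derivative_at[of f f' x] by simp

lemma partial_add:
  "f differentiable (at x) \<Longrightarrow> g differentiable (at x) \<Longrightarrow>
    partial j (\<lambda>x. f x + g x) x = partial j f x + partial j g x"
  using partial_eq[OF has_derivative_add, of f _ x g _ j]
  by (simp add: frechet_derivative_works partial_def)

lemma partial_mult:
  assumes "f differentiable (at x)" "g differentiable (at x)"
  shows "partial j (\<lambda>x. f x * g x) x = partial j f x * g x + f x * partial j g x"
proof -
  have "((\<lambda>x. f x * g x) has_derivative
      (\<lambda>h. f x * frechet_derivative g (at x) h + frechet_derivative f (at x) h * g x)) (at x)"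
    using assms by (intro has_derivative_mult) (simp_all add: frechet_derivative_works)
  from partial_eq[OF this] show ?thesis by (simp add: partial_def)
qed

lemma partial_const: "partial j (\<lambda>x. c) x = 0"
  by (simp add: partial_def)

lemma C_k_continuous: "C_k k f \<Longrightarrow> continuous_on UNIV f"
  by (cases k) (auto intro!: continuous_at_imp_continuous_on differentiable_imp_continuous_within)

lemma C_k_Suc_D: "C_k (Suc k) f \<Longrightarrow> C_k k f"
proof (induction k arbitrary: f)
  case 0
  then show ?case using C_k_continuous[of "Suc 0" f] by simp
qed simp

lemma C_k_const: "C_k k (\<lambda>x. c)"
  by (induction k arbitrary: c) (auto simp: partial_const[abs_def])

lemma C_k_add: "C_k k f \<Longrightarrow> C_k k g \<Longrightarrow> C_k k (\<lambda>x. f x + g x)"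
proof (induction k arbitrary: f g)
  case (Suc k)
  then have "partial j (\<lambda>x. f x + g x) = (\<lambda>x. partial j f x + partial j g x)" for j
    by (intro ext partial_add) auto
  then show ?case using Suc by (auto intro: differentiable_add)
qed (auto intro: continuous_on_add)

lemma C_k_mult: "C_k k f \<Longrightarrow> C_k k g \<Longrightarrow> C_k k (\<lambda>x. f x * g x)"
proof (induction k arbitrary: f g)
  case (Suc k)
  then have "partial j (\<lambda>x. f x * g x) = (\<lambda>x. partial j f x * g x + f x * partial j g x)" for j
    by (intro ext partial_mult) auto
  moreover have "C_k k (\<lambda>x. partial j f x * g x + f x * partial j g x)" for j
    using Suc C_k_Suc_D[of k f] C_k_Suc_D[of k g] by (intro C_k_add Suc.IH) auto
  ultimately show ?case using Suc by (auto intro: differentiable_mult)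
qed (auto intro: continuous_on_mult)

lemma C_k_prod: "(\<And>i. i \<in> I \<Longrightarrow> C_k k (f i)) \<Longrightarrow> C_k k (\<lambda>x. \<Prod>i\<in>I. f i x)"
  by (induction I rule: infinite_finite_induct) (auto intro: C_k_const C_k_mult)

lemma C_k_affine: "C_k k (\<lambda>x. c \<bullet> x + d)" "partial j (\<lambda>x. c \<bullet> x + d) x = c $ j"
proof -
  have d: "((\<lambda>x. c \<bullet> x + d) has_derivative (\<lambda>h. c \<bullet> h)) (at x)" for x
    by (auto intro!: derivative_eq_intros)
  show p: "partial j (\<lambda>x. c \<bullet> x + d) x = c $ j" for x j
    using partial_eq[OF d] by (simp add: inner_axis)
  have "partial j (\<lambda>x. c \<bullet> x + d) = (\<lambda>x. c $ j)" for j using p by blast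
  then show "C_k k (\<lambda>x. c \<bullet> x + d)"
    using d by (cases k) (auto simp: C_k_const differentiable_def intro!: continuous_intros)
qed

text \<open>The functions \<open>p(1/t) e\<^sup>-\<^sup>1\<^sup>/\<^sup>t\<close>, extended by zero to the left half-line, are closed under
  differentiation, so they are all smooth.\<close>

definition flat :: "real poly \<Rightarrow> real \<Rightarrow> real" where
  "flat p t = (if 0 < t then poly p (inverse t) * exp (- inverse t) else 0)"

lemma flat_tendsto_0: "(flat p \<longlongrightarrow> 0) (at 0)"
proof -
  have "((\<lambda>u. \<Sum>i\<le>degree p. coeff p i * (u ^ i / exp u)) \<longlongrightarrow> (\<Sum>i\<le>degree p. coeff p i * 0)) at_top"
    by (intro tendsto_intros tendsto_power_div_exp_0)
  then have "((\<lambda>u. poly p u * exp (- u)) \<longlongrightarrow> 0) at_top"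
    by (simp add: poly_altdef sum_distrib_right exp_minus divide_inverse mult.assoc)
  then have "((\<lambda>t. poly p (inverse t) * exp (- inverse t)) \<longlongrightarrow> 0) (at_right (0::real))"
    using filterlim_inverse_at_top_right by (rule filterlim_compose)
  then have "(flat p \<longlongrightarrow> 0) (at_right 0)"
    by (rule Lim_transform_eventually) (auto simp: flat_def eventually_at_filter)
  moreover have "(flat p \<longlongrightarrow> 0) (at_left 0)"
    by (rule Lim_transform_eventually[OF tendsto_const]) (auto simp: flat_def eventually_at_filter)
  ultimately show ?thesis by (simp add: filterlim_split_at)
qed

lemma flat_deriv: "(flat p has_real_derivative flat ([:0, 0, 1:] * (p - pderiv p)) t) (at t)"
proof (cases "t = 0")
  case True
  have "(\<lambda>h. (flat p (0 + h) - flat p 0) / h) = flat ([:0, 1:] * p)"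
    by (auto simp: flat_def fun_eq_iff field_simps)
  then show ?thesis
    using flat_tendsto_0[of "[:0, 1:] * p"] by (simp add: DERIV_def True flat_def[of _ 0])
next
  case False
  show ?thesis
  proof (cases "0 < t")
    case True
    have "((\<lambda>t. poly p (inverse t) * exp (- inverse t)) has_real_derivative
        flat ([:0, 0, 1:] * (p - pderiv p)) t) (at t)"
      using True
      by (auto intro!: derivative_eq_intros DERIV_chain2[OF poly_DERIV]
            simp: flat_def field_simps power2_eq_square)
    then show ?thesis
      by (rule has_field_derivative_transform_within_open[of _ _ _ "{0<..}"])
         (use True in \<open>auto simp: flat_def\<close>)
  next
    case neg: False
    have "((\<lambda>t. 0) has_real_derivative flat ([:0, 0, 1:] * (p - pderiv p)) t) (at t)"
      using neg by (simp add: flat_def)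
    then show ?thesis
      by (rule has_field_derivative_transform_within_open[of _ _ _ "{..<0}"])
         (use neg False in \<open>auto simp: flat_def\<close>)
  qed
qed

lemma C_k_flat: "C_k k (\<lambda>x :: real ^ 'n. flat p (s * x $ i + t))"
proof (induction k arbitrary: p)
  case (Suc k)
  let ?q = "[:0, 0, 1:] * (p - pderiv p)"
  have d: "((\<lambda>x :: real ^ 'n. flat p (s * x $ i + t)) has_derivative
      (\<lambda>h. flat ?q (s * x $ i + t) * (s * h $ i))) (at x)" for x
  proof (rule has_derivative_compose[OF _ flat_deriv[unfolded has_field_derivative_def]])
    show "((\<lambda>x :: real ^ 'n. s * x $ i + t) has_derivative (\<lambda>h. s * h $ i)) (at x)"
      by (auto intro!: derivative_eq_intros bounded_linear_imp_has_derivative[OF bounded_linear_vec_nth])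
  qed
  have "partial j (\<lambda>x :: real ^ 'n. flat p (s * x $ i + t)) =
      (\<lambda>x. (s * axis j 1 $ i) * flat ?q (s * x $ i + t))" for j
    using partial_eq[OF d] by (simp add: fun_eq_iff)
  moreover have "C_k k (\<lambda>x :: real ^ 'n. (s * axis j 1 $ i) * flat ?q (s * x $ i + t))" for j
    by (intro C_k_mult C_k_const Suc.IH)
  ultimately show ?case using d by (auto simp: differentiable_def)
next
  case 0
  have "continuous_on UNIV (flat p)"
    using flat_deriv by (intro continuous_at_imp_continuous_on) (auto intro: DERIV_isCont)
  then show ?case
    by (auto intro!: continuous_on_compose2[of UNIV "flat p"] continuous_intros)
qed


section \<open>Test functions\<close>

lemma test_functionsI:
  assumes "\<And>k. C_k k \<phi>" "compact S" "S \<subseteq> w" "\<And>x. x \<notin> S \<Longrightarrow> \<phi> x = 0"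
  shows "\<phi> \<in> test_functions w"
proof -
  have "closure {x. \<phi> x \<noteq> 0} \<subseteq> S"
    using assms(2,4) by (intro closure_minimal compact_imp_closed) auto
  moreover from this have "compact (closure {x. \<phi> x \<noteq> 0})"
    using bounded_subset[OF compact_imp_bounded[OF assms(2)], of "{x. \<phi> x \<noteq> 0}"] assms(4)
    unfolding compact_closure by auto
  ultimately show ?thesis using assms(1,3) by (auto simp: test_functions_def)
qed

lemma test_functions_D:
  assumes "\<phi> \<in> test_functions w"
  shows "C_k k \<phi>" "\<phi> differentiable (at x)" "continuous_on UNIV \<phi>"
proof -
  show C: "C_k k \<phi>" for k using assms by (auto simp: test_functions_def)
  show "\<phi> differentiable (at x)" using C[of "Suc 0"] by simp
  show "continuous_on UNIV \<phi>" using C_k_continuous[OF C[of 0]] .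
qed

lemma test_functions_support:
  assumes "\<phi> \<in> test_functions w"
  shows "\<exists>S. compact S \<and> S \<subseteq> w \<and> (\<forall>x. x \<notin> S \<longrightarrow> \<phi> x = 0)"
  using assms closure_subset[of "{x. \<phi> x \<noteq> 0}"]
  by (intro exI[of _ "closure {x. \<phi> x \<noteq> 0}"]) (auto simp: test_functions_def)

lemma test_functions_partial:
  assumes "\<phi> \<in> test_functions w"
  shows "partial j \<phi> \<in> test_functions w"
proof -
  obtain S where S: "compact S" "S \<subseteq> w" and S0: "\<And>x. x \<notin> S \<Longrightarrow> \<phi> x = 0"
    using test_functions_support[OF assms] by blast
  show ?thesis
  proof (rule test_functionsI[OF _ S])
    show "C_k k (partial j \<phi>)" for k using test_functions_D(1)[OF assms, of "Suc k"] by simp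
    fix x assume x: "x \<notin> S"
    have "open (- S)" using compact_imp_closed[OF S(1)] by (rule open_Compl)
    then have "(\<phi> has_derivative (\<lambda>h. 0)) (at x)"
      by (rule has_derivative_transform_within_open[OF has_derivative_const[of 0]]) (use x S0 in auto)
    from partial_eq[OF this] show "partial j \<phi> x = 0" .
  qed
qed

lemma test_functions_zero_outside:
  assumes "\<phi> \<in> test_functions w" "x \<notin> w"
  shows "\<phi> x = 0"
  using test_functions_support[OF assms(1)] assms(2) by blast

lemma test_functions_mono: "w \<subseteq> w' \<Longrightarrow> test_functions w \<subseteq> test_functions w'"
  by (auto simp: test_functions_def)

lemma test_functions_bounded_support:
  assumes "\<phi> \<in> test_functions w"
  shows "\<exists>R>0. \<forall>x. R < norm x \<longrightarrow> \<phi> x = 0"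
proof -
  obtain S where S: "compact S" "\<And>x. x \<notin> S \<Longrightarrow> \<phi> x = 0"
    using test_functions_support[OF assms] by blast
  obtain R where R: "0 < R" "\<And>x. x \<in> S \<Longrightarrow> norm x \<le> R"
    using compact_imp_bounded[OF S(1)] unfolding bounded_pos by blast
  have "\<phi> x = 0" if "R < norm x" for x using that R(2)[of x] S(2)[of x] by linarith
  with R(1) show ?thesis by blast
qed

lemma test_functions_bounded:
  assumes "\<phi> \<in> test_functions w"
  shows "\<exists>K>0. \<forall>x. \<bar>\<phi> x\<bar> \<le> K"
proof -
  obtain S where S: "compact S" "\<And>x. x \<notin> S \<Longrightarrow> \<phi> x = 0"
    using test_functions_support[OF assms] by blast
  have "compact (\<phi> ` S)"
    using test_functions_D(3)[OF assms] S(1)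
    by (intro compact_continuous_image) (auto intro: continuous_on_subset)
  from compact_imp_bounded[OF this] obtain K where K: "0 < K" "\<forall>y \<in> \<phi> ` S. norm y \<le> K"
    unfolding bounded_pos by blast
  have "\<bar>\<phi> x\<bar> \<le> K" for x using K S(2)[of x] by (cases "x \<in> S") auto
  then show ?thesis using K(1) by blast
qed

lemma test_functions_add:
  assumes "\<phi> \<in> test_functions w" "\<psi> \<in> test_functions w"
  shows "(\<lambda>x. \<phi> x + \<psi> x) \<in> test_functions w"
proof -
  obtain S where S: "compact S" "S \<subseteq> w" "\<And>x. x \<notin> S \<Longrightarrow> \<phi> x = 0"
    using test_functions_support[OF assms(1)] by blast
  obtain S' where S': "compact S'" "S' \<subseteq> w" "\<And>x. x \<notin> S' \<Longrightarrow> \<psi> x = 0"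
    using test_functions_support[OF assms(2)] by blast
  show ?thesis
  proof (rule test_functionsI)
    show "C_k k (\<lambda>x. \<phi> x + \<psi> x)" for k by (intro C_k_add assms[THEN test_functions_D(1)])
    show "compact (S \<union> S')" "S \<union> S' \<subseteq> w" using S(1,2) S'(1,2) by auto
    show "\<phi> x + \<psi> x = 0" if "x \<notin> S \<union> S'" for x using that S(3) S'(3) by simp
  qed
qed

lemma test_functions_mult:
  assumes "\<phi> \<in> test_functions w" "\<And>k. C_k k \<psi>"
  shows "(\<lambda>x. \<psi> x * \<phi> x) \<in> test_functions w"
proof -
  obtain S where S: "compact S" "S \<subseteq> w" "\<And>x. x \<notin> S \<Longrightarrow> \<phi> x = 0"
    using test_functions_support[OF assms(1)] by blast
  show ?thesis
  proof (rule test_functionsI[OF _ S(1,2)])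
    show "C_k k (\<lambda>x. \<psi> x * \<phi> x)" for k by (intro C_k_mult assms(2) test_functions_D(1)[OF assms(1)])
    show "\<psi> x * \<phi> x = 0" if "x \<notin> S" for x using that S(3) by simp
  qed
qed

text \<open>Difference quotients in direction \<open>j\<close> have integral zero because Lebesgue measure is invariant
  under translations.\<close>

lemma integral_partial_test_function:
  fixes \<psi> :: "real ^ 'n \<Rightarrow> real"
  assumes "\<psi> \<in> test_functions w"
  shows "integral\<^sup>L lebesgue (partial j \<psi>) = 0"
proof -
  define e where "e = (axis j 1 :: real ^ 'n)"
  have ne: "norm e = 1" by (simp add: e_def norm_axis_1)
  have cont: "continuous_on UNIV \<psi>" "continuous_on UNIV (partial j \<psi>)"
    using test_functions_D(3) assms test_functions_partial[OF assms] by auto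
  have meas: "\<psi> \<in> borel_measurable borel" "partial j \<psi> \<in> borel_measurable borel"
    using cont by (auto intro: borel_measurable_continuous_onI)
  obtain R where R: "0 < R" "\<And>x. R < norm x \<Longrightarrow> \<psi> x = 0"
    using test_functions_bounded_support[OF assms] by blast
  obtain K where K: "0 < K" "\<And>x. \<bar>partial j \<psi> x\<bar> \<le> K"
    using test_functions_bounded[OF test_functions_partial[OF assms]] by blast
  have der: "((\<lambda>s. \<psi> (x + s *\<^sub>R e)) has_real_derivative partial j \<psi> (x + s *\<^sub>R e)) (at s)" for x s
  proof -
    have "(\<psi> has_derivative frechet_derivative \<psi> (at (x + s *\<^sub>R e))) (at (x + s *\<^sub>R e))"
      using test_functions_D(2)[OF assms] by (simp add: frechet_derivative_works)
    then have "((\<lambda>s. \<psi> (x + s *\<^sub>R e)) has_derivative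
        (\<lambda>h. frechet_derivative \<psi> (at (x + s *\<^sub>R e)) (h *\<^sub>R e))) (at s)"
      by (rule has_derivative_compose[rotated]) (auto intro!: derivative_eq_intros)
    moreover have "frechet_derivative \<psi> (at (x + s *\<^sub>R e)) (h *\<^sub>R e) = partial j \<psi> (x + s *\<^sub>R e) * h" for h
      using linear_frechet_derivative[OF test_functions_D(2)[OF assms]]
      by (simp add: partial_def e_def linear_cmul)
    ultimately show ?thesis by (simp add: has_field_derivative_def)
  qed
  define h where "h n = 1 / (real n + 1)" for n
  have h: "0 < h n" "h n \<le> 1" for n by (auto simp: h_def)
  have h0: "h \<longlonglongrightarrow> 0"
    unfolding h_def using LIMSEQ_inverse_real_of_nat by (simp add: inverse_eq_divide add.commute)
  define d where "d n x = (\<psi> (x + h n *\<^sub>R e) - \<psi> x) / h n" for n x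
  have mt: "(\<lambda>x. \<psi> (x + c)) \<in> borel_measurable borel" for c
    by (rule measurable_compose[OF _ meas(1)]) simp
  have dm: "d n \<in> borel_measurable borel" for n
    unfolding d_def using mt meas(1) by measurable
  have int: "integrable lborel \<psi>"
  proof -
    have "integrable lborel (\<lambda>x. indicator (cball 0 R) x *\<^sub>R \<psi> x)"
      using borel_integrable_compact[of "cball 0 R" \<psi>] cont(1)
      by (simp add: continuous_on_subset set_integrable_def)
    moreover have "(\<lambda>x. indicator (cball 0 R) x *\<^sub>R \<psi> x) = \<psi>"
      using R(2) by (force simp: indicator_def fun_eq_iff)
    ultimately show ?thesis by simp
  qed
  have shift: "integrable lborel (\<lambda>x. \<psi> (x + c))" "integral\<^sup>L lborel (\<lambda>x. \<psi> (x + c)) = integral\<^sup>L lborel \<psi>" for c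
    using int integrable_distr_eq[of "(+) c" lborel borel \<psi>] integral_distr[of "(+) c" lborel borel \<psi>]
      meas(1) by (simp_all add: lborel_distr_plus add.commute)
  have int0: "integral\<^sup>L lborel (d n) = 0" for n
    unfolding d_def using shift[of "h n *\<^sub>R e"] int by simp
  have "(\<lambda>n. integral\<^sup>L lborel (d n)) \<longlonglongrightarrow> integral\<^sup>L lborel (partial j \<psi>)"
  proof (rule integral_dominated_convergence[where w = "\<lambda>x. K * indicator (cball 0 (R + 1)) x"])
    \<comment> \<open>steps are at most 1, so the quotients vanish at distance more than 1 from \<open>cball 0 R\<close>\<close>
    show "integrable lborel (\<lambda>x. K * indicator (cball 0 (R + 1)) (x :: real ^ 'n))"
      using emeasure_bounded_finite[of "cball (0 :: real ^ 'n) (R + 1)"]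
      by (intro integrable_mult_right integrable_real_indicator) auto
    have "(\<lambda>n. d n x) \<longlonglongrightarrow> partial j \<psi> x" for x
    proof -
      have "((\<lambda>s. (\<psi> (x + s *\<^sub>R e) - \<psi> x) / s) \<longlongrightarrow> partial j \<psi> x) (at 0)"
        using der[of x 0] by (simp add: DERIV_def)
      moreover have "filterlim h (at 0) sequentially"
        using h0 h(1) by (auto simp: filterlim_at intro!: always_eventually less_imp_neq[symmetric])
      ultimately show ?thesis unfolding d_def by (rule filterlim_compose)
    qed
    then show "AE x in lborel. (\<lambda>n. d n x) \<longlonglongrightarrow> partial j \<psi> x" by simp
    fix n
    have "norm (d n x) \<le> K * indicator (cball 0 (R + 1)) x" for x
    proof (cases "norm x \<le> R + 1")
      case True
      obtain s where "\<psi> (x + h n *\<^sub>R e) - \<psi> x = h n * partial j \<psi> (x + s *\<^sub>R e)"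
        using MVT2[OF h(1)[of n] der, of x] by auto
      then show ?thesis using True h(1)[of n] K(2) by (simp add: d_def abs_mult)
    next
      case False
      have "norm x \<le> norm (x + h n *\<^sub>R e) + h n"
        using norm_triangle_ineq4[of "x + h n *\<^sub>R e" "h n *\<^sub>R e"] h(1)[of n] ne by simp
      then have "\<psi> x = 0" "\<psi> (x + h n *\<^sub>R e) = 0" using False h(2)[of n] by (auto intro!: R(2))
      then show ?thesis using False by (simp add: d_def)
    qed
    then show "AE x in lborel. norm (d n x) \<le> K * indicator (cball 0 (R + 1)) x" by simp
  qed (use dm meas in simp_all)
  then have "integral\<^sup>L lborel (partial j \<psi>) = 0"
    using int0 by (simp add: LIMSEQ_const_iff)
  then show ?thesis using meas(2) by (simp add: integral_completion)
qed

lemma integral_lebesgue_on_zero_outside: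
  fixes f :: "real ^ 'n \<Rightarrow> real"
  assumes "w \<in> sets lebesgue" "\<And>x. x \<notin> w \<Longrightarrow> f x = 0"
  shows "integral\<^sup>L (lebesgue_on w) f = integral\<^sup>L lebesgue f"
proof -
  have "(\<lambda>x. indicator w x *\<^sub>R f x) = f" using assms(2) by (auto simp: indicator_def fun_eq_iff)
  then show ?thesis
    using integral_restrict_space[of w lebesgue f] assms(1) by simp
qed

text \<open>The product \<open>\<psi> \<phi>\<close> is itself a test function.\<close>

theorem integration_by_parts:
  assumes w: "w \<in> sets lebesgue" and phi: "\<phi> \<in> test_functions w" and psi: "\<And>k. C_k k \<psi>"
  shows "integral\<^sup>L (lebesgue_on w) (\<lambda>x. \<psi> x * partial j \<phi> x) =
      - integral\<^sup>L (lebesgue_on w) (\<lambda>x. partial j \<psi> x * \<phi> x)"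
proof -
  have integ: "integrable lebesgue f" if f: "f \<in> test_functions w" for f
  proof -
    obtain R where R: "\<And>x. R < norm x \<Longrightarrow> f x = 0"
      using test_functions_bounded_support[OF f] by blast
    have "integrable lborel (\<lambda>x. indicator (cball 0 R) x *\<^sub>R f x)"
      using borel_integrable_compact[of "cball 0 R" f] test_functions_D(3)[OF f]
      by (simp add: continuous_on_subset set_integrable_def)
    moreover have "(\<lambda>x. indicator (cball 0 R) x *\<^sub>R f x) = f"
      using R by (force simp: indicator_def fun_eq_iff)
    ultimately show ?thesis
      using borel_measurable_continuous_onI[OF test_functions_D(3)[OF f]] by (simp add: integrable_completion)
  qed
  have t: "(\<lambda>x. \<psi> x * partial j \<phi> x) \<in> test_functions w" "(\<lambda>x. partial j \<psi> x * \<phi> x) \<in> test_functions w"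
      "(\<lambda>x. \<psi> x * \<phi> x) \<in> test_functions w"
    using psi[of "Suc _"] by (auto intro!: test_functions_mult test_functions_partial phi psi)
  have "\<psi> differentiable (at x)" for x using psi[of 1] by simp
  then have "partial j (\<lambda>x. \<psi> x * \<phi> x) = (\<lambda>x. partial j \<psi> x * \<phi> x + \<psi> x * partial j \<phi> x)"
    using test_functions_D(2)[OF phi] by (intro ext partial_mult) auto
  then have "integral\<^sup>L lebesgue (\<lambda>x. partial j \<psi> x * \<phi> x + \<psi> x * partial j \<phi> x) = 0"
    using integral_partial_test_function[OF t(3), of j] by simp
  then have "integral\<^sup>L lebesgue (\<lambda>x. \<psi> x * partial j \<phi> x) = - integral\<^sup>L lebesgue (\<lambda>x. partial j \<psi> x * \<phi> x)"
    using integ[OF t(1)] integ[OF t(2)] by (simp add: add_eq_0_iff)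
  then show ?thesis
    using t(1,2) test_functions_zero_outside
    by (subst (1 2) integral_lebesgue_on_zero_outside[OF w]) blast+
qed

text \<open>The box \<open>box a b\<close> is the limit of the smooth functions below, each of which is positive exactly on
  that box.\<close>

lemma test_functions_approximate_box:
  fixes a b :: "real ^ 'n"
  assumes "cbox a b \<subseteq> w"
  shows "\<exists>\<phi>. (\<forall>n. \<phi> n \<in> test_functions w) \<and> (\<forall>n x. \<bar>\<phi> n x\<bar> \<le> 1) \<and>
      (\<forall>x. (\<lambda>n::nat. \<phi> n x) \<longlonglongrightarrow> indicator (box a b) x)"
proof -
  define g where "g n t = flat 1 (real (Suc n) * t)" for n t
  have g01: "0 \<le> g n t" "g n t \<le> 1" for n t
    using positive_imp_inverse_positive[of "real (Suc n) * t"]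
    by (auto simp: g_def flat_def simp del: inverse_mult_distrib of_nat_Suc)
  have glim: "(\<lambda>n. g n t) \<longlonglongrightarrow> (if 0 < t then 1 else 0)" for t
  proof (cases "0 < t")
    case True
    have "(\<lambda>n. exp (- (inverse (real (Suc n)) * inverse t))) \<longlonglongrightarrow> exp (- (0 * inverse t))"
      by (intro tendsto_intros LIMSEQ_inverse_real_of_nat)
    then show ?thesis using True by (simp add: g_def flat_def zero_less_mult_iff)
  next
    case False
    then have "g n t = 0" for n by (simp add: g_def flat_def mult_le_0_iff not_less del: of_nat_Suc)
    then show ?thesis using False by simp
  qed
  define \<phi> where "\<phi> n x = (\<Prod>i\<in>UNIV. g n (x $ i - a $ i) * g n (b $ i - x $ i))" for n and x :: "real ^ 'n"
  have "\<phi> n \<in> test_functions w" for n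
  proof (rule test_functionsI[of _ "cbox a b"])
    have "g n (x $ i - a $ i) = flat 1 (real (Suc n) * x $ i + - (real (Suc n) * a $ i))"
      "g n (b $ i - x $ i) = flat 1 (- real (Suc n) * x $ i + real (Suc n) * b $ i)" for x i
      by (simp_all add: g_def algebra_simps)
    then show "C_k k (\<phi> n)" for k
      unfolding \<phi>_def by (simp only:) (intro C_k_prod C_k_mult C_k_flat)
    fix x assume "x \<notin> cbox a b"
    then obtain i where "x $ i < a $ i \<or> b $ i < x $ i" by (auto simp: mem_box_cart not_le)
    then have "g n (x $ i - a $ i) * g n (b $ i - x $ i) = 0"
      by (auto simp: g_def flat_def zero_less_mult_iff)
    then show "\<phi> n x = 0" unfolding \<phi>_def by (intro prod_zero) auto
  qed (use assms in auto)
  moreover have "\<bar>\<phi> n x\<bar> \<le> 1" for n x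
    unfolding \<phi>_def abs_prod using g01 by (intro prod_le_1) (auto simp: abs_mult intro!: mult_le_one)
  moreover have "(\<lambda>n. \<phi> n x) \<longlonglongrightarrow> indicator (box a b) x" for x
  proof -
    have "(\<lambda>n. \<phi> n x) \<longlonglongrightarrow>
        (\<Prod>i\<in>UNIV. (if 0 < x $ i - a $ i then 1 else 0) * (if 0 < b $ i - x $ i then 1 else 0))"
      unfolding \<phi>_def by (intro tendsto_prod tendsto_mult glim)
    also have "(\<Prod>i\<in>UNIV. (if 0 < x $ i - a $ i then 1 else 0) * (if 0 < b $ i - x $ i then 1 else 0)) =
        (indicator (box a b) x :: real)"
    proof (cases "x \<in> box a b")
      case True
      then show ?thesis by (simp add: mem_box_cart)
    next
      case False
      then obtain i where "x $ i \<le> a $ i \<or> b $ i \<le> x $ i" by (auto simp: mem_box_cart not_less)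
      then show ?thesis using False by (subst prod_zero[of UNIV]) (auto intro: exI[of _ i])
    qed
    finally show ?thesis .
  qed
  ultimately show ?thesis by blast
qed

text \<open>Testing with approximations of boxes shows that the integral over every small box vanishes, and
  Lebesgue's differentiation theorem recovers the function from these integrals.\<close>

theorem fundamental_lemma:
  fixes g :: "real ^ 'n \<Rightarrow> real"
  assumes w: "open w" and g: "integrable (lebesgue_on w) g"
    and zero: "\<And>\<phi>. \<phi> \<in> test_functions w \<Longrightarrow> integral\<^sup>L (lebesgue_on w) (\<lambda>x. g x * \<phi> x) = 0"
  shows "AE x in lebesgue_on w. g x = 0"
proof -
  have wl: "w \<in> sets lebesgue" using w by simp
  define G where "G x = (if x \<in> w then g x else 0)" for x
  have "integrable lebesgue (\<lambda>x. indicator w x *\<^sub>R g x)"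
    using g wl by (simp add: integrable_restrict_space)
  moreover have "(\<lambda>x. indicator w x *\<^sub>R g x) = G" by (auto simp: G_def)
  ultimately have G: "integrable lebesgue G" by simp
  have Gon: "integrable (lebesgue_on S) G" if "S \<in> sets lebesgue" for S
    using integrable_mult_indicator[OF that G] that by (simp add: integrable_restrict_space)
  have box0: "integral (cbox a b) G = 0" if ab: "cbox a b \<subseteq> w" for a b
  proof -
    obtain \<phi> where \<phi>: "\<And>n. \<phi> n \<in> test_functions w" "\<And>n x. \<bar>\<phi> n x\<bar> \<le> 1"
        "\<And>x. (\<lambda>n::nat. \<phi> n x) \<longlonglongrightarrow> indicator (box a b) x"
      using test_functions_approximate_box[OF ab] by blast
    have m: "\<phi> n \<in> borel_measurable lebesgue" for n
      by (intro measurable_completion) (simp add: borel_measurable_continuous_onI[OF test_functions_D(3)[OF \<phi>(1)]])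
    have "(\<lambda>n. integral\<^sup>L lebesgue (\<lambda>x. G x * \<phi> n x)) \<longlonglongrightarrow> integral\<^sup>L lebesgue (\<lambda>x. G x * indicator (box a b) x)"
    proof (rule integral_dominated_convergence[where w = "\<lambda>x. norm (G x)"])
      show "AE x in lebesgue. (\<lambda>n. G x * \<phi> n x) \<longlonglongrightarrow> G x * indicator (box a b) x"
        by (intro AE_I2 tendsto_mult tendsto_const \<phi>)
      show "AE x in lebesgue. norm (G x * \<phi> n x) \<le> norm (G x)" for n
        using \<phi>(2) by (intro AE_I2) (simp add: abs_mult mult_left_le)
      show "(\<lambda>x. G x * \<phi> n x) \<in> borel_measurable lebesgue" for n
        using G m by (intro borel_measurable_times) auto
      show "(\<lambda>x. G x * indicator (box a b) x) \<in> borel_measurable lebesgue"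
        using G by (intro borel_measurable_times borel_measurable_indicator) auto
      show "integrable lebesgue (\<lambda>x. norm (G x))" using G by simp
    qed
    moreover have "integral\<^sup>L lebesgue (\<lambda>x. G x * \<phi> n x) = 0" for n
    proof -
      have "integral\<^sup>L lebesgue (\<lambda>x. G x * \<phi> n x) = integral\<^sup>L (lebesgue_on w) (\<lambda>x. G x * \<phi> n x)"
        by (rule integral_lebesgue_on_zero_outside[symmetric, OF wl]) (simp add: G_def)
      also have "\<dots> = integral\<^sup>L (lebesgue_on w) (\<lambda>x. g x * \<phi> n x)"
        by (rule Bochner_Integration.integral_cong) (auto simp: G_def)
      finally show ?thesis using zero[OF \<phi>(1)] by simp
    qed
    ultimately have "integral\<^sup>L lebesgue (\<lambda>x. G x * indicator (box a b) x) = 0"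
      by (simp add: LIMSEQ_const_iff)
    then have "integral\<^sup>L (lebesgue_on (box a b)) G = 0"
      by (simp add: integral_restrict_space mult.commute)
    then have "integral (box a b) G = 0"
      using lebesgue_integral_eq_integral[OF Gon[of "box a b"]] by simp
    then show ?thesis by (simp add: integral_open_interval)
  qed
  have "G integrable_on cbox a b" for a b
    using integrable_on_lebesgue_on[OF Gon[of "cbox a b"]] by simp
  then obtain N where N: "negligible N" "\<And>x e. x \<notin> N \<Longrightarrow> 0 < e \<Longrightarrow>
      \<exists>d>0. \<forall>h. 0 < h \<and> h < d \<longrightarrow>
        norm (integral (cbox x (x + h *\<^sub>R One)) G /\<^sub>R h ^ DIM(real ^ 'n) - G x) < e"
    using integrable_ccontinuous_explicit[of G] by metis
  have "G x = 0" if x: "x \<in> w" "x \<notin> N" for x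
  proof (rule ccontr)
    assume "G x \<noteq> 0"
    then obtain d where d: "0 < d" "\<And>h. 0 < h \<Longrightarrow> h < d \<Longrightarrow>
        norm (integral (cbox x (x + h *\<^sub>R One)) G /\<^sub>R h ^ DIM(real ^ 'n) - G x) < norm (G x)"
      using N(2)[OF x(2), of "norm (G x)"] by auto
    obtain r where r: "0 < r" "ball x r \<subseteq> w" using w x(1) openE by blast
    \<comment> \<open>small enough for the cube with corner \<open>x\<close> and side \<open>h\<close> to stay inside the ball\<close>
    define h where "h = min (d / 2) (r / (2 * norm (One :: real ^ 'n)))"
    have One: "0 < norm (One :: real ^ 'n)" by simp
    have h: "0 < h" "h < d" "h * norm (One :: real ^ 'n) < r"
      using d(1) r(1) One by (auto simp: h_def min_def field_simps split: if_splits)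
    have "cbox x (x + h *\<^sub>R One) \<subseteq> w"
    proof
      fix y assume y: "y \<in> cbox x (x + h *\<^sub>R One)"
      have "norm (y - x) \<le> norm (h *\<^sub>R (One :: real ^ 'n))"
        using y by (intro norm_le_componentwise)
          (auto simp: mem_box inner_diff_left inner_add_left algebra_simps)
      then show "y \<in> w" using h r(2) by (auto simp: dist_norm norm_minus_commute)
    qed
    then show False using d(2)[OF h(1,2)] box0 by simp
  qed
  then show ?thesis
    using N(1) wl by (subst AE_restrict_space_iff) (auto simp: G_def eventually_ae_filter negligible_iff_null_sets)
qed


section \<open>Sobolev spaces\<close>

locale region =
  fixes w :: "(real ^ 'n) set"
  assumes open_region: "open w" and bounded_region: "bounded w"
begin

lemma region_sets [simp]: "w \<in> sets lebesgue"
  using open_region by simp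

lemma fin: "finite_measure (lebesgue_on w)"
  by (rule finite_measure_lebesgue_on_bounded[OF region_sets bounded_region])

lemma test_functions_L2:
  assumes "\<phi> \<in> test_functions w"
  shows "\<phi> \<in> L2 w"
proof -
  obtain K where "\<And>x. \<bar>\<phi> x\<bar> \<le> K" using test_functions_bounded[OF assms] by blast
  moreover have "\<phi> \<in> borel_measurable (lebesgue_on w)"
    using test_functions_D(3)[OF assms]
    by (intro continuous_imp_measurable_on_sets_lebesgue) (auto intro: continuous_on_subset)
  ultimately show ?thesis by (intro L2_bounded[OF fin]) auto
qed

lemma test_functions_partial_L2: "\<phi> \<in> test_functions w \<Longrightarrow> partial j \<phi> \<in> L2 w"
  by (intro test_functions_L2 test_functions_partial)

lemma is_weak_grad_iff:
  "is_weak_grad w f g \<longleftrightarrow> (\<forall>\<phi> \<in> test_functions w. \<forall>j.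
     L2_inner w f (partial j \<phi>) = - L2_inner w (\<lambda>x. g x $ j) \<phi>)"
  by (simp add: is_weak_grad_def L2_inner_def)

lemma H1_L2: "f \<in> H1 w \<Longrightarrow> f \<in> L2 w"
  by (simp add: H1_def)

lemma H1_grad:
  assumes "f \<in> H1 w"
  shows "grad w f \<in> L2 w" "is_weak_grad w f (grad w f)"
  using assms someI_ex[of "\<lambda>g. g \<in> L2 w \<and> is_weak_grad w f g"] unfolding H1_def grad_def by auto

lemma weak_grad_add:
  assumes "is_weak_grad w f g" "is_weak_grad w f' g'" "f \<in> L2 w" "f' \<in> L2 w" "g \<in> L2 w" "g' \<in> L2 w"
  shows "is_weak_grad w (f + f') (g + g')"
  unfolding is_weak_grad_iff
proof (intro ballI allI)
  fix \<phi> j assume \<phi>: "\<phi> \<in> test_functions w"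
  have "(\<lambda>x. (g + g') x $ j) = (\<lambda>x. g x $ j) + (\<lambda>x. g' x $ j)" by (simp add: fun_eq_iff)
  then show "L2_inner w (f + f') (partial j \<phi>) = - L2_inner w (\<lambda>x. (g + g') x $ j) \<phi>"
    using assms \<phi> test_functions_L2[OF \<phi>] test_functions_partial_L2[OF \<phi>, of j]
    by (simp add: L2.add_left L2_component is_weak_grad_iff)
qed

lemma weak_grad_scale:
  assumes "is_weak_grad w f g" "f \<in> L2 w" "g \<in> L2 w"
  shows "is_weak_grad w (c *\<^sub>R f) (c *\<^sub>R g)"
  unfolding is_weak_grad_iff
proof (intro ballI allI)
  fix \<phi> j assume \<phi>: "\<phi> \<in> test_functions w"
  have "(\<lambda>x. (c *\<^sub>R g) x $ j) = c *\<^sub>R (\<lambda>x. g x $ j)" by (simp add: fun_eq_iff)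
  then show "L2_inner w (c *\<^sub>R f) (partial j \<phi>) = - L2_inner w (\<lambda>x. (c *\<^sub>R g) x $ j) \<phi>"
    using assms \<phi> test_functions_L2[OF \<phi>] test_functions_partial_L2[OF \<phi>, of j]
    by (simp add: L2.scale_left L2_component is_weak_grad_iff)
qed

text \<open>The gradient is selected among all weak gradients. Its linearity rests on their being equal up to
  null sets, which is the fundamental lemma applied to each component.\<close>

lemma weak_grad_unique:
  assumes "is_weak_grad w f g" "is_weak_grad w f g'" "g \<in> L2 w" "g' \<in> L2 w"
  shows "AE x in lebesgue_on w. g x = g' x"
proof -
  have "AE x in lebesgue_on w. g x $ j - g' x $ j = 0" for j
  proof (rule fundamental_lemma[OF open_region])
    have c: "(\<lambda>x. g x $ j) \<in> L2 w" "(\<lambda>x. g' x $ j) \<in> L2 w" using assms L2_component by auto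
    have eq: "(\<lambda>x. g x $ j - g' x $ j) = (\<lambda>x. g x $ j) - (\<lambda>x. g' x $ j)" by (simp add: fun_eq_iff)
    show "integrable (lebesgue_on w) (\<lambda>x. g x $ j - g' x $ j)"
      unfolding eq by (intro L2_integrable[OF fin] subspace_diff[OF subspace_L2] c)
    fix \<phi> assume \<phi>: "\<phi> \<in> test_functions w"
    have "L2_inner w (\<lambda>x. g x $ j - g' x $ j) \<phi> = 0"
      unfolding eq using assms \<phi> c test_functions_L2[OF \<phi>]
      by (simp add: L2.diff_left is_weak_grad_iff)
    then show "integral\<^sup>L (lebesgue_on w) (\<lambda>x. (g x $ j - g' x $ j) * \<phi> x) = 0"
      by (simp add: L2_inner_def)
  qed
  then have "AE x in lebesgue_on w. \<forall>j. g x $ j - g' x $ j = 0"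
    by (simp add: AE_all_countable)
  then show ?thesis by eventually_elim (simp add: vec_eq_iff)
qed

lemma grad_unique:
  assumes "f \<in> L2 w" "g \<in> L2 w" "is_weak_grad w f g"
  shows "f \<in> H1 w" "AE x in lebesgue_on w. grad w f x = g x"
proof -
  show f: "f \<in> H1 w" using assms by (auto simp: H1_def)
  show "AE x in lebesgue_on w. grad w f x = g x"
    using weak_grad_unique[OF H1_grad(2)[OF f] assms(3) H1_grad(1)[OF f] assms(2)] .
qed

lemma H1_add:
  assumes "f \<in> H1 w" "g \<in> H1 w"
  shows "f + g \<in> H1 w" "AE x in lebesgue_on w. grad w (f + g) x = grad w f x + grad w g x"
proof -
  have "is_weak_grad w (f + g) (grad w f + grad w g)"
    using assms by (intro weak_grad_add H1_grad H1_L2)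
  from grad_unique[OF _ _ this] show "f + g \<in> H1 w"
      "AE x in lebesgue_on w. grad w (f + g) x = grad w f x + grad w g x"
    using assms by (simp_all add: subspace_add[OF subspace_L2] H1_grad H1_L2)
qed

lemma H1_scale:
  assumes "f \<in> H1 w"
  shows "c *\<^sub>R f \<in> H1 w" "AE x in lebesgue_on w. grad w (c *\<^sub>R f) x = c *\<^sub>R grad w f x"
proof -
  have "is_weak_grad w (c *\<^sub>R f) (c *\<^sub>R grad w f)"
    using assms by (intro weak_grad_scale H1_grad H1_L2)
  from grad_unique[OF _ _ this] show "c *\<^sub>R f \<in> H1 w"
      "AE x in lebesgue_on w. grad w (c *\<^sub>R f) x = c *\<^sub>R grad w f x"
    using assms by (simp_all add: subspace_scale[OF subspace_L2] H1_grad H1_L2)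
qed

lemma H1_smooth:
  assumes "\<And>k. C_k k \<psi>" "\<psi> \<in> L2 w" "\<And>j. partial j \<psi> \<in> L2 w"
  shows "\<psi> \<in> H1 w"
proof (rule grad_unique(1)[OF assms(2)])
  show "(\<lambda>x. \<chi> j. partial j \<psi> x) \<in> L2 w" using assms(3) by (intro L2_vec) simp
  show "is_weak_grad w \<psi> (\<lambda>x. \<chi> j. partial j \<psi> x)"
    unfolding is_weak_grad_def using integration_by_parts[OF region_sets _ assms(1)] by simp
qed

lemma test_functions_H1: "\<phi> \<in> test_functions w \<Longrightarrow> \<phi> \<in> H1 w"
  by (intro H1_smooth test_functions_L2 test_functions_partial_L2 test_functions_D(1))

lemma affine_H1: "(\<lambda>x. c \<bullet> x + d) \<in> H1 w"
proof (rule H1_smooth)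
  obtain R where R: "\<And>x. x \<in> w \<Longrightarrow> norm x \<le> R" using bounded_region by (auto simp: bounded_iff)
  show "(\<lambda>x. c \<bullet> x + d) \<in> L2 w"
  proof (rule L2_bounded[OF fin])
    show "(\<lambda>x. c \<bullet> x + d) \<in> borel_measurable (lebesgue_on w)"
      by (intro continuous_imp_measurable_on_sets_lebesgue continuous_intros) simp
    show "norm (c \<bullet> x + d) \<le> norm c * R + \<bar>d\<bar>" if "x \<in> w" for x
      using Cauchy_Schwarz_ineq2[of c x] mult_left_mono[OF R[OF that], of "norm c"] by simp
  qed
  have "partial j (\<lambda>x. c \<bullet> x + d) = (\<lambda>x. c $ j)" for j by (simp add: fun_eq_iff C_k_affine)
  then show "partial j (\<lambda>x. c \<bullet> x + d) \<in> L2 w" for j using L2_const[OF fin] by simp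
qed (rule C_k_affine)

lemma zero_H1: "0 \<in> H1 w"
  using affine_H1[of 0 0] by (simp add: zero_fun_def)

lemma subspace_H1: "subspace (H1 w)"
  by (intro subspaceI zero_H1 H1_add H1_scale)

lemma H1_diff:
  assumes "f \<in> H1 w" "g \<in> H1 w"
  shows "f - g \<in> H1 w" "AE x in lebesgue_on w. grad w (f - g) x = grad w f x - grad w g x"
proof -
  show "f - g \<in> H1 w" using subspace_diff[OF subspace_H1 assms] .
  show "AE x in lebesgue_on w. grad w (f - g) x = grad w f x - grad w g x"
    using H1_add(2)[OF assms(1) H1_scale(1)[OF assms(2)], of "-1"] H1_scale(2)[OF assms(2), of "-1"]
    by eventually_elim simp
qed

text \<open>Functions that agree almost everywhere have the same weak gradients, so the same one is chosen.\<close>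

lemma grad_cong:
  assumes "AE x in lebesgue_on w. f x = g x" "f \<in> L2 w" "g \<in> L2 w"
  shows "grad w f = grad w g" "f \<in> H1 w \<longleftrightarrow> g \<in> H1 w"
proof -
  have "is_weak_grad w f h \<longleftrightarrow> is_weak_grad w g h" for h
    unfolding is_weak_grad_iff
    using L2_inner_cong[OF assms(1) _ assms(2) _ assms(3)] test_functions_partial_L2
    by (smt (verit, ccfv_SIG) AE_cong AE_I2)
  then show "grad w f = grad w g" "f \<in> H1 w \<longleftrightarrow> g \<in> H1 w"
    using assms by (simp_all add: grad_def H1_def)
qed

lemma grad_inner_bilinear:
  assumes "f \<in> H1 w" "g \<in> H1 w" "h \<in> H1 w"
  shows "L2_inner w (grad w (f + g)) (grad w h) = L2_inner w (grad w f) (grad w h) + L2_inner w (grad w g) (grad w h)"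
    and "L2_inner w (grad w (c *\<^sub>R f)) (grad w h) = c * L2_inner w (grad w f) (grad w h)"
proof -
  have "L2_inner w (grad w (f + g)) (grad w h) = L2_inner w (grad w f + grad w g) (grad w h)"
    using assms H1_add[OF assms(1,2)]
    by (intro L2_inner_cong) (auto simp: H1_grad subspace_add[OF subspace_L2])
  then show "L2_inner w (grad w (f + g)) (grad w h) = L2_inner w (grad w f) (grad w h) + L2_inner w (grad w g) (grad w h)"
    using assms by (simp add: H1_grad L2.add_left)
  have "L2_inner w (grad w (c *\<^sub>R f)) (grad w h) = L2_inner w (c *\<^sub>R grad w f) (grad w h)"
    using assms H1_scale[OF assms(1), of c]
    by (intro L2_inner_cong) (auto simp: H1_grad subspace_scale[OF subspace_L2])
  then show "L2_inner w (grad w (c *\<^sub>R f)) (grad w h) = c * L2_inner w (grad w f) (grad w h)"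
    using assms by (simp add: H1_grad L2.scale_left)
qed

definition H1_inner :: "real \<Rightarrow> (real ^ 'n \<Rightarrow> real) \<Rightarrow> (real ^ 'n \<Rightarrow> real) \<Rightarrow> real" where
  "H1_inner c f g = L2_inner w (grad w f) (grad w g) + c * L2_inner w f g"

lemma H1_semi_inner:
  assumes "0 \<le> c"
  shows "semi_inner (H1 w) (H1_inner c)"
proof (unfold_locales, goal_cases)
  case 1 then show ?case by (rule subspace_H1)
next
  case (2 x y z) then show ?case by (simp add: H1_inner_def grad_inner_bilinear L2.add_left H1_L2 algebra_simps)
next
  case (3 k x z) then show ?case by (simp add: H1_inner_def grad_inner_bilinear L2.scale_left H1_L2 algebra_simps)
next
  case (4 x y) then show ?case by (simp add: H1_inner_def L2.sym H1_grad H1_L2)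
next
  case (5 x) then show ?case using assms by (simp add: H1_inner_def L2.nonneg H1_grad H1_L2)
qed

text \<open>The weak gradient is a closed operator: both sides of its defining identity are continuous in
  \<open>L\<^sup>2\<close>.\<close>

lemma weak_grad_limit:
  assumes X: "\<And>n. X n \<in> L2 w" "\<And>n. G n \<in> L2 w" "\<And>n. is_weak_grad w (X n) (G n)"
    and f: "f \<in> L2 w" "(\<lambda>n. L2_inner w (X n - f) (X n - f)) \<longlonglongrightarrow> 0"
    and g: "g \<in> L2 w" "(\<lambda>n. L2_inner w (G n - g) (G n - g)) \<longlonglongrightarrow> 0"
  shows "is_weak_grad w f g"
  unfolding is_weak_grad_iff
proof (intro ballI allI)
  fix \<phi> j assume \<phi>: "\<phi> \<in> test_functions w"
  have lim1: "(\<lambda>n. L2_inner w (X n) (partial j \<phi>)) \<longlonglongrightarrow> L2_inner w f (partial j \<phi>)"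
    by (rule L2_inner_tendsto[OF X(1) f test_functions_partial_L2[OF \<phi>]])
  \<comment> \<open>one component of a field is its inner product with a coordinate vector\<close>
  have "(\<lambda>n. L2_inner w (G n) (\<lambda>x. \<phi> x *\<^sub>R axis j 1)) \<longlonglongrightarrow> L2_inner w g (\<lambda>x. \<phi> x *\<^sub>R axis j 1)"
  proof (rule L2_inner_tendsto[OF X(2) g])
    show "(\<lambda>x. \<phi> x *\<^sub>R axis j 1 :: real ^ 'n) \<in> L2 w"
    proof (rule L2_vec)
      fix i
      have "(\<lambda>x. (\<phi> x *\<^sub>R axis j 1 :: real ^ 'n) $ i) = (axis j 1 $ i :: real) *\<^sub>R \<phi>"
        by (simp add: fun_eq_iff)
      then show "(\<lambda>x. (\<phi> x *\<^sub>R axis j 1 :: real ^ 'n) $ i) \<in> L2 w"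
        using subspace_scale[OF subspace_L2 test_functions_L2[OF \<phi>]] by simp
    qed
  qed
  then have lim2: "(\<lambda>n. L2_inner w (\<lambda>x. G n x $ j) \<phi>) \<longlonglongrightarrow> L2_inner w (\<lambda>x. g x $ j) \<phi>"
    by (simp add: L2_inner_def inner_axis mult.commute)
  have "L2_inner w (X n) (partial j \<phi>) = - L2_inner w (\<lambda>x. G n x $ j) \<phi>" for n
    using X(3) \<phi> by (simp add: is_weak_grad_iff)
  with lim1 have "(\<lambda>n. - L2_inner w (\<lambda>x. G n x $ j) \<phi>) \<longlonglongrightarrow> L2_inner w f (partial j \<phi>)" by simp
  then show "L2_inner w f (partial j \<phi>) = - L2_inner w (\<lambda>x. g x $ j) \<phi>"
    using tendsto_minus[OF lim2] LIMSEQ_unique by blast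
qed

lemma L2_0_eq: "L2_0 w = {f \<in> L2 w. L2_inner w f (\<lambda>x. 1) = 0}"
  by (simp add: L2_0_def L2_inner_def)

lemma subspace_L2_0: "subspace (L2_0 w)"
  using subspace_L2[of w] L2_const[OF fin, of 1] L2.closed
  by (auto simp: subspace_def L2_0_eq L2.add_left L2.scale_left)
     (simp add: L2_inner_def)

text \<open>A Cauchy sequence and its gradients converge separately in \<open>L\<^sup>2\<close>, and the limits fit together. The
  mean is an \<open>L\<^sup>2\<close> inner product with \<open>1\<close>, hence continuous.\<close>

theorem H1_complete:
  assumes c: "0 < c"
  shows "complete_semi_inner (H1 w \<inter> L2_0 w) (H1_inner c)"
proof -
  interpret E: semi_inner "H1 w" "H1_inner c" using H1_semi_inner c by simp
  show ?thesis
  proof (unfold_locales, goal_cases)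
    case 1 then show ?case by (intro subspace_inter subspace_H1 subspace_L2_0)
  next
    case (2 x y z) then show ?case by (simp add: E.add_left)
  next
    case (3 c x z) then show ?case by (simp add: E.scale_left)
  next
    case (4 x y) then show ?case by (simp add: E.sym)
  next
    case (5 x) then show ?case by (simp add: E.nonneg)
  next
    case (6 X)
    have X: "X n \<in> H1 w" "X n \<in> L2 w" "grad w (X n) \<in> L2 w" "L2_inner w (X n) (\<lambda>x. 1) = 0" for n
      using 6(1)[of n] by (auto simp: H1_L2 H1_grad L2_0_eq)
    have gd: "L2_inner w (grad w (X m) - grad w (X n)) (grad w (X m) - grad w (X n))
        = L2_inner w (grad w (X m - X n)) (grad w (X m - X n))" for m n
      using H1_diff[OF X(1) X(1), of m n] X(3)
      by (intro L2_inner_cong) (auto simp: H1_grad subspace_diff[OF subspace_L2])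
    have split: "L2_inner w (X m - X n) (X m - X n) \<le> H1_inner c (X m - X n) (X m - X n) / c"
      "L2_inner w (grad w (X m) - grad w (X n)) (grad w (X m) - grad w (X n)) \<le> H1_inner c (X m - X n) (X m - X n)"
      for m n
      using c L2.nonneg[of "X m - X n" w] L2.nonneg[of "grad w (X m - X n)" w] H1_diff(1)[OF X(1) X(1), of m n]
      unfolding gd by (simp_all add: H1_inner_def field_simps H1_grad H1_L2)
    have "\<exists>N. \<forall>m\<ge>N. \<forall>n\<ge>N. L2_inner w (X m - X n) (X m - X n) < e" if e: "0 < e" for e
    proof -
      obtain N where N: "\<forall>m\<ge>N. \<forall>n\<ge>N. H1_inner c (X m - X n) (X m - X n) < e * c"
        using 6(2)[of "e * c"] e c by auto
      have "L2_inner w (X m - X n) (X m - X n) < e" if "m \<ge> N" "n \<ge> N" for m n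
        by (rule le_less_trans[OF split(1)]) (use N that c in \<open>simp add: pos_divide_less_eq\<close>)
      then show ?thesis by blast
    qed
    from L2_complete[OF fin X(2) this]
    obtain f where f: "f \<in> L2 w" "(\<lambda>n. L2_inner w (X n - f) (X n - f)) \<longlonglongrightarrow> 0"
      by blast
    have "\<exists>N. \<forall>m\<ge>N. \<forall>n\<ge>N. L2_inner w (grad w (X m) - grad w (X n)) (grad w (X m) - grad w (X n)) < e"
      if "0 < e" for e
      using 6(2)[OF that] split(2) by (meson le_less_trans)
    from L2_complete[OF fin X(3) this]
    obtain g where g: "g \<in> L2 w" "(\<lambda>n. L2_inner w (grad w (X n) - g) (grad w (X n) - g)) \<longlonglongrightarrow> 0"
      by blast
    have fg: "f \<in> H1 w" "AE x in lebesgue_on w. grad w f x = g x"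
      using grad_unique[OF f(1) g(1) weak_grad_limit[OF X(2,3) H1_grad(2)[OF X(1)] f g]] by auto
    have "(\<lambda>n. L2_inner w (X n) (\<lambda>x. 1)) \<longlonglongrightarrow> L2_inner w f (\<lambda>x. 1)"
      by (rule L2_inner_tendsto[OF X(2) f L2_const[OF fin]])
    then have "f \<in> L2_0 w" using f(1) X(4) by (simp add: L2_0_eq LIMSEQ_const_iff)
    moreover have "L2_inner w (grad w (X n - f)) (grad w (X n - f)) = L2_inner w (grad w (X n) - g) (grad w (X n) - g)" for n
    proof (rule L2_inner_cong)
      show "AE x in lebesgue_on w. grad w (X n - f) x = (grad w (X n) - g) x"
        using H1_diff(2)[OF X(1)[of n] fg(1)] fg(2) by eventually_elim simp
      then show "AE x in lebesgue_on w. grad w (X n - f) x = (grad w (X n) - g) x" .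
    qed (use X fg g H1_diff(1)[OF X(1)[of n] fg(1)] in \<open>auto simp: H1_grad subspace_diff[OF subspace_L2]\<close>)
    then have "(\<lambda>n. H1_inner c (X n - f) (X n - f)) \<longlonglongrightarrow> 0"
      using tendsto_add[OF g(2) tendsto_mult[OF tendsto_const[of c] f(2)]] by (simp add: H1_inner_def)
    ultimately show ?case using fg(1) by blast
  qed
qed

lemma H1_norm_eq: "H1_norm w f = sqrt (H1_inner 1 f f)"
  by (simp add: H1_norm_def H1_inner_def add.commute)

lemma H1_0_H1: "f \<in> H1_0 w \<Longrightarrow> f \<in> H1 w"
  by (simp add: H1_0_def)

lemma subspace_H1_0: "subspace (H1_0 w)"
proof -
  interpret E: semi_inner "H1 w" "H1_inner 1" by (rule H1_semi_inner) simp
  have approx: "\<exists>\<phi> \<in> test_functions w. H1_norm w (f - \<phi>) < e" if "f \<in> H1_0 w" "0 < e" for f e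
    using that by (auto simp: H1_0_def fun_diff_def)
  have I: "f \<in> H1_0 w" if "f \<in> H1 w" "\<And>e. 0 < e \<Longrightarrow> \<exists>\<phi> \<in> test_functions w. H1_norm w (f - \<phi>) < e" for f
    using that by (auto simp: H1_0_def fun_diff_def)
  show ?thesis
  proof (rule subspaceI)
    show "0 \<in> H1_0 w"
    proof (rule I[OF zero_H1])
      fix e :: real assume "0 < e"
      moreover have "(0 :: real ^ 'n \<Rightarrow> real) \<in> test_functions w"
        by (rule test_functionsI[of _ "{}"]) (auto simp: zero_fun_def C_k_const)
      moreover have "H1_inner 1 0 0 = 0" using E.scale_left[OF zero_H1 zero_H1, of 0] by simp
      ultimately show "\<exists>\<phi> \<in> test_functions w. H1_norm w (0 - \<phi>) < e"
        by (intro bexI[of _ 0]) (auto simp: H1_norm_eq)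
    qed
    fix f assume f: "f \<in> H1_0 w"
    show "f + g \<in> H1_0 w" if g: "g \<in> H1_0 w" for g
    proof (rule I[OF H1_add(1)[OF H1_0_H1[OF f] H1_0_H1[OF g]]])
      fix e :: real assume "0 < e"
      then obtain \<phi> \<psi> where p: "\<phi> \<in> test_functions w" "H1_norm w (f - \<phi>) < e / 2"
          "\<psi> \<in> test_functions w" "H1_norm w (g - \<psi>) < e / 2"
        using approx[OF f, of "e / 2"] approx[OF g, of "e / 2"] by auto
      have eq: "f + g - (\<phi> + \<psi>) = (f - \<phi>) + (g - \<psi>)" by (simp add: algebra_simps)
      have "H1_norm w (f + g - (\<phi> + \<psi>)) < e"
        unfolding eq using E.triangle[of "f - \<phi>" "g - \<psi>"] p f g
        by (simp add: H1_norm_eq H1_diff H1_0_H1 test_functions_H1)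
      then show "\<exists>\<phi> \<in> test_functions w. H1_norm w (f + g - \<phi>) < e"
        using test_functions_add[OF p(1,3)] by (auto simp: plus_fun_def)
    qed
    show "c *\<^sub>R f \<in> H1_0 w" for c
    proof (rule I[OF H1_scale(1)[OF H1_0_H1[OF f]]])
      fix e :: real assume e: "0 < e"
      \<comment> \<open>\<open>\<bar>c\<bar> + 1\<close> rather than \<open>\<bar>c\<bar>\<close>, which may be zero\<close>
      then obtain \<phi> where p: "\<phi> \<in> test_functions w" "H1_norm w (f - \<phi>) < e / (\<bar>c\<bar> + 1)"
        using approx[OF f, of "e / (\<bar>c\<bar> + 1)"] by auto
      have d: "f - \<phi> \<in> H1 w" using p f by (simp add: H1_diff H1_0_H1 test_functions_H1)
      have "H1_norm w (c *\<^sub>R f - c *\<^sub>R \<phi>) = H1_norm w (c *\<^sub>R (f - \<phi>))" by (simp add: scaleR_diff_right)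
      also have "\<dots> = \<bar>c\<bar> * H1_norm w (f - \<phi>)"
        using d by (simp add: H1_norm_eq E.scale_left E.scale_right E.closed real_sqrt_mult flip: mult.assoc)
      also have "\<dots> \<le> (\<bar>c\<bar> + 1) * H1_norm w (f - \<phi>)"
        using E.nonneg[OF d] by (intro mult_right_mono) (auto simp: H1_norm_eq)
      also have "\<dots> < e" using p(2) by (simp add: field_simps)
      finally have "H1_norm w (c *\<^sub>R f - c *\<^sub>R \<phi>) < e" .
      moreover have "c *\<^sub>R \<phi> \<in> test_functions w"
        using test_functions_mult[OF p(1) C_k_const, of c] by (simp add: scaleR_fun_def)
      ultimately show "\<exists>\<phi> \<in> test_functions w. H1_norm w (c *\<^sub>R f - \<phi>) < e" by blast
    qed
  qed
qed

text \<open>Test functions on the smaller region are test functions on the larger one.\<close>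

lemma H1_restrict:
  assumes "f \<in> H1 w'" "w \<subseteq> w'" "w' \<in> sets lebesgue"
  shows "f \<in> H1 w"
proof -
  obtain g where g: "f \<in> L2 w'" "g \<in> L2 w'" "is_weak_grad w' f g" using assms(1) by (auto simp: H1_def)
  have "is_weak_grad w f g"
    unfolding is_weak_grad_def
  proof (intro ballI allI)
    fix \<phi> j assume \<phi>: "\<phi> \<in> test_functions w"
    then have \<phi>': "\<phi> \<in> test_functions w'" using test_functions_mono[OF assms(2)] by blast
    have z: "\<phi> x = 0" "partial j \<phi> x = 0" if "x \<notin> w" for x
      using that test_functions_zero_outside \<phi> test_functions_partial[OF \<phi>] by blast+
    have e: "integral\<^sup>L (lebesgue_on w) h = integral\<^sup>L (lebesgue_on w') h" if "\<And>x. x \<notin> w \<Longrightarrow> h x = 0" for h :: "real ^ 'n \<Rightarrow> real"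
      using integral_lebesgue_on_zero_outside[OF region_sets, of h]
        integral_lebesgue_on_zero_outside[OF assms(3), of h] that assms(2) by (metis subsetD)
    show "integral\<^sup>L (lebesgue_on w) (\<lambda>x. f x * partial j \<phi> x) = - integral\<^sup>L (lebesgue_on w) (\<lambda>x. g x $ j * \<phi> x)"
      using g(3) \<phi>' z by (subst (1 2) e) (auto simp: is_weak_grad_def)
  qed
  moreover have "f \<in> L2 w" "g \<in> L2 w" using g assms by (auto intro: L2_mono)
  ultimately show ?thesis by (auto simp: H1_def)
qed

end


lemma sum_fun_apply: "(\<Sum>i\<in>A. f i) x = (\<Sum>i\<in>A. f i x)"
  by (induction A rule: infinite_finite_induct) auto

lemma AE_mono_region:
  assumes "AE x in lebesgue_on w'. P x" "w \<subseteq> w'" "w \<in> sets lebesgue" "w' \<in> sets lebesgue"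
  shows "AE x in lebesgue_on w. P x"
  using assms by (auto simp: AE_restrict_space_iff elim: eventually_mono)

lemma subspace_vec_fields:
  assumes "subspace X"
  shows "subspace (vec_fields X)"
proof (rule subspaceI)
  show "0 \<in> vec_fields X" using subspace_0[OF assms] by (simp add: vec_fields_def zero_fun_def)
  fix u assume u: "u \<in> vec_fields X"
  show "u + v \<in> vec_fields X" if v: "v \<in> vec_fields X" for v
  proof -
    have "(\<lambda>x. (u + v) x $ i) = (\<lambda>x. u x $ i) + (\<lambda>x. v x $ i)" for i by (simp add: fun_eq_iff)
    then show ?thesis using u v subspace_add[OF assms] by (simp add: vec_fields_def)
  qed
  show "c *\<^sub>R u \<in> vec_fields X" for c
  proof -
    have "(\<lambda>x. (c *\<^sub>R u) x $ i) = c *\<^sub>R (\<lambda>x. u x $ i)" for i by (simp add: fun_eq_iff)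
    then show ?thesis using u subspace_scale[OF assms] by (simp add: vec_fields_def)
  qed
qed

context region
begin

subsection \<open>Vector fields\<close>

abbreviation "H1v \<equiv> vec_fields (H1 w)"

lemma subspace_H1v: "subspace H1v"
  by (intro subspace_vec_fields subspace_H1)

lemma H1v_L2: "u \<in> H1v \<Longrightarrow> u \<in> L2 w"
  by (intro L2_vec H1_L2) (simp add: vec_fields_def)

lemma vgrad_add:
  assumes "u \<in> H1v" "v \<in> H1v"
  shows "AE x in lebesgue_on w. vgrad w (u + v) x = vgrad w u x + vgrad w v x"
proof -
  have "AE x in lebesgue_on w. \<forall>i. grad w ((\<lambda>y. u y $ i) + (\<lambda>y. v y $ i)) x =
      grad w (\<lambda>y. u y $ i) x + grad w (\<lambda>y. v y $ i) x"
    using assms H1_add(2) by (simp add: AE_all_countable vec_fields_def)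
  then show ?thesis by eventually_elim (simp add: vgrad_def vec_eq_iff plus_fun_def)
qed

lemma vgrad_scale:
  assumes "u \<in> H1v"
  shows "AE x in lebesgue_on w. vgrad w (c *\<^sub>R u) x = c *\<^sub>R vgrad w u x"
proof -
  have "AE x in lebesgue_on w. \<forall>i. grad w (c *\<^sub>R (\<lambda>y. u y $ i)) x = c *\<^sub>R grad w (\<lambda>y. u y $ i) x"
    using assms H1_scale(2) by (simp add: AE_all_countable vec_fields_def)
  then show ?thesis by eventually_elim (simp add: vgrad_def vec_eq_iff scaleR_fun_def)
qed

lemma vgrad_null:
  assumes "u \<in> H1v" "AE x in lebesgue_on w. u x = 0"
  shows "AE x in lebesgue_on w. vgrad w u x = 0"
proof -
  have "grad w (\<lambda>y. u y $ i) = grad w 0" for i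
    using assms by (intro grad_cong) (auto simp: vec_fields_def H1_L2 zero_H1 elim!: eventually_mono)
  moreover have "AE x in lebesgue_on w. grad w 0 x = 0"
    using H1_scale(2)[OF zero_H1, of 0] by simp
  ultimately show ?thesis by (auto simp: vgrad_def vec_eq_iff)
qed

lemma strain_component: "(\<lambda>x. strain w u x $ i $ j) = (1/2) *\<^sub>R ((\<lambda>x. vgrad w u x $ i $ j) + (\<lambda>x. vgrad w u x $ j $ i))"
  by (simp add: strain_def transpose_def fun_eq_iff)

lemma strain_L2:
  assumes "u \<in> H1v"
  shows "strain w u \<in> L2 w"
proof (intro L2_vec)
  fix i j
  have "(\<lambda>x. vgrad w u x $ k $ l) \<in> L2 w" for k l
    using assms by (simp add: vgrad_def vec_fields_def L2_component H1_grad)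
  then show "(\<lambda>x. strain w u x $ i $ j) \<in> L2 w"
    unfolding strain_component using subspace_scale[OF subspace_L2 subspace_add[OF subspace_L2]] by blast
qed

lemma transpose_add: "transpose (A + B) = transpose A + transpose (B :: real ^ 'n ^ 'n)"
  by (simp add: transpose_def vec_eq_iff)

lemma transpose_scaleR: "transpose (c *\<^sub>R A) = c *\<^sub>R transpose (A :: real ^ 'n ^ 'n)"
  by (simp add: transpose_def vec_eq_iff)

lemma strain_add:
  "u \<in> H1v \<Longrightarrow> v \<in> H1v \<Longrightarrow> AE x in lebesgue_on w. strain w (u + v) x = strain w u x + strain w v x"
  using vgrad_add[of u v]
  by (auto simp: strain_def transpose_add scaleR_add_right elim!: eventually_mono)

lemma strain_scale:
  "u \<in> H1v \<Longrightarrow> AE x in lebesgue_on w. strain w (c *\<^sub>R u) x = c *\<^sub>R strain w u x"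
  using vgrad_scale[of u c]
  by (auto simp: strain_def transpose_scaleR scaleR_add_right elim!: eventually_mono)

text \<open>On the whole domain this is \<open>c m + a\<close>, and on the solid it is the form of the Lagrange multiplier
  space.\<close>

definition elastic :: "real \<Rightarrow> (real ^ 'n \<Rightarrow> real ^ 'n) \<Rightarrow> (real ^ 'n \<Rightarrow> real ^ 'n) \<Rightarrow> real" where
  "elastic c u v = c * L2_inner w u v + 2 * L2_inner w (strain w u) (strain w v)"

lemma elastic_semi_inner:
  assumes "0 \<le> c"
  shows "semi_inner H1v (elastic c)"
proof (unfold_locales, goal_cases)
  case 1 then show ?case by (rule subspace_H1v)
next
  case (2 x y z)
  have "L2_inner w (strain w (x + y)) (strain w z) = L2_inner w (strain w x + strain w y) (strain w z)"
    using 2 strain_add[of x y]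
    by (intro L2_inner_cong) (auto simp: strain_L2 subspace_add[OF subspace_L2] subspace_add[OF subspace_H1v])
  then show ?case using 2 by (simp add: elastic_def L2.add_left H1v_L2 strain_L2 algebra_simps)
next
  case (3 k x z)
  have "L2_inner w (strain w (k *\<^sub>R x)) (strain w z) = L2_inner w (k *\<^sub>R strain w x) (strain w z)"
    using 3 strain_scale[of x k]
    by (intro L2_inner_cong) (auto simp: strain_L2 subspace_scale[OF subspace_L2] subspace_scale[OF subspace_H1v])
  then show ?case using 3 by (simp add: elastic_def L2.scale_left H1v_L2 strain_L2 algebra_simps)
next
  case (4 x y) then show ?case by (simp add: elastic_def L2.sym H1v_L2 strain_L2)
next
  case (5 x) then show ?case using assms by (simp add: elastic_def L2.nonneg H1v_L2 strain_L2)
qed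

lemma elastic_null:
  assumes "u \<in> H1v" "AE x in lebesgue_on w. u x = 0"
  shows "elastic c u u = 0"
proof -
  have "AE x in lebesgue_on w. strain w u x = 0"
    using vgrad_null[OF assms] by eventually_elim (simp add: strain_def transpose_def vec_eq_iff)
  then show ?thesis using assms(2) by (simp add: elastic_def L2_inner_null)
qed

lemma divergence_L2:
  assumes "u \<in> H1v"
  shows "divergence w u \<in> L2 w"
proof -
  have eq: "divergence w u = (\<Sum>i\<in>UNIV. (\<lambda>x. vgrad w u x $ i $ i))"
    by (simp add: fun_eq_iff divergence_def trace_def sum_fun_apply)
  have "(\<lambda>x. vgrad w u x $ i $ i) \<in> L2 w" for i
    using assms by (simp add: vgrad_def vec_fields_def L2_component H1_grad)
  then show ?thesis unfolding eq by (intro subspace_sum[OF subspace_L2]) auto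
qed

lemma divergence_add:
  "u \<in> H1v \<Longrightarrow> v \<in> H1v \<Longrightarrow> AE x in lebesgue_on w. divergence w (u + v) x = divergence w u x + divergence w v x"
  using vgrad_add[of u v] by (auto simp: divergence_def trace_add elim!: eventually_mono)

lemma divergence_scale:
  "u \<in> H1v \<Longrightarrow> AE x in lebesgue_on w. divergence w (c *\<^sub>R u) x = c *\<^sub>R divergence w u x"
  using vgrad_scale[of u c]
  by (auto simp: divergence_def trace_def sum_distrib_left elim!: eventually_mono)

end


section \<open>Finite element spaces are finite-dimensional\<close>

definition monomial_at :: "('n \<Rightarrow> nat) \<Rightarrow> real ^ 'n \<Rightarrow> real" where
  "monomial_at a x = (\<Prod>i\<in>UNIV. (x $ i) ^ a i)"

lemma finite_multi_indices: "finite {a :: 'n::finite \<Rightarrow> nat. sum a UNIV \<le> k}"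
proof (rule finite_subset)
  show "{a :: 'n \<Rightarrow> nat. sum a UNIV \<le> k} \<subseteq> (UNIV \<rightarrow>\<^sub>E {..k})"
  proof
    fix a :: "'n \<Rightarrow> nat" assume "a \<in> {a. sum a UNIV \<le> k}"
    then have "a i \<le> k" for i using member_le_sum[of i UNIV a] by simp
    then show "a \<in> UNIV \<rightarrow>\<^sub>E {..k}" by (simp add: PiE_iff)
  qed
qed (simp add: finite_PiE)

lemma C_k_poly: "p \<in> polys m \<Longrightarrow> C_k k p"
proof -
  assume "p \<in> polys m"
  then obtain c where p: "p = (\<lambda>x. \<Sum>a | sum a UNIV \<le> m. c a * (\<Prod>i\<in>UNIV. (x $ i) ^ a i))"
    by (auto simp: polys_def fun_eq_iff)
  have pow: "C_k k (\<lambda>x :: real ^ 'n. (x $ i) ^ n)" for i n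
  proof (induction n)
    case (Suc n)
    have "C_k k (\<lambda>x :: real ^ 'n. x $ i)" using C_k_affine(1)[of k "axis i 1" 0] by (simp add: inner_axis')
    with Suc show ?case by (simp add: C_k_mult)
  qed (simp add: C_k_const)
  have "C_k k (\<lambda>x. \<Sum>a\<in>A. c a * (\<Prod>i\<in>UNIV. (x $ i) ^ a i))" if "finite A" for A
    using that
    by (induction A) (simp_all add: C_k_const C_k_add C_k_mult C_k_prod pow)
  then show ?thesis unfolding p using finite_multi_indices by blast
qed

lemma poly_map_differentiable:
  fixes F :: "real ^ 'n \<Rightarrow> real ^ 'n"
  assumes "F \<in> vec_fields (polys m)"
  shows "F differentiable_on S"
proof -
  have "(\<lambda>x. F x $ i) differentiable (at x)" for i x
    using C_k_poly[of "\<lambda>x. F x $ i" m "Suc 0"] assms by (simp add: vec_fields_def)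
  then have "(\<lambda>x. F x \<bullet> b) differentiable (at x)" if "b \<in> Basis" for b x
    using that by (auto simp: Basis_vec_def inner_axis)
  then have "F differentiable (at x)" for x
    using differentiable_componentwise_within[of F x UNIV] by simp
  then show ?thesis by (simp add: differentiable_on_def differentiable_at_withinI)
qed

definition null_on :: "(real ^ 'n) set \<Rightarrow> (real ^ 'n \<Rightarrow> 'b::real_vector) set" where
  "null_on w = {u. AE x in lebesgue_on w. u x = 0}"

text \<open>Element maps are differentiable, so they map null sets to null sets. Therefore the polynomial
  coefficients on the reference simplex determine a finite element function almost everywhere.\<close>

lemma null_on_elements:
  fixes u :: "real ^ 'n \<Rightarrow> 'b::real_vector"
  assumes T: "finite T" "\<And>F. F \<in> T \<Longrightarrow> F \<in> vec_fields (polys m)"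
    and cover: "w \<subseteq> (\<Union>F\<in>T. F ` ref_simplex)" and w: "w \<in> sets lebesgue"
    and null: "\<And>F. F \<in> T \<Longrightarrow> AE y in lebesgue_on ref_simplex. u (F y) = 0"
  shows "u \<in> null_on w"
proof -
  have "compact (ref_simplex :: (real ^ 'n) set)"
    unfolding ref_simplex_def ref_vertices_def by (intro finite_imp_compact_convex_hull) auto
  then have ref: "(ref_simplex :: (real ^ 'n) set) \<in> sets lebesgue"
    by (simp add: compact_imp_closed)
  define Z where "Z F = {y \<in> ref_simplex. u (F y) \<noteq> 0}" for F :: "real ^ 'n \<Rightarrow> real ^ 'n"
  have "negligible (Z F)" if "F \<in> T" for F
  proof -
    have "AE y in lebesgue. y \<in> ref_simplex \<longrightarrow> u (F y) = 0"
      using null[OF that] ref by (simp add: AE_restrict_space_iff)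
    then obtain N where "negligible N" "{y. \<not> (y \<in> ref_simplex \<longrightarrow> u (F y) = 0)} \<subseteq> N"
      unfolding eventually_ae_filter negligible_iff_null_sets by auto
    then show ?thesis by (rule_tac negligible_subset[of N]) (auto simp: Z_def)
  qed
  then have "negligible (F ` Z F)" if "F \<in> T" for F
    using that T(2) by (intro negligible_differentiable_image_negligible poly_map_differentiable) auto
  then have "negligible (\<Union>F\<in>T. F ` Z F)"
    using T(1) by (intro negligible_Union) auto
  moreover have "{x. \<not> (x \<in> w \<longrightarrow> u x = 0)} \<subseteq> (\<Union>F\<in>T. F ` Z F)"
    using cover unfolding Z_def by blast
  ultimately have "AE x in lebesgue. x \<in> w \<longrightarrow> u x = 0"
    unfolding eventually_ae_filter negligible_iff_null_sets by auto
  then show ?thesis using w by (simp add: null_on_def AE_restrict_space_iff)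
qed

text \<open>The coordinates of a finite element function are the polynomial coefficients on the elements that
  make up \<open>w\<close>. They are related to the function rather than computed from it: on a null set of the
  reference simplex the function is arbitrary.\<close>

theorem finite_dim_piecewise_poly:
  fixes X :: "(real ^ 'n \<Rightarrow> 'b::euclidean_space) set"
  assumes X: "subspace X" and pw: "\<And>u b. u \<in> X \<Longrightarrow> b \<in> Basis \<Longrightarrow> (\<lambda>x. u x \<bullet> b) \<in> piecewise_poly T w k"
    and T: "finite T" "\<And>F. F \<in> T \<Longrightarrow> F \<in> vec_fields (polys m)"
    and fit: "fitted T w" and w: "w \<in> sets lebesgue"
  shows "finite_dim_mod X (null_on w)"
proof -
  obtain T' where T': "T' \<subseteq> T" "(\<Union>F\<in>T'. F ` ref_simplex) = closure w"
    using fit by (auto simp: fitted_def)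
  let ?A = "{a :: 'n \<Rightarrow> nat. sum a UNIV \<le> k}"
  define K where "K = T' \<times> (Basis :: 'b set) \<times> ?A"
  have K: "finite K"
    unfolding K_def using finite_subset[OF T'(1) T(1)] finite_multi_indices
    by (intro finite_cartesian_product) auto
  define \<delta> where "\<delta> \<kappa> = (\<lambda>\<kappa>'. if \<kappa>' = \<kappa> then 1 else 0 :: real)"
    for \<kappa> :: "(real ^ 'n \<Rightarrow> real ^ 'n) \<times> 'b \<times> ('n \<Rightarrow> nat)"
  define W where "W = {c. \<forall>\<kappa>. \<kappa> \<notin> K \<longrightarrow> c \<kappa> = (0::real)}"
  have W: "W \<subseteq> span (\<delta> ` K)"
  proof
    fix c assume c: "c \<in> W"
    have "c = (\<Sum>\<kappa>\<in>K. c \<kappa> *\<^sub>R \<delta> \<kappa>)"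
      using c K by (auto simp: fun_eq_iff sum_fun_apply \<delta>_def W_def sum.delta' if_distrib cong: if_cong)
    also have "\<dots> \<in> span (\<delta> ` K)" by (intro span_sum span_scale span_base imageI)
    finally show "c \<in> span (\<delta> ` K)" .
  qed
  define rep where "rep c F b y = (\<Sum>a\<in>?A. c (F, b, a) * monomial_at a y)"
    for c :: "(real ^ 'n \<Rightarrow> real ^ 'n) \<times> 'b \<times> ('n \<Rightarrow> nat) \<Rightarrow> real" and F b y
  define R where "R = {(u, c). u \<in> X \<and> c \<in> W \<and>
    (\<forall>F\<in>T'. \<forall>b\<in>Basis. AE y in lebesgue_on ref_simplex. u (F y) \<bullet> b = rep c F b y)}"
  have rep: "rep (c + c') F b y = rep c F b y + rep c' F b y" "rep (s *\<^sub>R c) F b y = s * rep c F b y"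
      "rep 0 F b y = 0" for c c' F b y s
    by (simp_all add: rep_def algebra_simps sum.distrib sum_distrib_left)
  show ?thesis
  proof (rule finite_dim_mod_coordinates[OF X finite_imageI[OF K, of \<delta>], of R])
    show "subspace R"
    proof (rule subspaceI)
      show "0 \<in> R" using subspace_0[OF X] by (simp add: R_def zero_prod_def rep W_def)
      fix p assume p: "p \<in> R"
      show "p + q \<in> R" if q: "q \<in> R" for q
      proof -
        obtain u c v d where uv: "p = (u, c)" "q = (v, d)" by (metis surj_pair)
        have "AE y in lebesgue_on ref_simplex. (u + v) (F y) \<bullet> b = rep (c + d) F b y"
          if "F \<in> T'" "b \<in> Basis" for F b
        proof -
          have "AE y in lebesgue_on ref_simplex. u (F y) \<bullet> b = rep c F b y"
               "AE y in lebesgue_on ref_simplex. v (F y) \<bullet> b = rep d F b y"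
            using p q that by (auto simp: R_def uv)
          then show ?thesis by eventually_elim (simp add: rep inner_add_left)
        qed
        then show ?thesis using p q subspace_add[OF X] by (auto simp: R_def uv W_def)
      qed
      show "s *\<^sub>R p \<in> R" for s
      proof -
        obtain u c where u: "p = (u, c)" by (metis surj_pair)
        have "AE y in lebesgue_on ref_simplex. (s *\<^sub>R u) (F y) \<bullet> b = rep (s *\<^sub>R c) F b y"
          if "F \<in> T'" "b \<in> Basis" for F b
        proof -
          have "AE y in lebesgue_on ref_simplex. u (F y) \<bullet> b = rep c F b y"
            using p that by (auto simp: R_def u)
          then show ?thesis by eventually_elim (simp add: rep)
        qed
        then show ?thesis using p subspace_scale[OF X] by (auto simp: R_def u W_def)
      qed
    qed
    show "R \<subseteq> X \<times> span (\<delta> ` K)" using W by (auto simp: R_def)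
  next
    fix u assume u: "u \<in> X"
    define c where "c F b = (SOME c. AE y in lebesgue_on ref_simplex. u (F y) \<bullet> b = (\<Sum>a\<in>?A. c a * monomial_at a y))"
      for F :: "real ^ 'n \<Rightarrow> real ^ 'n" and b
    have c: "AE y in lebesgue_on ref_simplex. u (F y) \<bullet> b = (\<Sum>a\<in>?A. c F b a * monomial_at a y)"
      if F: "F \<in> T'" and b: "b \<in> Basis" for F b
      unfolding c_def
    proof (rule someI_ex[of "\<lambda>c. AE y in lebesgue_on ref_simplex. u (F y) \<bullet> b = (\<Sum>a\<in>?A. c a * monomial_at a y)"])
      have "F \<in> T" "F ` ref_simplex \<subseteq> closure w" using F T' by auto
      then obtain p where "p \<in> polys k" and p: "AE y in lebesgue_on ref_simplex. u (F y) \<bullet> b = p y"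
        using pw[OF u b] unfolding piecewise_poly_def by blast
      then obtain c where "\<And>y. p y = (\<Sum>a\<in>?A. c a * monomial_at a y)"
        by (auto simp: polys_def monomial_at_def)
      with p show "\<exists>c. AE y in lebesgue_on ref_simplex. u (F y) \<bullet> b = (\<Sum>a\<in>?A. c a * monomial_at a y)"
        by (intro exI[of _ c]) simp
    qed
    define d where "d = (\<lambda>(F, b, a). if (F, b, a) \<in> K then c F b a else 0)"
    have "rep d F b y = (\<Sum>a\<in>?A. c F b a * monomial_at a y)" if "F \<in> T'" "b \<in> Basis" for F b y
      using that by (simp add: rep_def d_def K_def)
    then have "(u, d) \<in> R" using u c by (auto simp: R_def W_def d_def)
    then show "\<exists>d. (u, d) \<in> R" by (rule exI[of _ d])
  next
    fix u assume R0: "(u, 0) \<in> R"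
    show "u \<in> null_on w"
    proof (rule null_on_elements[of T' m])
      show "F \<in> vec_fields (polys m)" if "F \<in> T'" for F
        using T(2) T'(1) that by blast
      show "finite T'" using T(1) T'(1) by (rule finite_subset[rotated])
      show "w \<subseteq> (\<Union>F\<in>T'. F ` ref_simplex)" unfolding T'(2) by (rule closure_subset)
      fix F assume F: "F \<in> T'"
      have "AE y in lebesgue_on ref_simplex. \<forall>b\<in>Basis. u (F y) \<bullet> b = 0"
        using R0 F by (intro AE_finite_allI) (auto simp: R_def rep)
      then show "AE y in lebesgue_on ref_simplex. u (F y) = 0"
        by eventually_elim (simp add: euclidean_all_zero_iff)
    qed (rule w)
  qed
qed


section \<open>The coupled problem\<close>

lemma subspace_polys: "subspace (polys k)"
proof (rule subspaceI)
  show "0 \<in> polys k" by (auto simp: polys_def intro!: exI[of _ "\<lambda>a. 0"])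
  fix p assume p: "p \<in> polys k"
  show "p + q \<in> polys k" if q: "q \<in> polys k" for q
  proof -
    obtain c d where "\<And>x. p x = (\<Sum>a | sum a UNIV \<le> k. c a * (\<Prod>i\<in>UNIV. (x $ i) ^ a i))"
        "\<And>x. q x = (\<Sum>a | sum a UNIV \<le> k. d a * (\<Prod>i\<in>UNIV. (x $ i) ^ a i))"
      using p q by (auto simp: polys_def)
    then show ?thesis
      by (auto simp: polys_def distrib_right sum.distrib intro!: exI[of _ "\<lambda>a. c a + d a"])
  qed
  show "s *\<^sub>R p \<in> polys k" for s
  proof -
    obtain c where "\<And>x. p x = (\<Sum>a | sum a UNIV \<le> k. c a * (\<Prod>i\<in>UNIV. (x $ i) ^ a i))"
      using p by (auto simp: polys_def)
    then show ?thesis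
      by (auto simp: polys_def sum_distrib_left mult.assoc intro!: exI[of _ "\<lambda>a. s * c a"])
  qed
qed

lemma subspace_piecewise_poly: "subspace (piecewise_poly T w k)"
proof (rule subspaceI)
  show "0 \<in> piecewise_poly T w k"
    unfolding piecewise_poly_def using subspace_0[OF subspace_polys]
    by (intro CollectI ballI impI bexI[of _ 0]) auto
  fix u assume u: "u \<in> piecewise_poly T w k"
  show "u + v \<in> piecewise_poly T w k" if v: "v \<in> piecewise_poly T w k" for v
    unfolding piecewise_poly_def
  proof (safe)
    fix F assume F: "F \<in> T" "F ` ref_simplex \<subseteq> closure w"
    obtain p q where pq: "p \<in> polys k" "AE y in lebesgue_on ref_simplex. u (F y) = p y"
        "q \<in> polys k" "AE y in lebesgue_on ref_simplex. v (F y) = q y"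
      using u v F unfolding piecewise_poly_def by blast
    have "AE y in lebesgue_on ref_simplex. (u + v) (F y) = (p + q) y"
      using pq(2,4) by eventually_elim simp
    then show "\<exists>p\<in>polys k. AE y in lebesgue_on ref_simplex. (u + v) (F y) = p y"
      using subspace_add[OF subspace_polys pq(1,3)] by blast
  qed
  show "s *\<^sub>R u \<in> piecewise_poly T w k" for s
    unfolding piecewise_poly_def
  proof (safe)
    fix F assume F: "F \<in> T" "F ` ref_simplex \<subseteq> closure w"
    obtain p where p: "p \<in> polys k" "AE y in lebesgue_on ref_simplex. u (F y) = p y"
      using u F unfolding piecewise_poly_def by blast
    have "AE y in lebesgue_on ref_simplex. (s *\<^sub>R u) (F y) = (s *\<^sub>R p) y"
      using p(2) by eventually_elim simp
    then show "\<exists>p\<in>polys k. AE y in lebesgue_on ref_simplex. (s *\<^sub>R u) (F y) = p y"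
      using subspace_scale[OF subspace_polys p(1)] by blast
  qed
qed

lemma lipschitz_domain_region: "lipschitz_domain D \<Longrightarrow> region D"
  by (simp add: lipschitz_domain_def region_def)

lemma vec_fields_mono: "X \<subseteq> Y \<Longrightarrow> vec_fields X \<subseteq> vec_fields Y"
  by (auto simp: vec_fields_def)

text \<open>Bilinearity is the one property that the two- and three-dimensional cross products must share for
  the argument to cover both.\<close>

locale fsi_bilinear = fsi rot \<Omega> \<Omega>s T Rey \<gamma> dt
  for rot :: "'r::euclidean_space \<Rightarrow> real ^ 'n \<Rightarrow> real ^ 'n" and \<Omega> \<Omega>s T Rey \<gamma> dt +
  assumes bilinear_rot: "bilinear rot"
begin

sublocale whole: region \<Omega> by (rule lipschitz_domain_region[OF domain])
sublocale solid: region \<Omega>s by (rule lipschitz_domain_region[OF solid_domain])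
sublocale fluid: region \<Omega>f using lipschitz_domain_region[OF fluid_domain] by (simp add: \<Omega>f_def)

lemma mass_coeff_pos: "0 < mass_coeff"
  using params_pos by (simp add: mass_coeff_def)

lemma solid_sub: "\<Omega>s \<subseteq> \<Omega>"
  using solid_inside closure_subset by blast

lemma fluid_sub: "\<Omega>f \<subseteq> \<Omega>"
  by (auto simp: \<Omega>f_def)

subsection \<open>The pressure norm\<close>

text \<open>Evaluating the pressure norm at \<open>p\<close> means to split \<open>p = m + c w\<close> with \<open>A w = M m\<close> and
  \<open>c = Re / (\<gamma> \<Delta>t)\<close>. Inserting \<open>m = p - c w\<close> gives \<open>A w + c M w = M p\<close>, a Neumann problem with
  a zero-order term. Its form \<open>E\<close> below is an inner product on zero-mean \<open>H\<^sup>1\<close> functions that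
  dominates the \<open>L\<^sup>2\<close> norm because \<open>c > 0\<close>, so the Riesz theorem solves it.\<close>

abbreviation "H1Q \<equiv> H1 \<Omega>f \<inter> Q"
abbreviation "E \<equiv> fluid.H1_inner mass_coeff"

definition solves :: "(real ^ 'n \<Rightarrow> real) \<Rightarrow> (real ^ 'n \<Rightarrow> real) \<Rightarrow> bool" where
  "solves p z \<longleftrightarrow> z \<in> H1Q \<and> (\<forall>q\<in>H1Q. E z q = L2_inner \<Omega>f p q)"

sublocale E: complete_semi_inner H1Q E
  unfolding Q_def by (rule fluid.H1_complete[OF mass_coeff_pos])

lemma subspace_Q: "subspace Q"
  unfolding Q_def by (rule fluid.subspace_L2_0)

lemma Q_L2: "q \<in> Q \<Longrightarrow> q \<in> L2 \<Omega>f"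
  by (simp add: Q_def L2_0_def)

lemma solves_exists:
  assumes "p \<in> Q"
  shows "\<exists>z. solves p z"
proof -
  have lin: "linear_form_on H1Q (L2_inner \<Omega>f p)"
    using assms by (intro linear_form_onI) (auto simp: L2.add_right L2.scale_right Q_L2)
  have "\<bar>L2_inner \<Omega>f p q\<bar> \<le> (sqrt (L2_inner \<Omega>f p p) / sqrt mass_coeff) * sqrt (E q q)" if "q \<in> H1Q" for q
  proof -
    have "L2_inner \<Omega>f q q * mass_coeff \<le> E q q"
      using that L2.nonneg[OF fluid.H1_grad(1), of q] by (simp add: fluid.H1_inner_def)
    then have "sqrt (L2_inner \<Omega>f q q) \<le> sqrt (E q q) / sqrt mass_coeff"
      using mass_coeff_pos by (simp add: pos_le_divide_eq flip: real_sqrt_mult real_sqrt_divide)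
    then have "sqrt (L2_inner \<Omega>f p p) * sqrt (L2_inner \<Omega>f q q) \<le>
        sqrt (L2_inner \<Omega>f p p) * (sqrt (E q q) / sqrt mass_coeff)"
      using L2.nonneg[OF Q_L2[OF assms]] by (intro mult_left_mono) auto
    then show ?thesis
      using L2.Cauchy_Schwarz_abs[OF Q_L2[OF assms] Q_L2, of q] that by simp
  qed
  from E.Riesz[OF lin this] show ?thesis by (auto simp: solves_def)
qed

lemma solves_in: "solves p z \<Longrightarrow> z \<in> Q" "solves p z \<Longrightarrow> z \<in> H1 \<Omega>f"
  by (auto simp: solves_def)

lemma solves_add: "solves p z \<Longrightarrow> solves p' z' \<Longrightarrow> p \<in> Q \<Longrightarrow> p' \<in> Q \<Longrightarrow> solves (p + p') (z + z')"
  by (auto simp: solves_def E.closed E.add_left L2.add_left Q_L2 fluid.H1_add subspace_add[OF subspace_Q])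

lemma solves_scale: "solves p z \<Longrightarrow> p \<in> Q \<Longrightarrow> solves (c *\<^sub>R p) (c *\<^sub>R z)"
  by (auto simp: solves_def E.scale_left L2.scale_left Q_L2 fluid.H1_scale subspace_scale[OF subspace_Q])

text \<open>The solution \<open>z\<close> provides a splitting of \<open>p\<close>. Conversely, the second summand \<open>v\<close> of any splitting
  solves the same Neumann problem, so \<open>v = z\<close> almost everywhere and the functional is the same.\<close>

lemma S_tilde_eq:
  assumes p: "p \<in> Q" and z: "solves p z"
  shows "S_tilde p = M_op (p - mass_coeff *\<^sub>R z)"
proof -
  have A_inv: "A_inverse (M_op m) v" if m: "m \<in> Q" "m = p - mass_coeff *\<^sub>R v" and v: "solves p v" for m v
  proof -
    have "L2_inner \<Omega>f (grad \<Omega>f v) (grad \<Omega>f q) = L2_inner \<Omega>f m q" if q: "q \<in> H1Q" for q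
    proof -
      have "L2_inner \<Omega>f m q = L2_inner \<Omega>f p q - mass_coeff * L2_inner \<Omega>f v q"
        unfolding m(2) using p solves_in[OF v] q
        by (simp add: L2.diff_left L2.scale_left Q_L2 subspace_scale[OF subspace_L2])
      also have "L2_inner \<Omega>f p q = E v q" using v q by (simp add: solves_def)
      finally show ?thesis by (simp add: fluid.H1_inner_def)
    qed
    then show ?thesis using v by (simp add: A_inverse_def M_op_def solves_def)
  qed
  let ?m = "p - mass_coeff *\<^sub>R z"
  have mQ: "?m \<in> Q" using p solves_in[OF z] by (simp add: subspace_diff[OF subspace_Q] subspace_scale[OF subspace_Q])
  show ?thesis
    unfolding S_tilde_def
  proof (rule the_equality)
    show "\<exists>m\<in>Q. \<exists>w. M_op m = M_op ?m \<and> A_inverse (M_op ?m) w \<and> (AE x in lebesgue_on \<Omega>f. m x + mass_coeff * w x = p x)"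
      using mQ A_inv[OF mQ refl z] by (intro bexI[of _ ?m] exI[of _ z]) auto
  next
    fix g assume "\<exists>m\<in>Q. \<exists>w. M_op m = g \<and> A_inverse g w \<and> (AE x in lebesgue_on \<Omega>f. m x + mass_coeff * w x = p x)"
    then obtain m v where m: "m \<in> Q" "M_op m = g" "A_inverse (M_op m) v"
        "AE x in lebesgue_on \<Omega>f. m x + mass_coeff * v x = p x" by blast
    have v: "v \<in> H1Q" using m(3) by (simp add: A_inverse_def)
    have "E v q = L2_inner \<Omega>f p q" if q: "q \<in> H1Q" for q
    proof -
      have "L2_inner \<Omega>f p q = L2_inner \<Omega>f (m + mass_coeff *\<^sub>R v) q"
        using m(4) p m(1) v q
        by (intro L2_inner_cong) (auto simp: Q_L2 subspace_add[OF subspace_L2] subspace_scale[OF subspace_L2] elim!: eventually_mono)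
      also have "\<dots> = M_op m q + mass_coeff * L2_inner \<Omega>f v q"
        using m(1) v q by (simp add: M_op_def L2.add_left L2.scale_left Q_L2 subspace_scale[OF subspace_L2])
      also have "M_op m q = L2_inner \<Omega>f (grad \<Omega>f v) (grad \<Omega>f q)"
        using m(3) q by (simp add: A_inverse_def)
      finally show ?thesis by (simp add: fluid.H1_inner_def)
    qed
    then have d: "E (v - z) q = 0" if "q \<in> H1Q" for q
      using that v z by (simp add: solves_def E.diff_left)
    have dH: "v - z \<in> H1Q" using v z E.closed by (simp add: solves_def)
    have "L2_inner \<Omega>f (v - z) (v - z) = 0"
      using d[OF dH] L2.nonneg[OF fluid.H1_grad(1), of "v - z"] L2.nonneg[OF Q_L2, of "v - z"] dH mass_coeff_pos
      by (simp add: fluid.H1_inner_def add_nonneg_eq_0_iff)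
    then have "AE x in lebesgue_on \<Omega>f. (v - z) x = 0"
      by (rule L2_inner_self_eq_0[OF Q_L2[OF IntD2[OF dH]]])
    then have ae: "AE x in lebesgue_on \<Omega>f. m x = ?m x"
      using m(4) by eventually_elim auto
    show "g = M_op ?m"
      unfolding m(2)[symmetric] M_op_def
    proof (rule restrict_ext)
      fix q assume "q \<in> Q"
      then show "L2_inner \<Omega>f m q = L2_inner \<Omega>f ?m q"
        using ae mQ m(1) by (intro L2_inner_cong) (auto intro: Q_L2)
    qed
  qed
qed

lemma S_tilde_apply:
  assumes "p \<in> Q" "solves p z" "q \<in> Q"
  shows "S_tilde p q = L2_inner \<Omega>f p q - mass_coeff * L2_inner \<Omega>f z q"
  using assms solves_in[OF assms(2)]
  by (simp add: S_tilde_eq M_op_def L2.diff_left L2.scale_left Q_L2 subspace_scale[OF subspace_L2])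

text \<open>Symmetry is that of the solution operator \<open>p \<mapsto> z\<close>: if \<open>z'\<close> solves the
  problem for \<open>q\<close>, then \<open>(p, z') = E z z' = (q, z)\<close>. Positivity
  comes from \<open>\<langle>S p, p\<rangle> = \<parallel>m\<parallel>\<^sup>2 + c \<parallel>\<nabla>z\<parallel>\<^sup>2\<close> for \<open>m = p - c z\<close>.\<close>

lemma S_tilde_semi_inner: "semi_inner Q S_tilde"
proof (unfold_locales, goal_cases)
  case 1 show ?case by (rule subspace_Q)
next
  case (2 p p' q)
  obtain z z' where "solves p z" "solves p' z'" using 2 solves_exists by blast
  then show ?case
    using 2 solves_add[of p z p' z'] solves_in[of _ z] solves_in[of _ z']
    by (simp add: S_tilde_apply subspace_add[OF subspace_Q] L2.add_left Q_L2 algebra_simps)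
next
  case (3 c p q)
  obtain z where "solves p z" using 3 solves_exists by blast
  then show ?case
    using 3 solves_scale[of p z c] solves_in[of _ z]
    by (simp add: S_tilde_apply subspace_scale[OF subspace_Q] L2.scale_left Q_L2 algebra_simps)
next
  case (4 p q)
  obtain z z' where z: "solves p z" "solves q z'" using 4 solves_exists by blast
  have "L2_inner \<Omega>f p z' = E z z'" "L2_inner \<Omega>f q z = E z' z" using z by (auto simp: solves_def)
  moreover have "E z z' = E z' z" using z by (intro E.sym) (auto simp: solves_def)
  moreover have "L2_inner \<Omega>f z q = L2_inner \<Omega>f q z" "L2_inner \<Omega>f z' p = L2_inner \<Omega>f p z'"
      "L2_inner \<Omega>f p q = L2_inner \<Omega>f q p"
    using 4 z solves_in by (auto intro!: L2.sym Q_L2)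
  ultimately show ?case using 4 z by (simp add: S_tilde_apply)
next
  case (5 p)
  obtain z where z: "solves p z" using 5 solves_exists by blast
  let ?m = "p - mass_coeff *\<^sub>R z"
  have L: "p \<in> L2 \<Omega>f" "z \<in> L2 \<Omega>f" "mass_coeff *\<^sub>R z \<in> L2 \<Omega>f" "?m \<in> L2 \<Omega>f"
    using 5 solves_in[OF z] by (auto simp: Q_L2 subspace_scale[OF subspace_L2] subspace_diff[OF subspace_L2])
  have "E z z = L2_inner \<Omega>f p z" using z by (simp add: solves_def)
  then have "L2_inner \<Omega>f ?m z = L2_inner \<Omega>f (grad \<Omega>f z) (grad \<Omega>f z)"
    using L by (simp add: fluid.H1_inner_def L2.diff_left L2.scale_left)
  moreover have "S_tilde p p = L2_inner \<Omega>f ?m ?m + mass_coeff * L2_inner \<Omega>f ?m z"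
    using 5 z L L2.sym[OF L(1,2)]
    by (simp add: S_tilde_apply L2.diff_left L2.diff_right L2.scale_left L2.scale_right algebra_simps)
  ultimately show ?case
    using mass_coeff_pos L2.nonneg[OF L(4)] L2.nonneg[OF fluid.H1_grad(1)[OF solves_in(2)[OF z]]] by simp
qed

sublocale S: semi_inner Q S_tilde by (rule S_tilde_semi_inner)

lemma S_tilde_null:
  assumes "q \<in> Q" "q \<in> null_on \<Omega>f"
  shows "S_tilde q q = 0"
proof -
  obtain z where z: "solves q z" using assms solves_exists by blast
  have "L2_inner \<Omega>f q q = 0" using assms(2) by (intro L2_inner_null) (simp add: null_on_def)
  then have "L2_inner \<Omega>f q z = 0" "L2_inner \<Omega>f q q = 0"
    using L2.null_orthogonal[OF Q_L2[OF assms(1)] Q_L2[OF solves_in(1)[OF z]]] by auto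
  then show ?thesis
    using assms(1) z solves_in(1)[OF z] L2.sym[of q \<Omega>f z] by (simp add: S_tilde_apply Q_L2)
qed


subsection \<open>The forms on the discrete spaces\<close>

sublocale C: semi_inner solid.H1v c_form
proof -
  have "c_form = solid.elastic mass_coeff" by (simp add: fun_eq_iff c_form_def solid.elastic_def)
  then show "semi_inner solid.H1v c_form" using solid.elastic_semi_inner mass_coeff_pos by simp
qed

sublocale D: semi_inner whole.H1v "whole.elastic mass_coeff"
  using whole.elastic_semi_inner mass_coeff_pos by simp

lemma c_form_null: "u \<in> solid.H1v \<Longrightarrow> u \<in> null_on \<Omega>s \<Longrightarrow> c_form u u = 0"
  using solid.elastic_null[of u mass_coeff] by (simp add: null_on_def c_form_def solid.elastic_def)

lemma V_norm2_eq: "V_norm2 u = whole.elastic mass_coeff u u"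
  by (simp add: V_norm2_def whole.elastic_def)

lemma V_h_H1v: "u \<in> V_h \<Longrightarrow> u \<in> whole.H1v"
  using vec_fields_mono[of "H1_0 \<Omega>" "H1 \<Omega>"] whole.H1_0_H1 by (auto simp: V_h_def V_def)

lemma whole_solid_H1v: "u \<in> whole.H1v \<Longrightarrow> u \<in> solid.H1v"
  using solid.H1_restrict[OF _ solid_sub] by (auto simp: vec_fields_def)

lemma Lam_h_H1v: "l \<in> Lam_h \<Longrightarrow> l \<in> solid.H1v"
  by (simp add: Lam_h_def Lam_def)

lemma Q_h_Q: "q \<in> Q_h \<Longrightarrow> q \<in> Q"
  by (simp add: Q_h_def)

lemma const_H1v: "(\<lambda>x. U) \<in> solid.H1v"
  using solid.affine_H1[of 0] by (simp add: vec_fields_def)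

text \<open>Each component of a rotation field is affine; its gradient comes from the adjoint of
  \<open>r \<mapsto> \<omega> \<times> r\<close>.\<close>

lemma rotation_H1v: "rotation \<omega> \<in> solid.H1v"
proof -
  have l: "linear (rot \<omega>)" using bilinear_rot by (simp add: bilinear_def)
  have eq: "(\<lambda>x. rotation \<omega> x $ i) = (\<lambda>x. adjoint (rot \<omega>) (axis i 1) \<bullet> x + (- (adjoint (rot \<omega>) (axis i 1) \<bullet> centroid \<Omega>s)))" for i
  proof
    fix x
    have "rotation \<omega> x $ i = axis i 1 \<bullet> rot \<omega> (x - centroid \<Omega>s)" by (simp add: rotation_def inner_axis')
    also have "\<dots> = (x - centroid \<Omega>s) \<bullet> adjoint (rot \<omega>) (axis i 1)"
      using adjoint_works[OF l] by (simp add: inner_commute)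
    finally show "rotation \<omega> x $ i = adjoint (rot \<omega>) (axis i 1) \<bullet> x + (- (adjoint (rot \<omega>) (axis i 1) \<bullet> centroid \<Omega>s))"
      by (simp add: inner_diff_left inner_commute)
  qed
  show ?thesis unfolding vec_fields_def mem_Collect_eq eq by (intro allI solid.affine_H1)
qed

definition slip_of :: "('n, 'r) xvec \<Rightarrow> real ^ 'n \<Rightarrow> real ^ 'n" where
  "slip_of = (\<lambda>(u, U, \<omega>). slip u U \<omega>)"

lemma slip_of_H1v: "x \<in> X_h \<Longrightarrow> slip_of x \<in> solid.H1v"
proof -
  assume x: "x \<in> X_h"
  obtain u U \<omega> where xe: "x = (u, U, \<omega>)" by (metis surj_pair)
  have "slip_of x = u - (\<lambda>y. U) - rotation \<omega>" by (simp add: fun_eq_iff slip_of_def slip_def xe)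
  moreover have "u \<in> solid.H1v" using x xe V_h_H1v whole_solid_H1v by (auto simp: X_h_def)
  ultimately show ?thesis using const_H1v rotation_H1v C.closed by simp
qed

lemma slip_of_linear: "slip_of (x + y) = slip_of x + slip_of y" "slip_of (c *\<^sub>R x) = c *\<^sub>R slip_of x"
proof -
  have "rot (a + b) r = rot a r + rot b r" "rot (c *\<^sub>R a) r = c *\<^sub>R rot a r" for a b r c
    using bilinear_rot by (auto simp: bilinear_def linear_iff)
  then show "slip_of (x + y) = slip_of x + slip_of y" "slip_of (c *\<^sub>R x) = c *\<^sub>R slip_of x"
    by (auto simp: fun_eq_iff slip_of_def slip_def rotation_def algebra_simps split: prod.split)
qed

lemma subspace_V_h: "subspace V_h"
  unfolding V_h_def V_def
  by (intro subspace_inter subspace_vec_fields whole.subspace_H1_0 subspace_piecewise_poly)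

lemma subspace_Lam_h: "subspace Lam_h"
  unfolding Lam_h_def Lam_def
  by (intro subspace_inter subspace_vec_fields solid.subspace_H1 subspace_piecewise_poly)

lemma subspace_Q_h: "subspace Q_h"
proof -
  have "subspace {q :: real ^ 'n \<Rightarrow> real. continuous_on (closure \<Omega>f) q}"
    by (auto simp: subspace_def zero_fun_def plus_fun_def scaleR_fun_def intro: continuous_intros)
  moreover have "Q_h = Q \<inter> {q. continuous_on (closure \<Omega>f) q} \<inter> piecewise_poly T \<Omega>f 1"
    by (auto simp: Q_h_def)
  ultimately show ?thesis by (simp add: subspace_inter subspace_Q subspace_piecewise_poly)
qed

lemma subspace_X_h: "subspace X_h"
  unfolding X_h_def by (intro subspace_Times subspace_V_h) auto

lemma subspace_Y_h: "subspace Y_h"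
  unfolding Y_h_def by (intro subspace_Times subspace_Q_h subspace_Lam_h)

lemma mesh_props: "finite T" "F \<in> T \<Longrightarrow> F \<in> vec_fields (polys 2)"
  using mesh by (auto simp: isoparametric_mesh_def)

lemma vec_fields_inner_Basis:
  assumes "u \<in> vec_fields Z" "b \<in> Basis"
  shows "(\<lambda>x. u x \<bullet> b) \<in> Z"
  using assms by (auto simp: vec_fields_def Basis_vec_def inner_axis)

lemma finite_dim_X_h: "finite_dim_mod X_h (null_on \<Omega> \<times> {0})"
proof -
  have "fitted T \<Omega>" using mesh by (auto simp: fitted_def isoparametric_mesh_def)
  then have "finite_dim_mod V_h (null_on \<Omega>)"
    by (intro finite_dim_piecewise_poly[where k = 2, OF subspace_V_h _ mesh_props(1) mesh_props(2)])
       (auto simp: V_h_def vec_fields_inner_Basis)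
  then show ?thesis
    unfolding X_h_def UNIV_Times_UNIV
    by (intro finite_dim_mod_Times finite_dim_mod_UNIV subspace_0[OF subspace_V_h]) auto
qed

lemma finite_dim_Y_h: "finite_dim_mod Y_h (null_on \<Omega>f \<times> null_on \<Omega>s)"
proof -
  have "finite_dim_mod Q_h (null_on \<Omega>f)"
    using mesh_fitted(2)[folded \<Omega>f_def]
    by (intro finite_dim_piecewise_poly[where k = 1, OF subspace_Q_h _ mesh_props(1) mesh_props(2)])
       (auto simp: Q_h_def)
  moreover have "finite_dim_mod Lam_h (null_on \<Omega>s)"
    using mesh_fitted(1)
    by (intro finite_dim_piecewise_poly[where k = 2, OF subspace_Lam_h _ mesh_props(1) mesh_props(2)])
       (auto simp: Lam_h_def vec_fields_inner_Basis)
  ultimately show ?thesis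
    unfolding Y_h_def by (intro finite_dim_mod_Times subspace_0 subspace_Q_h subspace_Lam_h)
qed

lemma form_A_eq: "form_A x y = whole.elastic mass_coeff (fst x) (fst y) + c_form (slip_of x) (slip_of y)"
  by (simp add: form_A_def m_form_def a_form_def whole.elastic_def slip_of_def split: prod.split)

lemma X_h_H1v: "x \<in> X_h \<Longrightarrow> fst x \<in> whole.H1v"
  using V_h_H1v by (auto simp: X_h_def)

lemma form_A_null:
  assumes "x \<in> X_h" "x \<in> null_on \<Omega> \<times> {0}"
  shows "form_A x x = 0"
proof -
  obtain u where u: "x = (u, 0)" "u \<in> null_on \<Omega>" using assms(2) by auto
  have "rot 0 r = 0" for r using bilinear_rot by (simp add: bilinear_lzero)
  then have "slip_of x = u" by (simp add: u slip_of_def slip_def rotation_def fun_eq_iff zero_prod_def)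
  moreover have "u \<in> null_on \<Omega>s"
    using u(2) AE_mono_region[OF _ solid_sub] by (auto simp: null_on_def)
  moreover have "u \<in> whole.H1v" using X_h_H1v[OF assms(1)] u by simp
  ultimately show ?thesis
    using u whole_solid_H1v by (simp add: form_A_eq c_form_null whole.elastic_null null_on_def)
qed

sublocale A: finite_dim_semi_inner X_h form_A "null_on \<Omega> \<times> {0}"
proof (unfold_locales, goal_cases)
  case 1 show ?case by (rule subspace_X_h)
next
  case (2 x y z)
  then show ?case by (simp add: form_A_eq slip_of_linear C.add_left D.add_left X_h_H1v slip_of_H1v)
next
  case (3 c x z)
  then show ?case by (simp add: form_A_eq slip_of_linear C.scale_left D.scale_left X_h_H1v slip_of_H1v distrib_left)
next
  case (4 x y)
  then show ?case using C.sym D.sym by (simp add: form_A_eq X_h_H1v slip_of_H1v)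
next
  case (5 x)
  then show ?case by (simp add: form_A_eq C.nonneg D.nonneg X_h_H1v slip_of_H1v)
next
  case 6 show ?case by (rule finite_dim_X_h)
next
  case (7 x) then show ?case by (rule form_A_null)
qed

lemma form_B_eq: "form_B x y = - L2_inner \<Omega>f (fst y) (divergence \<Omega> (fst x)) + c_form (snd y) (slip_of x)"
  by (simp add: form_B_def b_form_def L2_inner_def slip_of_def split: prod.split)

lemma divergence_L2_fluid: "u \<in> whole.H1v \<Longrightarrow> divergence \<Omega> u \<in> L2 \<Omega>f"
  using L2_mono[OF whole.divergence_L2 fluid_sub] by simp

lemma Y_h_D: "y \<in> Y_h \<Longrightarrow> fst y \<in> Q" "y \<in> Y_h \<Longrightarrow> fst y \<in> L2 \<Omega>f" "y \<in> Y_h \<Longrightarrow> snd y \<in> solid.H1v"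
  using Q_h_Q Q_L2 Lam_h_H1v by (auto simp: Y_h_def)

lemma form_B_linear_left:
  assumes y: "y \<in> Y_h"
  shows "linear_form_on X_h (\<lambda>x. form_B x y)"
proof (rule linear_form_onI)
  fix x x' assume x: "x \<in> X_h" "x' \<in> X_h"
  have "AE z in lebesgue_on \<Omega>f. divergence \<Omega> (fst x + fst x') z = (divergence \<Omega> (fst x) + divergence \<Omega> (fst x')) z"
    using AE_mono_region[OF whole.divergence_add fluid_sub] x X_h_H1v by simp
  then have "L2_inner \<Omega>f (fst y) (divergence \<Omega> (fst x + fst x')) = L2_inner \<Omega>f (fst y) (divergence \<Omega> (fst x) + divergence \<Omega> (fst x'))"
    using x y X_h_H1v D.closed
    by (intro L2_inner_cong) (auto simp: Y_h_D divergence_L2_fluid subspace_add[OF subspace_L2])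
  then show "form_B (x + x') y = form_B x y + form_B x' y"
    using x y by (simp add: form_B_eq slip_of_linear C.add_right L2.add_right Y_h_D slip_of_H1v divergence_L2_fluid X_h_H1v)
next
  fix c x assume x: "x \<in> X_h"
  have "AE z in lebesgue_on \<Omega>f. divergence \<Omega> (c *\<^sub>R fst x) z = (c *\<^sub>R divergence \<Omega> (fst x)) z"
    using AE_mono_region[OF whole.divergence_scale fluid_sub] x X_h_H1v by simp
  then have "L2_inner \<Omega>f (fst y) (divergence \<Omega> (c *\<^sub>R fst x)) = L2_inner \<Omega>f (fst y) (c *\<^sub>R divergence \<Omega> (fst x))"
    using x y X_h_H1v D.closed
    by (intro L2_inner_cong) (auto simp: Y_h_D divergence_L2_fluid subspace_scale[OF subspace_L2])
  then show "form_B (c *\<^sub>R x) y = c * form_B x y"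
    using x y by (simp add: form_B_eq slip_of_linear C.scale_right L2.scale_right Y_h_D slip_of_H1v divergence_L2_fluid X_h_H1v algebra_simps)
qed

lemma form_B_linear_right:
  assumes x: "x \<in> X_h"
  shows "linear_form_on Y_h (form_B x)"
  using x by (intro linear_form_onI)
    (simp_all add: form_B_eq C.add_left L2.add_left C.scale_left L2.scale_left Y_h_D slip_of_H1v divergence_L2_fluid X_h_H1v algebra_simps)

text \<open>The bilinear form of the block-diagonal preconditioner.\<close>

definition form_P :: "'n yvec \<Rightarrow> 'n yvec \<Rightarrow> real" where
  "form_P y z = S_tilde (fst y) (fst z) + c_form (snd y) (snd z)"

sublocale P: finite_dim_semi_inner Y_h form_P "null_on \<Omega>f \<times> null_on \<Omega>s"
proof (unfold_locales, goal_cases)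
  case 1 show ?case by (rule subspace_Y_h)
next
  case (2 x y z)
  then show ?case by (simp add: form_P_def S.add_left C.add_left Y_h_D)
next
  case (3 c x z)
  then show ?case by (simp add: form_P_def S.scale_left C.scale_left Y_h_D distrib_left)
next
  case (4 x y)
  then show ?case using S.sym C.sym by (simp add: form_P_def Y_h_D)
next
  case (5 x)
  then show ?case by (simp add: form_P_def S.nonneg C.nonneg Y_h_D)
next
  case 6 show ?case by (rule finite_dim_Y_h)
next
  case (7 x)
  then have "fst x \<in> null_on \<Omega>f" "snd x \<in> null_on \<Omega>s" by (auto simp: mem_Times_iff)
  then show ?case using 7(1) by (simp add: form_P_def S_tilde_null c_form_null Y_h_D)
qed

lemma Y_norm2_eq: "Y_norm2 y = form_P y y"
  by (simp add: Y_norm2_def form_P_def Q_norm2_def Lam_norm2_def split: prod.split)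

lemma precond_eq: "precond y = (\<lambda>z\<in>Y_h. form_P y z)"
  by (simp add: precond_def form_P_def split_beta')

lemma X_norm2_nonneg: "x \<in> X_h \<Longrightarrow> 0 \<le> X_norm2 x"
  using D.nonneg V_h_H1v C.nonneg const_H1v rotation_H1v
  by (auto simp: X_norm2_def V_norm2_eq T_norm2_def R_norm2_def X_h_def)

lemma Y_nonzero_eq: "Y_nonzero = Y_h - (null_on \<Omega>f \<times> null_on \<Omega>s)"
  by (auto simp: Y_nonzero_def Y_eq_def null_on_def)

lemma Y_eq_iff: "Y_eq y z \<longleftrightarrow> y - z \<in> null_on \<Omega>f \<times> null_on \<Omega>s"
  by (auto simp: Y_eq_def null_on_def split: prod.split)

end


section \<open>The preconditioned Schur complement\<close>

locale fsi_stable = fsi_bilinear rot \<Omega> \<Omega>s T Rey \<gamma> dt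
  for rot :: "'r::euclidean_space \<Rightarrow> real ^ 'n \<Rightarrow> real ^ 'n" and \<Omega> \<Omega>s T Rey \<gamma> dt +
  fixes \<alpha> C\<^sub>a C\<^sub>b \<beta> :: real
  assumes constants_pos: "0 < \<alpha>" "0 < C\<^sub>a" "0 < C\<^sub>b" "0 < \<beta>"
    and stable: "stability_bounds \<alpha> C\<^sub>a C\<^sub>b"
    and inf_sup: "inf_sup_constant = ereal \<beta>"
begin

lemma form_A_bounds:
  assumes "x \<in> X_h"
  shows "\<alpha> * X_norm2 x \<le> form_A x x" "form_A x x \<le> C\<^sub>a * X_norm2 x"
proof -
  obtain u U \<omega> where x: "x = (u, U, \<omega>)" by (metis surj_pair)
  have "u \<in> V_h" "0 \<in> Q_h" "0 \<in> Lam_h"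
    using assms subspace_0[OF subspace_Q_h] subspace_0[OF subspace_Lam_h] by (auto simp: x X_h_def)
  then show "\<alpha> * X_norm2 x \<le> form_A x x" "form_A x x \<le> C\<^sub>a * X_norm2 x"
    using stable unfolding stability_bounds_def Let_def by (simp_all add: x X_norm2_def form_A_def)
qed

lemma form_B_bound:
  assumes "x \<in> X_h" "y \<in> Y_h"
  shows "\<bar>form_B x y\<bar> \<le> C\<^sub>b * sqrt (form_P y y) * sqrt (X_norm2 x)"
proof -
  obtain u U \<omega> where x: "x = (u, U, \<omega>)" by (metis surj_pair)
  obtain q \<mu> where y: "y = (q, \<mu>)" by (metis surj_pair)
  have "u \<in> V_h" "q \<in> Q_h" "\<mu> \<in> Lam_h" using assms by (auto simp: x y X_h_def Y_h_def)
  then show ?thesis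
    using stable unfolding stability_bounds_def Let_def Y_norm2_eq[symmetric]
    by (simp add: x y X_norm2_def Y_norm2_def form_B_def)
qed

text \<open>The infimum over all \<open>y\<close> in the inf-sup condition is used at one \<open>y\<close>, where it bounds
  \<open>\<beta>\<close> by every upper bound of the quotients in \<open>x\<close>.\<close>

lemma inf_sup_le:
  assumes y: "y \<in> Y_nonzero"
    and "\<And>x. x \<in> X_nonzero \<Longrightarrow> form_B x y / (sqrt (form_P y y) * sqrt (X_norm2 x)) \<le> c"
  shows "\<beta> \<le> c"
proof -
  have "ereal \<beta> \<le> (SUP x \<in> X_nonzero. ereal (form_B x y / (sqrt (Y_norm2 y) * sqrt (X_norm2 x))))"
    unfolding inf_sup[symmetric] inf_sup_constant_def using y by (rule INF_lower)
  also have "\<dots> \<le> ereal c"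
    using assms(2) by (intro SUP_least) (simp add: Y_norm2_eq)
  finally show ?thesis by simp
qed

text \<open>The inf-sup condition forces the norm on \<open>Y_h\<close> to be definite. Where the norm is zero, every
  quotient is a division by zero, that is zero, and \<open>\<beta>\<close> could not be positive.\<close>

lemma form_P_pos:
  assumes y: "y \<in> Y_nonzero"
  shows "0 < form_P y y"
proof (rule ccontr)
  assume "\<not> 0 < form_P y y"
  moreover have "0 \<le> form_P y y" using y by (intro P.nonneg) (simp add: Y_nonzero_def)
  ultimately have "form_P y y = 0" by simp
  then have "\<beta> \<le> 0" by (intro inf_sup_le[OF y]) simp
  then show False using constants_pos by simp
qed

text \<open>An infimum over the empty set would be \<open>\<infinity>\<close>.\<close>

lemma Y_nonzero_nonempty: "Y_nonzero \<noteq> {}"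
  using inf_sup by (auto simp: inf_sup_constant_def top_ereal_def)

text \<open>The element \<open>A\<^sup>-\<^sup>1 B\<^sup>T y\<close> of \<open>X_h\<close>.\<close>

definition lift :: "'n yvec \<Rightarrow> ('n, 'r) xvec" where
  "lift y = inv_into X_h A_op (B_transpose y)"

text \<open>The form \<open>A\<close> may have a kernel, but there \<open>X_norm2\<close> vanishes by coercivity, and so does
  \<open>B\<^sup>T y\<close> by the bound on \<open>B\<close>. Hence \<open>B\<^sup>T y\<close> lies in the range of \<open>A\<close>.\<close>

lemma lift:
  assumes y: "y \<in> Y_h"
  shows "lift y \<in> X_h" "x \<in> X_h \<Longrightarrow> form_A (lift y) x = form_B x y"
proof -
  have "form_B x y = 0" if x: "x \<in> X_h" "form_A x x = 0" for x
  proof -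
    have "X_norm2 x = 0"
      using form_A_bounds(1)[OF x(1)] X_norm2_nonneg[OF x(1)] x(2) constants_pos(1)
      by (simp add: mult_le_0_iff)
    then show ?thesis using form_B_bound[OF x(1) y] by simp
  qed
  from A.finite_dim_Riesz[OF form_B_linear_left[OF y] this]
  obtain v where v: "v \<in> X_h" "\<forall>x\<in>X_h. form_A v x = form_B x y" by auto
  have "A_op v = B_transpose y"
    using v y by (auto simp: A_op_def B_transpose_def B_op_def fun_eq_iff)
  then have im: "B_transpose y \<in> A_op ` X_h" using v(1) by (intro image_eqI[where x = v]) simp_all
  show "lift y \<in> X_h" unfolding lift_def by (rule inv_into_into[OF im])
  have "A_op (lift y) = B_transpose y" unfolding lift_def by (rule f_inv_into_f[OF im])
  then have "A_op (lift y) x = B_transpose y x" for x by simp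
  then show "x \<in> X_h \<Longrightarrow> form_A (lift y) x = form_B x y"
    using y by (simp add: A_op_def B_transpose_def B_op_def split: if_splits) metis
qed

definition schur_form :: "'n yvec \<Rightarrow> 'n yvec \<Rightarrow> real" where
  "schur_form y z = form_B (lift y) z"

lemma schur_eq: "schur y = (\<lambda>z\<in>Y_h. schur_form y z)"
  by (simp add: schur_def B_op_def schur_form_def lift_def)

text \<open>With \<open>x = A\<^sup>-\<^sup>1 B\<^sup>T y\<close> and \<open>x' = A\<^sup>-\<^sup>1 B\<^sup>T z\<close>, the Schur complement satisfies
  \<open>\<langle>S y, z\<rangle> = \<langle>B x, z\<rangle> = \<langle>A x', x\<rangle>\<close>, which makes it symmetric and positive semidefinite.\<close>

lemma schur_form_A: "y \<in> Y_h \<Longrightarrow> z \<in> Y_h \<Longrightarrow> schur_form y z = form_A (lift y) (lift z)"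
  using lift[of y] lift[of z] A.sym[of "lift y" "lift z"] by (simp add: schur_form_def)

lemma schur_form_linear: "y \<in> Y_h \<Longrightarrow> linear_form_on Y_h (schur_form y)"
  unfolding schur_form_def by (intro form_B_linear_right lift)

lemma schur_form_sym: "y \<in> Y_h \<Longrightarrow> z \<in> Y_h \<Longrightarrow> schur_form y z = schur_form z y"
  using schur_form_A[of y z] schur_form_A[of z y] A.sym[OF lift(1) lift(1), of y z] by simp

text \<open>For \<open>x = A\<^sup>-\<^sup>1 B\<^sup>T y\<close> and \<open>s = \<langle>S y, y\<rangle> = \<langle>A x, x\<rangle>\<close>, the bound on \<open>B\<close> and coercivity
  give \<open>s\<^sup>2 = \<langle>B x, y\<rangle>\<^sup>2 \<le> C\<^sub>b\<^sup>2 \<parallel>y\<parallel>\<^sup>2 \<parallel>x\<parallel>\<^sup>2 \<le> C\<^sub>b\<^sup>2 \<parallel>y\<parallel>\<^sup>2 s / \<alpha>\<close>.\<close>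

lemma schur_form_upper:
  assumes y: "y \<in> Y_h"
  shows "schur_form y y \<le> C\<^sub>b\<^sup>2 / \<alpha> * form_P y y"
proof -
  define s where "s = schur_form y y"
  have s: "s = form_A (lift y) (lift y)" using schur_form_A[OF y y] by (simp add: s_def)
  have s0: "0 \<le> s" unfolding s by (rule A.nonneg[OF lift(1)[OF y]])
  have P0: "0 \<le> form_P y y" by (rule P.nonneg[OF y])
  have X: "0 \<le> X_norm2 (lift y)" "X_norm2 (lift y) \<le> s / \<alpha>"
    using X_norm2_nonneg[OF lift(1)[OF y]] form_A_bounds(1)[OF lift(1)[OF y]] constants_pos(1)
    by (simp_all add: s pos_le_divide_eq mult.commute)
  have "\<bar>s\<bar>\<^sup>2 \<le> (C\<^sub>b * sqrt (form_P y y) * sqrt (X_norm2 (lift y)))\<^sup>2"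
    using form_B_bound[OF lift(1)[OF y] y] by (intro power_mono) (auto simp: s_def schur_form_def)
  also have "\<dots> = C\<^sub>b\<^sup>2 * form_P y y * X_norm2 (lift y)"
    using P0 X(1) by (simp add: power_mult_distrib)
  also have "\<dots> \<le> C\<^sub>b\<^sup>2 * form_P y y * (s / \<alpha>)"
    using P0 X(2) by (intro mult_left_mono) auto
  finally have le: "s * s \<le> (C\<^sub>b\<^sup>2 / \<alpha> * form_P y y) * s"
    by (simp add: power2_eq_square field_simps)
  show ?thesis
  proof (cases "s = 0")
    case True
    then show ?thesis using P0 constants_pos(1) by (simp add: s_def)
  next
    case False
    then show ?thesis using mult_right_le_imp_le[OF le] s0 by (simp add: s_def)
  qed
qed

text \<open>For \<open>x = A\<^sup>-\<^sup>1 B\<^sup>T y\<close> and any \<open>v\<close>, the Cauchy--Schwarz inequality for \<open>A\<close> gives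
  \<open>\<langle>B v, y\<rangle> = \<langle>A x, v\<rangle> \<le> \<langle>S y, y\<rangle>\<^sup>1\<^sup>/\<^sup>2 (C\<^sub>a \<parallel>v\<parallel>\<^sup>2)\<^sup>1\<^sup>/\<^sup>2\<close>. The supremum over \<open>v\<close> of
  \<open>\<langle>B v, y\<rangle> / (\<parallel>y\<parallel> \<parallel>v\<parallel>)\<close> is at least \<open>\<beta>\<close>.\<close>

lemma schur_form_lower:
  assumes y: "y \<in> Y_nonzero"
  shows "\<beta>\<^sup>2 / C\<^sub>a * form_P y y \<le> schur_form y y"
proof -
  have yY: "y \<in> Y_h" using y by (simp add: Y_nonzero_def)
  define s where "s = schur_form y y"
  have s: "s = form_A (lift y) (lift y)" using schur_form_A[OF yY yY] by (simp add: s_def)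
  have s0: "0 \<le> s" unfolding s by (rule A.nonneg[OF lift(1)[OF yY]])
  note P0 = form_P_pos[OF y]
  have "\<beta> \<le> sqrt (s * C\<^sub>a) / sqrt (form_P y y)"
  proof (rule inf_sup_le[OF y])
    fix x assume "x \<in> X_nonzero"
    then have x: "x \<in> X_h" by (simp add: X_nonzero_def)
    have "form_B x y \<le> sqrt s * sqrt (form_A x x)"
      using A.Cauchy_Schwarz_abs[OF lift(1)[OF yY] x] lift(2)[OF yY x] by (simp add: s)
    also have "\<dots> \<le> sqrt s * sqrt (C\<^sub>a * X_norm2 x)"
      using form_A_bounds(2)[OF x] s0 by (intro mult_left_mono) auto
    finally have "form_B x y \<le> sqrt (s * C\<^sub>a) * sqrt (X_norm2 x)"
      by (simp add: real_sqrt_mult)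
    moreover have "0 \<le> sqrt (s * C\<^sub>a) / sqrt (form_P y y)"
      using s0 constants_pos(2) P0 by simp
    ultimately show "form_B x y / (sqrt (form_P y y) * sqrt (X_norm2 x)) \<le> sqrt (s * C\<^sub>a) / sqrt (form_P y y)"
      using X_norm2_nonneg[OF x] P0 by (cases "X_norm2 x = 0") (simp_all add: field_simps)
  qed
  then have "\<beta>\<^sup>2 \<le> (sqrt (s * C\<^sub>a) / sqrt (form_P y y))\<^sup>2"
    using constants_pos(4) by (intro power_mono) auto
  also have "\<dots> = s * C\<^sub>a / form_P y y"
    using s0 constants_pos(2) P0 by (simp add: power_divide)
  finally show ?thesis
    unfolding s_def[symmetric] using P0 constants_pos(2) by (simp add: field_simps)
qed

sublocale spectrum: relative_spectrum Y_h form_P "null_on \<Omega>f \<times> null_on \<Omega>s" schur_form "C\<^sub>b\<^sup>2 / \<alpha>"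
proof (unfold_locales, goal_cases)
  case 1 show ?case by (rule subspace_Y_h)
next
  case (2 x y z)
  then show ?case
    using schur_form_linear[of z] subspace_add[OF subspace_Y_h, of x y] schur_form_sym[of _ z]
    by (simp add: linear_form_on_def)
next
  case (3 c x z)
  then show ?case
    using schur_form_linear[of z] subspace_scale[OF subspace_Y_h, of x c] schur_form_sym[of _ z]
    by (simp add: linear_form_on_def)
next
  case (4 x y) then show ?case by (rule schur_form_sym)
next
  case (5 x) then show ?case using schur_form_A[of x x] A.nonneg[OF lift(1), of x] by simp
next
  case (6 x) then show ?case by (rule schur_form_upper)
qed

text \<open>The functional \<open>S y\<close> vanishes on the kernel of the preconditioner, again by the bound on \<open>B\<close>, so
  it is in the range of the preconditioner.\<close>

lemma precond_schur:
  assumes y: "y \<in> Y_h"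
  shows "precond_schur y \<in> Y_h" "z \<in> Y_h \<Longrightarrow> form_P (precond_schur y) z = schur_form y z"
proof -
  have "schur_form y z = 0" if "z \<in> Y_h" "form_P z z = 0" for z
    using form_B_bound[OF lift(1)[OF y] that(1)] that(2) by (simp add: schur_form_def)
  from P.finite_dim_Riesz[OF schur_form_linear[OF y] this]
  obtain v where v: "v \<in> Y_h" "\<forall>z\<in>Y_h. form_P v z = schur_form y z" by auto
  have "precond v = schur y" using v by (auto simp: precond_eq schur_eq fun_eq_iff)
  then have im: "schur y \<in> precond ` Y_h" using v(1) by (intro image_eqI[where x = v]) simp_all
  show "precond_schur y \<in> Y_h" unfolding precond_schur_def by (rule inv_into_into[OF im])
  have "precond (precond_schur y) = schur y" unfolding precond_schur_def by (rule f_inv_into_f[OF im])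
  then have "precond (precond_schur y) z = schur y z" by simp
  then show "z \<in> Y_h \<Longrightarrow> form_P (precond_schur y) z = schur_form y z"
    by (simp add: precond_eq schur_eq)
qed

text \<open>Both inclusions compare \<open>z\<close>, the image of \<open>y\<close> under the preconditioned operator, with \<open>l y\<close>.
  That \<open>z - l y\<close> is null and that it is in the kernel of \<open>form_P\<close> are equivalent because the norm on
  \<open>Y_h\<close> is definite.\<close>

lemma eigenvalues_eq: "eigenvalues = relative_eigenvalues Y_h form_P schur_form"
proof (intro equalityI subsetI)
  fix l assume "l \<in> eigenvalues"
  then obtain q \<mu> where y: "(q, \<mu>) \<in> Y_nonzero"
      and eq: "Y_eq (precond_schur (q, \<mu>)) (\<lambda>x. l * q x, \<lambda>x. l *\<^sub>R \<mu> x)"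
    by (auto simp: eigenvalues_def)
  let ?y = "(q, \<mu>)" and ?z = "precond_schur (q, \<mu>)"
  have yY: "?y \<in> Y_h" using y by (simp add: Y_nonzero_def)
  have zY: "?z \<in> Y_h" by (rule precond_schur(1)[OF yY])
  have d: "?z - l *\<^sub>R ?y \<in> null_on \<Omega>f \<times> null_on \<Omega>s"
    using eq by (simp add: Y_eq_iff scaleR_fun_def)
  have dY: "?z - l *\<^sub>R ?y \<in> Y_h" using zY yY P.closed by blast
  have "schur_form ?y v = l * form_P ?y v" if v: "v \<in> Y_h" for v
    using P.null_orthogonal[OF dY v P.null[OF dY d]] precond_schur(2)[OF yY v] zY yY v
    by (simp add: P.diff_left P.scale_left P.closed del: scaleR_Pair)
  then show "l \<in> relative_eigenvalues Y_h form_P schur_form"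
    using yY form_P_pos[OF y] by (auto simp: relative_eigenvalues_def)
next
  fix l assume "l \<in> relative_eigenvalues Y_h form_P schur_form"
  then obtain y where y: "y \<in> Y_h" "0 < form_P y y" "\<And>v. v \<in> Y_h \<Longrightarrow> schur_form y v = l * form_P y v"
    unfolding relative_eigenvalues_def by blast
  have yn: "y \<in> Y_nonzero" using y P.null[OF y(1)] by (auto simp: Y_nonzero_eq)
  let ?d = "precond_schur y - l *\<^sub>R y"
  have zY: "precond_schur y \<in> Y_h" by (rule precond_schur(1)[OF y(1)])
  have dY: "?d \<in> Y_h" using zY y(1) P.closed by blast
  have "form_P ?d ?d = 0"
    using precond_schur(2)[OF y(1) dY] y(3)[OF dY] zY y(1) dY
    by (subst P.diff_left) (simp_all add: P.scale_left P.closed)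
  then have "?d \<in> null_on \<Omega>f \<times> null_on \<Omega>s"
    using form_P_pos[of ?d] dY by (auto simp: Y_nonzero_eq)
  moreover have "l *\<^sub>R y = (\<lambda>x. l * fst y x, \<lambda>x. l *\<^sub>R snd y x)"
    by (simp add: prod_eq_iff fun_eq_iff)
  ultimately have "Y_eq (precond_schur y) (\<lambda>x. l * fst y x, \<lambda>x. l *\<^sub>R snd y x)"
    by (simp add: Y_eq_iff)
  then show "l \<in> eigenvalues"
    using yn by (auto simp: eigenvalues_def split_beta' intro!: bexI[of _ y])
qed

theorem condition_number_bound: "condition_number \<le> C\<^sub>b\<^sup>2 * C\<^sub>a / (\<alpha> * \<beta>\<^sup>2)"
proof -
  have fin: "finite eigenvalues"
    unfolding eigenvalues_eq by (rule spectrum.finite_relative_eigenvalues)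
  obtain y0 where "y0 \<in> Y_nonzero" using Y_nonzero_nonempty by blast
  then have ne: "eigenvalues \<noteq> {}"
    unfolding eigenvalues_eq
    using form_P_pos by (intro spectrum.relative_eigenvalues_nonempty[of y0]) (auto simp: Y_nonzero_def)
  have bounds: "\<beta>\<^sup>2 / C\<^sub>a \<le> l" "l \<le> C\<^sub>b\<^sup>2 / \<alpha>" if l: "l \<in> eigenvalues" for l
  proof -
    obtain y where y: "y \<in> Y_h" "0 < form_P y y" "schur_form y y = l * form_P y y"
      using l unfolding eigenvalues_eq relative_eigenvalues_def by blast
    have "y \<in> Y_nonzero" using y P.null[OF y(1)] by (auto simp: Y_nonzero_eq)
    then have le: "\<beta>\<^sup>2 / C\<^sub>a * form_P y y \<le> l * form_P y y" "l * form_P y y \<le> C\<^sub>b\<^sup>2 / \<alpha> * form_P y y"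
      using schur_form_lower[of y] schur_form_upper[OF y(1)] unfolding y(3) by blast+
    show "\<beta>\<^sup>2 / C\<^sub>a \<le> l" "l \<le> C\<^sub>b\<^sup>2 / \<alpha>"
      using mult_right_le_imp_le[OF le(1) y(2)] mult_right_le_imp_le[OF le(2) y(2)] .
  qed
  have "condition_number \<le> (C\<^sub>b\<^sup>2 / \<alpha>) / (\<beta>\<^sup>2 / C\<^sub>a)"
    unfolding condition_number_def
    using bounds Max_in[OF fin ne] Min_in[OF fin ne] constants_pos
    by (intro frac_le) auto
  also have "\<dots> = C\<^sub>b\<^sup>2 * C\<^sub>a / (\<alpha> * \<beta>\<^sup>2)" by simp
  finally show ?thesis .
qed

end

lemma bilinear_rot2: "bilinear rot2"
  by (auto simp: bilinear_def rot2_def linear_iff vec_eq_iff forall_2 algebra_simps)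

theorem corollary5p3:
  fixes \<alpha> C\<^sub>a C\<^sub>b \<beta> :: real
  assumes "\<alpha> > 0" "C\<^sub>a > 0" "C\<^sub>b > 0" "\<beta> > 0"
  shows "\<exists>C :: real.
    (\<forall>(\<Omega> :: (real ^ 2) set) \<Omega>s T Rey \<gamma> dt.
       fsi \<Omega> \<Omega>s T Rey \<gamma> dt \<longrightarrow>
       fsi.stability_bounds rot2 \<Omega> \<Omega>s T Rey \<gamma> dt \<alpha> C\<^sub>a C\<^sub>b \<longrightarrow>
       fsi.inf_sup_constant rot2 \<Omega> \<Omega>s T Rey \<gamma> dt = ereal \<beta> \<longrightarrow>
       fsi.condition_number rot2 \<Omega> \<Omega>s T Rey \<gamma> dt \<le> C) \<and>
    (\<forall>(\<Omega> :: (real ^ 3) set) \<Omega>s T Rey \<gamma> dt.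
       fsi \<Omega> \<Omega>s T Rey \<gamma> dt \<longrightarrow>
       fsi.stability_bounds cross3 \<Omega> \<Omega>s T Rey \<gamma> dt \<alpha> C\<^sub>a C\<^sub>b \<longrightarrow>
       fsi.inf_sup_constant cross3 \<Omega> \<Omega>s T Rey \<gamma> dt = ereal \<beta> \<longrightarrow>
       fsi.condition_number cross3 \<Omega> \<Omega>s T Rey \<gamma> dt \<le> C)"
proof (intro exI conjI allI impI)
  fix \<Omega> \<Omega>s :: "(real ^ 2) set" and T Rey \<gamma> dt
  assume "fsi \<Omega> \<Omega>s T Rey \<gamma> dt" "fsi.stability_bounds rot2 \<Omega> \<Omega>s T Rey \<gamma> dt \<alpha> C\<^sub>a C\<^sub>b"
    "fsi.inf_sup_constant rot2 \<Omega> \<Omega>s T Rey \<gamma> dt = ereal \<beta>"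
  then interpret fsi_stable rot2 \<Omega> \<Omega>s T Rey \<gamma> dt \<alpha> C\<^sub>a C\<^sub>b \<beta>
    using assms bilinear_rot2
    by (intro fsi_stable.intro fsi_bilinear.intro fsi_bilinear_axioms.intro fsi_stable_axioms.intro)
  show "fsi.condition_number rot2 \<Omega> \<Omega>s T Rey \<gamma> dt \<le> C\<^sub>b\<^sup>2 * C\<^sub>a / (\<alpha> * \<beta>\<^sup>2)"
    by (rule condition_number_bound)
next
  fix \<Omega> \<Omega>s :: "(real ^ 3) set" and T Rey \<gamma> dt
  assume "fsi \<Omega> \<Omega>s T Rey \<gamma> dt" "fsi.stability_bounds cross3 \<Omega> \<Omega>s T Rey \<gamma> dt \<alpha> C\<^sub>a C\<^sub>b"
    "fsi.inf_sup_constant cross3 \<Omega> \<Omega>s T Rey \<gamma> dt = ereal \<beta>"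
  then interpret fsi_stable cross3 \<Omega> \<Omega>s T Rey \<gamma> dt \<alpha> C\<^sub>a C\<^sub>b \<beta>
    using assms bilinear_cross
    by (intro fsi_stable.intro fsi_bilinear.intro fsi_bilinear_axioms.intro fsi_stable_axioms.intro)
  show "fsi.condition_number cross3 \<Omega> \<Omega>s T Rey \<gamma> dt \<le> C\<^sub>b\<^sup>2 * C\<^sub>a / (\<alpha> * \<beta>\<^sup>2)"
    by (rule condition_number_bound)
qed

end
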